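(* Let $s\ge 0$ be a real number, let $q\geq 3$ be an integer, and let $T$ be an invertible bounded operator on a Banach space whose spectrum is contained in $E_{1/q}$. Suppose that $$\|T^{n}\| = O(n^{s}),\quad n\to+\infty,$$ and that $$\|T^{-n}\| = O\big(e^{n^{\beta}}\big),\quad n\to+\infty,\ \text{ for some real } \beta< b(1/q).$$ Then $$\|T^{-n}\| = O(n^{s}),\quad n\to+\infty.$$
   Context: Banach spaces are complex. $\mathbb{T}$ is the unit circle in $\mathbb{C}$. For $\xi\in(0,1/2)$, the perfect symmetric set associated with $\xi$ is $$E_{\xi}=\Big\{\exp\Big(2i\pi(1-\xi)\sum_{n=1}^{+\infty}\epsilon_n\xi^{n-1}\Big):\ \epsilon_n\in\{0,1\}\ (n\ge 1)\Big\}\subset\mathbb{T},$$ and $$b(\xi)=\frac{\log\frac1\xi-\log 2}{2\log\frac1\xi-\log 2}.$$ *)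

theory Defs
  imports "HOL-Analysis.Analysis" "HOL-Library.Landau_Symbols"
begin

text \<open>The library only has real Banach spaces.  A complex Banach space is a real one with a
  compatible complex scalar multiplication for which the same norm is homogeneous.\<close>

class complex_banach = banach +
  fixes scaleC :: "complex \<Rightarrow> 'a \<Rightarrow> 'a"  (infixr \<open>*\<^sub>C\<close> 75)
  assumes scaleC_add_right: "a *\<^sub>C (x + y) = a *\<^sub>C x + a *\<^sub>C y"
    and scaleC_add_left: "(a + b) *\<^sub>C x = a *\<^sub>C x + b *\<^sub>C x"
    and scaleC_scaleC: "a *\<^sub>C b *\<^sub>C x = (a * b) *\<^sub>C x"
    and scaleR_scaleC: "r *\<^sub>R x = complex_of_real r *\<^sub>C x"
    and norm_scaleC: "norm (a *\<^sub>C x) = cmod a * norm x"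

instantiation complex :: complex_banach
begin

definition scaleC_complex :: "complex \<Rightarrow> complex \<Rightarrow> complex" where
  "scaleC_complex = (*)"

instance
  by standard (simp_all add: scaleC_complex_def algebra_simps norm_mult scaleR_conv_of_real)

end

definition bounded_clinear :: "('a::complex_banach \<Rightarrow> 'b::complex_banach) \<Rightarrow> bool" where
  "bounded_clinear f \<longleftrightarrow> bounded_linear f \<and> (\<forall>c x. f (c *\<^sub>C x) = c *\<^sub>C f x)"

text \<open>Invertibility is in the algebra of bounded operators: the inverse has to be bounded too.\<close>

definition invertible_operator :: "('a::complex_banach \<Rightarrow> 'a) \<Rightarrow> bool" where
  "invertible_operator f \<longleftrightarrow>
     bounded_clinear f \<and> (\<exists>g. bounded_clinear g \<and> g \<circ> f = id \<and> f \<circ> g = id)"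

definition spectrum :: "('a::complex_banach \<Rightarrow> 'a) \<Rightarrow> complex set" where
  "spectrum f = {z. \<not> invertible_operator (\<lambda>x. f x - z *\<^sub>C x)}"

definition perfect_symmetric_set :: "real \<Rightarrow> complex set" where
  "perfect_symmetric_set \<xi> =
     {exp (2 * \<i> * complex_of_real (pi * (1 - \<xi>) * (\<Sum>n. \<epsilon> (Suc n) * \<xi> ^ n))) | \<epsilon> :: nat \<Rightarrow> real.
        \<forall>n\<ge>1. \<epsilon> n \<in> {0, 1}}"

definition growth_exponent :: "real \<Rightarrow> real" where
  "growth_exponent \<xi> = (ln (1 / \<xi>) - ln 2) / (2 * ln (1 / \<xi>) - ln 2)"

end

theory Submission
  imports Defs "HOL-Complex_Analysis.Complex_Analysis" "HOL-Real_Asymp.Real_Asymp"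
begin

text \<open>
  Digit expansions in base \<open>q\<close> give \<open>z ^ q \<in> E\<close> for all \<open>z \<in> E\<close>, where \<open>E\<close> is the perfect symmetric
  set of ratio \<open>1 / q\<close>. Suppose that \<open>f z = (\<Sum>l. f\<^sub>l z\<^sup>l)\<close> is holomorphic in the disc, \<open>f\<^sub>0 \<noteq> 0\<close>,
  \<open>(\<Sum>l. \<bar>f\<^sub>l\<bar> l\<^sup>s) < \<infinity>\<close>, and that \<open>f (T ^ N) = 0\<close> for all powers \<open>N\<close> of \<open>q\<close>. Then
  \<open>- f\<^sub>0 T\<^sup>-\<^sup>n = (\<Sum>l\<ge>1. f\<^sub>l T ^ (l N - n))\<close>; with \<open>n \<le> N \<le> q n\<close> only positive powers of \<open>T\<close> occur,
  and the bound on \<open>T\<^sup>n\<close> gives the bound on \<open>T\<^sup>-\<^sup>n\<close>.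

  Such an \<open>f\<close> exists. The growth of \<open>T\<^sup>-\<^sup>n\<close> bounds the resolvent inside the disc by
  \<open>exp (B \<delta> ^ (- \<alpha>))\<close> at distance \<open>\<delta>\<close> from the circle, with \<open>\<alpha> = \<beta> / (1 - \<beta>)\<close>. The condition
  \<open>\<beta> < b (1 / q)\<close> says exactly that \<open>\<alpha> < 1 - ln 2 / ln q\<close>, one minus the dimension of \<open>E\<close>; this
  leaves room for a function \<open>f\<close> that is bounded by \<open>exp (- c dist (z, E) ^ (- a))\<close> for some
  \<open>a > \<alpha>\<close>, namely \<open>f = exp (- \<Phi>)\<close> with \<open>\<Phi>\<close> a sum of terms \<open>(1 - cnj \<zeta> z) powr (- \<sigma>)\<close> over
  roots of unity \<open>\<zeta> \<in> E\<close>. Writing \<open>f (r T)\<close> as a Cauchy integral and deforming the contour into the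
  boundaries of \<open>q\<^sup>k\<close> small cells, the cells that miss \<open>E\<close> contribute nothing and the others are dominated by the
  decay of \<open>f\<close>, so that \<open>f (T) = 0\<close>. The same applies to \<open>f (z ^ N)\<close>, which is just as flat on \<open>E\<close>.
\<close>

section \<open>Separation of points by bounded functionals\<close>

text \<open>The obstacle is that the growth of the powers of \<open>T\<close> bounds the resolvent
  only in terms of the distance to the circle, whereas contours around the pieces of
  \<open>E\<close> must cross the circle. They cross it in gaps of \<open>E\<close>, and a maximum
  principle on discs centred there (\<open>holomorphic_bound_across_line\<close>) carries the bound
  over the crossing at the cost of a constant in the exponent. This requires \<alpha> < 1, which
  holds since b(1/q) < 1/2. The q^k cells of level k have width q^-k, so their perimeters have a
  bounded sum, and the dimension of \<open>E\<close> enters only through the construction of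
  \<open>f\<close>. The series of \<open>f\<close> is controlled only in the disc, so the Cauchy
  integral uses f(r z), with log(1/r) proportional to the cell height; then r tends to 1. The
  computation treats one functional and one vector at a time, and Hahn-Banach gives the operator
  statement. For f(z^N) the constant in the flatness bound degrades like N^-a. This does no harm:
  only the qualitative fact f(T^N) = 0 is used for each N, and the final estimate involves the
  coefficients of \<open>f\<close>, which do not depend on N.\<close>

definition sublinear :: "('a::real_normed_vector \<Rightarrow> real) \<Rightarrow> bool" where
  "sublinear p \<longleftrightarrow> (\<forall>x y. p (x + y) \<le> p x + p y) \<and> (\<forall>t x. t \<ge> 0 \<longrightarrow> p (t *\<^sub>R x) = t * p x)"

lemma sublinear_add: "sublinear p \<Longrightarrow> p (x + y) \<le> p x + p y"
  and sublinear_scaleR: "sublinear p \<Longrightarrow> t \<ge> 0 \<Longrightarrow> p (t *\<^sub>R x) = t * p x"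
  by (auto simp: sublinear_def)

lemma sublinear_zero: "sublinear p \<Longrightarrow> p 0 = 0"
  using sublinear_scaleR[of p 0 0] by simp

lemma sublinear_minus: "sublinear p \<Longrightarrow> - p (- x) \<le> p x"
  using sublinear_add[of p x "- x"] sublinear_zero[of p] by simp

text \<open>Tilting lowers a sublinear functional unless it is odd, so a minimal one is linear; this
  replaces the extension of functionals from subspaces in the Hahn-Banach theorem.\<close>

lemma sublinear_tilt:
  fixes p :: "'a::real_normed_vector \<Rightarrow> real"
  assumes p: "sublinear p"
  obtains p' where "sublinear p'" "\<And>x. p' x \<le> p x" "p' (- y) \<le> - p y"
proof
  \<comment> \<open>Write x = (x + t y) + t (- y) and assign the value \<open>- p y\<close> to
    \<open>- y\<close>: the infimum is the largest sublinear functional below \<open>p\<close> with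
    value at most \<open>- p y\<close> at \<open>- y\<close>.\<close>
  define p' where "p' x = (INF t\<in>{0..}. p (x + t *\<^sub>R y) - t * p y)" for x
  have lower: "- p (- x) \<le> p (x + t *\<^sub>R y) - t * p y" if "t \<ge> 0" for x t
    using sublinear_add[OF p, of "x + t *\<^sub>R y" "- x"] sublinear_scaleR[OF p that] by simp
  then have bdd: "bdd_below ((\<lambda>t. p (x + t *\<^sub>R y) - t * p y) ` {0..})" for x
    by (auto intro!: bdd_belowI2)
  have p'_le: "p' x \<le> p (x + t *\<^sub>R y) - t * p y" if "t \<ge> 0" for x t
    unfolding p'_def using that by (intro cINF_lower bdd) auto
  show "p' x \<le> p x" for x
    using p'_le[of 0 x] by simp
  show "p' (- y) \<le> - p y"
    using p'_le[of 1 "- y"] by (simp add: sublinear_zero[OF p])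
  have geI: "c \<le> p' x" if "\<And>t. t \<ge> 0 \<Longrightarrow> c \<le> p (x + t *\<^sub>R y) - t * p y" for c x
    unfolding p'_def using that by (intro cINF_greatest) auto
  have add: "p' (x + z) \<le> p' x + p' z" for x z
  proof -
    have "p' (x + z) - (p (z + r *\<^sub>R y) - r * p y) \<le> p' x" if "r \<ge> 0" for r
    proof (rule geI)
      fix t :: real assume "t \<ge> 0"
      have "p' (x + z) \<le> p ((x + z) + (t + r) *\<^sub>R y) - (t + r) * p y"
        using \<open>t \<ge> 0\<close> that by (intro p'_le) auto
      also have "(x + z) + (t + r) *\<^sub>R y = (x + t *\<^sub>R y) + (z + r *\<^sub>R y)"
        by (simp add: algebra_simps)
      finally show "p' (x + z) - (p (z + r *\<^sub>R y) - r * p y) \<le> p (x + t *\<^sub>R y) - t * p y"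
        using sublinear_add[OF p, of "x + t *\<^sub>R y" "z + r *\<^sub>R y"] by (simp add: algebra_simps)
    qed
    then have "p' (x + z) - p' x \<le> p' z"
      by (intro geI) (force simp: algebra_simps)
    then show ?thesis by simp
  qed
  have scale_le: "p' (c *\<^sub>R x) \<le> c * p' x" if "c > 0" for c x
  proof -
    have "p' (c *\<^sub>R x) / c \<le> p' x"
    proof (rule geI)
      fix t :: real assume "t \<ge> 0"
      have "p' (c *\<^sub>R x) \<le> p (c *\<^sub>R x + (c * t) *\<^sub>R y) - (c * t) * p y"
        using that \<open>t \<ge> 0\<close> by (intro p'_le) auto
      also have "c *\<^sub>R x + (c * t) *\<^sub>R y = c *\<^sub>R (x + t *\<^sub>R y)"
        by (simp add: algebra_simps)
      finally show "p' (c *\<^sub>R x) / c \<le> p (x + t *\<^sub>R y) - t * p y"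
        using that sublinear_scaleR[OF p, of c "x + t *\<^sub>R y"] by (simp add: field_simps)
    qed
    then show ?thesis using that by (simp add: field_simps)
  qed
  have scale: "p' (c *\<^sub>R x) = c * p' x" if "c > 0" for c x
  proof (rule antisym[OF scale_le[OF that]])
    have "p' ((1/c) *\<^sub>R (c *\<^sub>R x)) \<le> (1/c) * p' (c *\<^sub>R x)"
      using that by (intro scale_le) auto
    then show "c * p' x \<le> p' (c *\<^sub>R x)" using that by (simp add: field_simps)
  qed
  have "p' 0 = 0"
  proof (rule antisym)
    show "p' 0 \<le> 0" using p'_le[of 0 0] by (simp add: sublinear_zero[OF p])
    show "0 \<le> p' 0" using lower[of _ 0] by (intro geI) (simp add: sublinear_zero[OF p])
  qed
  then have "p' (t *\<^sub>R x) = t * p' x" if "t \<ge> 0" for t x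
    using that scale[of t x] by (cases "t = 0") auto
  with add show "sublinear p'" by (simp add: sublinear_def)
qed

text \<open>Zorn's lemma gives a minimal sublinear functional \<open>m\<close> below
  \<open>p0\<close>. Tilting \<open>m\<close> at \<open>y\<close> yields a smaller one, hence
  \<open>m\<close> itself, so \<open>m (- y) = - m y\<close>; an odd sublinear functional is
  additive and homogeneous for all real scalars.\<close>

lemma sublinear_dominates_linear:
  fixes p0 :: "'a::real_normed_vector \<Rightarrow> real"
  assumes p0: "sublinear p0"
  obtains p where "linear p" "\<And>x. p x \<le> p0 x"
proof -
  define A where "A = {p. sublinear p \<and> (\<forall>x. p x \<le> p0 x)}"
  \<comment> \<open>The order is reversed: the maximal element given by
    \<open>predicate_Zorn\<close> is a pointwise minimal functional, and the upper bound of a chain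
    is its infimum.\<close>
  define P where "P p r \<longleftrightarrow> (\<forall>x. r x \<le> p x)" for p r :: "'a \<Rightarrow> real"
  have po: "partial_order_on A (relation_of P A)"
    by (rule partial_order_on_relation_ofI) (auto simp: P_def fun_eq_iff intro: order_trans antisym)
  have "\<exists>m\<in>A. \<forall>r\<in>A. P m r \<longrightarrow> r = m"
  proof (rule predicate_Zorn[OF po])
    fix C assume C: "C \<in> Chains (relation_of P A)"
    then have CA: "C \<subseteq> A" and chain: "\<And>p r. p \<in> C \<Longrightarrow> r \<in> C \<Longrightarrow> P p r \<or> P r p"
      by (auto simp: Chains_def relation_of_def)
    show "\<exists>u\<in>A. \<forall>a\<in>C. P a u"
    proof (cases "C = {}")
      case True
      with p0 show ?thesis by (auto simp: A_def)
    next
      case False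
      define u where "u x = (INF p\<in>C. p x)" for x
      have lower: "- p0 (- x) \<le> p x" if "p \<in> C" for p x
      proof -
        have "sublinear p" "p (- x) \<le> p0 (- x)" using that CA by (auto simp: A_def)
        then show ?thesis using sublinear_minus[of p x] by linarith
      qed
      then have bdd: "bdd_below ((\<lambda>p. p x) ` C)" for x by (auto intro!: bdd_belowI2)
      have u_le: "u x \<le> p x" if "p \<in> C" for p x
        unfolding u_def using that by (intro cINF_lower bdd)
      have u_ge: "c \<le> u x" if "\<And>p. p \<in> C \<Longrightarrow> c \<le> p x" for c x
        unfolding u_def using that False by (intro cINF_greatest) auto
      have sub: "sublinear p" if "p \<in> C" for p using CA that by (auto simp: A_def)
      have "u (x + y) \<le> u x + u y" for x y
      proof -
        \<comment> \<open>An infimum of sublinear functionals need not be subadditive; in a chain,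
          the smaller of \<open>p\<close> and \<open>r\<close> serves for both \<open>x\<close> and
          \<open>y\<close>.\<close>
        have *: "u (x + y) \<le> p x + r y" if pr: "p \<in> C" "r \<in> C" for p r
        proof -
          from chain[OF pr] show ?thesis
          proof
            assume "P p r"
            then have "r x \<le> p x" by (simp add: P_def)
            with u_le[OF pr(2), of "x + y"] sublinear_add[OF sub[OF pr(2)], of x y]
            show ?thesis by linarith
          next
            assume "P r p"
            then have "p y \<le> r y" by (simp add: P_def)
            with u_le[OF pr(1), of "x + y"] sublinear_add[OF sub[OF pr(1)], of x y]
            show ?thesis by linarith
          qed
        qed
        have "u (x + y) - r y \<le> u x" if "r \<in> C" for r
          using *[OF _ that] by (intro u_ge) (simp add: algebra_simps)
        then have "u (x + y) - u x \<le> u y" by (intro u_ge) (force simp: algebra_simps)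
        then show ?thesis by simp
      qed
      moreover have "u (t *\<^sub>R x) = t * u x" if "t \<ge> 0" for t x
      proof (cases "t = 0")
        case True
        have "u 0 = 0"
          unfolding u_def using False sub by (simp add: sublinear_zero cong: INF_cong)
        with True show ?thesis by simp
      next
        case False
        with that have t: "t > 0" by simp
        show ?thesis
        proof (rule antisym)
          have "u (t *\<^sub>R x) / t \<le> u x"
            using t by (intro u_ge) (metis sub u_le sublinear_scaleR that pos_divide_le_eq mult.commute)
          then show "u (t *\<^sub>R x) \<le> t * u x" using t by (simp add: field_simps)
          show "t * u x \<le> u (t *\<^sub>R x)"
            using t by (intro u_ge) (simp add: sub u_le sublinear_scaleR)
        qed
      qed
      ultimately have "sublinear u" by (simp add: sublinear_def)
      moreover obtain p where "p \<in> C" using False by auto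
      then have "u x \<le> p0 x" for x
        using u_le[of p x] CA by (force simp: A_def intro: order_trans)
      ultimately have "u \<in> A" by (simp add: A_def)
      with u_le show ?thesis by (auto simp: P_def)
    qed
  qed
  then obtain m where "m \<in> A" and min: "\<And>r. r \<in> A \<Longrightarrow> P m r \<Longrightarrow> r = m" by blast
  then have m: "sublinear m" "\<And>x. m x \<le> p0 x" by (auto simp: A_def)
  have neg: "m (- y) = - m y" for y
  proof -
    obtain p' where p': "sublinear p'" "\<And>x. p' x \<le> m x" "p' (- y) \<le> - m y"
      using sublinear_tilt[OF m(1)] by blast
    then have "p' = m" using m(2) by (intro min) (auto simp: A_def P_def intro: order_trans)
    with p' sublinear_minus[OF m(1), of y] show ?thesis by simp
  qed
  have "m (x + y) = m x + m y" for x y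
    using sublinear_add[OF m(1), of x y] sublinear_add[OF m(1), of "x + y" "- y"] by (simp add: neg)
  moreover have "m (t *\<^sub>R x) = t * m x" for t x
    using sublinear_scaleR[OF m(1), of t x] sublinear_scaleR[OF m(1), of "- t" x] neg[of "t *\<^sub>R x"]
    by (cases "t \<ge> 0") auto
  ultimately have "linear m" by (intro linearI) auto
  with m(2) that show ?thesis by blast
qed

text \<open>The norm is tilted at \<open>x\<close> before a linear minorant is taken. This forces
  \<open>l (- x) \<le> - norm x\<close>, whereas an arbitrary linear functional below the norm could
  vanish at \<open>x\<close>.\<close>

lemma real_functional_separates:
  fixes x :: "'a::real_normed_vector"
  assumes "x \<noteq> 0"
  obtains l :: "'a \<Rightarrow> real" where "bounded_linear l" "l x \<noteq> 0"
proof -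
  have "sublinear (norm :: 'a \<Rightarrow> real)" by (simp add: sublinear_def norm_triangle_ineq)
  from sublinear_tilt[OF this, of x]
  obtain p' :: "'a \<Rightarrow> real" where p': "sublinear p'" "\<And>y. p' y \<le> norm y" "p' (- x) \<le> - norm x" by blast
  obtain l where l: "linear l" "\<And>y. l y \<le> p' y" using sublinear_dominates_linear[OF p'(1)] by blast
  have le: "l y \<le> norm y" for y using l(2) p'(2) by (rule order_trans)
  have "\<bar>l y\<bar> \<le> norm y" for y
    using le[of y] le[of "- y"] linear_neg[OF l(1), of y] by simp
  then have "bounded_linear l"
    using l(1) by (intro linear_conv_bounded_linear[THEN iffD1] bounded_linear_intro[of _ 1])
      (auto simp: linear_add linear_scale)
  moreover have "l (- x) \<le> - norm x" using l(2)[of "- x"] p'(3) by simp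
  then have "l x \<noteq> 0" using assms linear_neg[OF l(1), of x] by auto
  ultimately show ?thesis using that by blast
qed

section \<open>Complex scalars and complex functionals\<close>

lemma scaleC_zero_right: "c *\<^sub>C (0::'a::complex_banach) = 0"
  using scaleC_add_right[of c "0::'a" 0] by simp

lemma scaleC_minus_right: "c *\<^sub>C (- x::'a::complex_banach) = - (c *\<^sub>C x)"
  using scaleC_add_right[of c x "- x"] by (simp add: scaleC_zero_right eq_neg_iff_add_eq_0 add.commute)

lemma scaleC_minus_left: "(- c) *\<^sub>C (x::'a::complex_banach) = - (c *\<^sub>C x)"
  using scaleC_add_left[of "c" "- c" x] norm_scaleC[of 0 x]
  by (simp add: eq_neg_iff_add_eq_0 add.commute)

lemma scaleC_zero_left: "0 *\<^sub>C (x::'a::complex_banach) = 0"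
  using norm_scaleC[of 0 x] by simp

lemma scaleC_one: "1 *\<^sub>C (x::'a::complex_banach) = x"
  using scaleR_scaleC[of 1 x] by simp

lemma scaleC_diff_right: "c *\<^sub>C (x - y::'a::complex_banach) = c *\<^sub>C x - c *\<^sub>C y"
  using scaleC_add_right[of c x "- y"] by (simp add: scaleC_minus_right)

lemma scaleC_diff_left: "(c - d) *\<^sub>C (x::'a::complex_banach) = c *\<^sub>C x - d *\<^sub>C x"
  using scaleC_add_left[of c "- d" x] by (simp add: scaleC_minus_left)

text \<open>A real functional k is the real part of the complex linear functional that sends y to
  k(y) - i k(i y).\<close>

lemma complex_functional_separates:
  fixes x :: "'a::complex_banach"
  assumes "x \<noteq> 0"
  obtains l :: "'a \<Rightarrow> complex" where "bounded_clinear l" "l x \<noteq> 0"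
proof -
  obtain k :: "'a \<Rightarrow> real" where k: "bounded_linear k" "k x \<noteq> 0"
    using real_functional_separates[OF assms] by blast
  interpret k: bounded_linear k by fact
  obtain K where K: "\<And>y. \<bar>k y\<bar> \<le> norm y * K" using k.bounded by auto
  define l where "l y = Complex (k y) (- k (\<i> *\<^sub>C y))" for y
  have "norm (l y) \<le> norm y * (2 * K)" for y
    using cmod_le[of "l y"] K[of y] K[of "\<i> *\<^sub>C y"] by (simp add: l_def norm_scaleC)
  moreover have add: "l (y + z) = l y + l z" for y z
    by (simp add: l_def k.add scaleC_add_right complex_eq_iff)
  moreover have i_comm: "\<i> *\<^sub>C (r *\<^sub>R y) = r *\<^sub>R (\<i> *\<^sub>C y)" for r and y :: 'a
    by (simp add: scaleR_scaleC scaleC_scaleC mult.commute)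
  have sc: "l (r *\<^sub>R y) = r *\<^sub>R l y" for r y
    by (simp add: l_def k.scaleR i_comm complex_eq_iff)
  ultimately have bl: "bounded_linear l" by (intro bounded_linear_intro[of _ "2 * K"]) auto
  have "\<i> *\<^sub>C \<i> *\<^sub>C y = - y" for y :: 'a
    by (simp add: scaleC_scaleC scaleC_minus_left scaleC_one)
  then have i: "l (\<i> *\<^sub>C y) = \<i> * l y" for y by (simp add: l_def k.neg complex_eq_iff)
  have "l (c *\<^sub>C y) = c * l y" for c y
  proof -
    have "c *\<^sub>C y = Re c *\<^sub>R y + Im c *\<^sub>R (\<i> *\<^sub>C y)"
      by (metis complex_eq mult.commute scaleC_add_left scaleC_scaleC scaleR_scaleC)
    then have "l (c *\<^sub>C y) = (of_real (Re c) + \<i> * of_real (Im c)) * l y"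
      by (simp add: add sc i scaleR_conv_of_real algebra_simps)
    then show ?thesis by (simp add: complex_eq[symmetric])
  qed
  with bl have "bounded_clinear l" by (simp add: bounded_clinear_def scaleC_complex_def)
  moreover have "l x \<noteq> 0" using k(2) by (simp add: l_def complex_eq_iff)
  ultimately show ?thesis using that by blast
qed

section \<open>Bounded operators and their resolvents\<close>

lemma bounded_clinearD:
  assumes "bounded_clinear f"
  shows "bounded_linear f" "f (c *\<^sub>C x) = c *\<^sub>C f x"
  using assms by (auto simp: bounded_clinear_def)

lemma bounded_clinear_scaleC: "bounded_clinear (\<lambda>x::'a::complex_banach. c *\<^sub>C x)"
  unfolding bounded_clinear_def
proof (intro conjI allI)
  show "bounded_linear (\<lambda>x::'a. c *\<^sub>C x)"
    by (rule bounded_linear_intro[of _ "cmod c"])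
       (auto simp: scaleC_add_right norm_scaleC scaleR_scaleC scaleC_scaleC mult.commute)
qed (simp add: scaleC_scaleC mult.commute)

lemma bounded_clinear_diff:
  "bounded_clinear f \<Longrightarrow> bounded_clinear g \<Longrightarrow> bounded_clinear (\<lambda>x. f x - g x)"
  by (auto simp: bounded_clinear_def bounded_linear_sub scaleC_diff_right)

lemma bounded_clinear_compose:
  "bounded_clinear f \<Longrightarrow> bounded_clinear g \<Longrightarrow> bounded_clinear (\<lambda>x. f (g x))"
  by (auto simp: bounded_clinear_def bounded_linear_compose)

lemma bounded_clinear_ident: "bounded_clinear (\<lambda>x. x)"
  by (auto simp: bounded_clinear_def)

lemma bounded_clinear_funpow:
  fixes f :: "'a::complex_banach \<Rightarrow> 'a"
  shows "bounded_clinear f \<Longrightarrow> bounded_clinear (f ^^ n)"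
proof (induction n)
  case 0
  then show ?case by (simp add: id_def bounded_clinear_ident)
next
  case (Suc n)
  then show ?case using bounded_clinear_compose[of f "f ^^ n"] by (simp add: comp_def)
qed

section \<open>Invertible operators\<close>

lemma invertible_operatorD:
  assumes "invertible_operator f"
  shows "bounded_clinear f" "bounded_clinear (inv f)" "f (inv f x) = x" "inv f (f x) = x"
proof -
  obtain g where g: "bounded_clinear f" "bounded_clinear g" "g \<circ> f = id" "f \<circ> g = id"
    using assms by (auto simp: invertible_operator_def)
  have "inv f = g" using g by (intro inv_unique_comp) auto
  with g show "bounded_clinear f" "bounded_clinear (inv f)" "f (inv f x) = x" "inv f (f x) = x"
    by (simp_all add: pointfree_idE)
qed

lemma invertible_operator_compose:
  assumes "invertible_operator f" "invertible_operator g"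
  shows "invertible_operator (\<lambda>x. f (g x))"
  unfolding invertible_operator_def
proof (intro conjI exI)
  note f = invertible_operatorD[OF assms(1)] and g = invertible_operatorD[OF assms(2)]
  show "bounded_clinear (\<lambda>x. f (g x))" "bounded_clinear (\<lambda>x. inv g (inv f x))"
    by (rule bounded_clinear_compose; rule f g)+
  show "(\<lambda>x. inv g (inv f x)) \<circ> (\<lambda>x. f (g x)) = id" "(\<lambda>x. f (g x)) \<circ> (\<lambda>x. inv g (inv f x)) = id"
    by (simp_all add: fun_eq_iff f(3,4) g(3,4))
qed

text \<open>The equation x - L x = y is a fixed point problem for the contraction that sends x to y
  + L x, so Banach's theorem takes the place of the Neumann series.\<close>

lemma invertible_operator_one_minus:
  fixes L :: "'a::complex_banach \<Rightarrow> 'a"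
  assumes L: "bounded_clinear L" and bound: "\<And>x. norm (L x) \<le> c * norm x" and c: "0 \<le> c" "c < 1"
  shows "invertible_operator (\<lambda>x. x - L x)"
proof -
  interpret L: bounded_linear L using L by (rule bounded_clinearD)
  have "\<exists>x. x - L x = y" for y
  proof -
    have "dist (y + L a) (y + L b) \<le> c * dist a b" for a b
      using bound[of "a - b"] by (simp add: dist_norm L.diff)
    then have "\<exists>!x. y + L x = x"
      using c by (intro banach_fix_type[of c]) auto
    then show ?thesis by (metis add_diff_cancel_right')
  qed
  then obtain g where g: "\<And>y. g y - L (g y) = y" by metis
  have inj: "(1 - c) * norm x \<le> norm (x - L x)" for x
    using norm_triangle_ineq2[of x "L x"] bound[of x] by (simp add: algebra_simps)
  have eqI: "x = y" if "x - L x = y - L y" for x y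
  proof -
    have "(x - y) - L (x - y) = 0" using that by (simp add: L.diff algebra_simps)
    then have "(1 - c) * norm (x - y) \<le> 0" using inj[of "x - y"] by simp
    then show ?thesis using c by (simp add: mult_le_0_iff)
  qed
  have gf: "g (x - L x) = x" for x by (rule eqI) (rule g)
  have "bounded_linear g"
  proof (rule bounded_linear_intro[of _ "1 / (1 - c)"])
    show "g (x + y) = g x + g y" for x y
      by (rule eqI) (metis L.add add_diff_add g)
    show "g (r *\<^sub>R x) = r *\<^sub>R g x" for r x
      by (rule eqI) (simp add: g L.scaleR flip: scaleR_diff_right)
    show "norm (g x) \<le> norm x * (1 / (1 - c))" for x
      using inj[of "g x"] c by (simp add: g field_simps)
  qed
  moreover have "g (r *\<^sub>C x) = r *\<^sub>C g x" for r x
    by (rule eqI) (simp add: g bounded_clinearD(2)[OF L] flip: scaleC_diff_right)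
  ultimately have "bounded_clinear g" by (simp add: bounded_clinear_def)
  moreover have "bounded_clinear (\<lambda>x. x - L x)"
    by (intro bounded_clinear_diff bounded_clinear_ident L)
  ultimately show ?thesis
    unfolding invertible_operator_def by (auto intro!: exI[of _ g] simp: fun_eq_iff g gf)
qed

text \<open>The sign convention is the inverse of T - z, hence the minus sign in the expansion
  outside the disc. Values on the spectrum carry no meaning.\<close>

definition resolvent :: "('a::complex_banach \<Rightarrow> 'a) \<Rightarrow> complex \<Rightarrow> 'a \<Rightarrow> 'a" where
  "resolvent T z = inv (\<lambda>x. T x - z *\<^sub>C x)"

lemma resolvent:
  assumes "z \<notin> spectrum T"
  shows "bounded_clinear (resolvent T z)"
    "T (resolvent T z x) - z *\<^sub>C resolvent T z x = x"
    "resolvent T z (T x - z *\<^sub>C x) = x"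
  using assms invertible_operatorD[of "\<lambda>x. T x - z *\<^sub>C x"] by (auto simp: spectrum_def resolvent_def)

text \<open>With \<open>B\<close> the resolvent at \<open>z\<close>, T - w = (T - z)(1 - (w - z) B),
  and the second factor is invertible as soon as |w - z| < 1/K.\<close>

lemma closed_spectrum:
  fixes T :: "'a::complex_banach \<Rightarrow> 'a"
  assumes T: "bounded_clinear T"
  shows "closed (spectrum T)"
  unfolding closed_def
proof (rule openI)
  fix z assume "z \<in> - spectrum T"
  then have z: "z \<notin> spectrum T" by simp
  define B where "B = resolvent T z"
  have B: "bounded_clinear B" "\<And>x. T (B x) - z *\<^sub>C B x = x"
    using resolvent[OF z] by (auto simp: B_def)
  obtain K where K: "K > 0" "\<And>x. norm (B x) \<le> norm x * K"
    using bounded_linear.pos_bounded[OF bounded_clinearD(1)[OF B(1)]] by auto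
  have "w \<notin> spectrum T" if w: "dist z w < 1 / K" for w
  proof -
    have small: "cmod (w - z) * K < 1"
      using w K(1) by (simp add: dist_norm norm_minus_commute field_simps)
    have "invertible_operator (\<lambda>x. x - (w - z) *\<^sub>C B x)"
    proof (rule invertible_operator_one_minus)
      show "bounded_clinear (\<lambda>x. (w - z) *\<^sub>C B x)"
        by (rule bounded_clinear_compose[OF bounded_clinear_scaleC B(1)])
      show "norm ((w - z) *\<^sub>C B x) \<le> (cmod (w - z) * K) * norm x" for x
        using mult_left_mono[OF K(2)[of x], of "cmod (w - z)"] by (simp add: norm_scaleC algebra_simps)
    qed (use small K(1) in auto)
    moreover have "invertible_operator (\<lambda>x. T x - z *\<^sub>C x)" using z by (simp add: spectrum_def)
    ultimately have "invertible_operator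
        (\<lambda>x. T (x - (w - z) *\<^sub>C B x) - z *\<^sub>C (x - (w - z) *\<^sub>C B x))"
      by (rule invertible_operator_compose[rotated])
    moreover have "T (x - (w - z) *\<^sub>C B x) - z *\<^sub>C (x - (w - z) *\<^sub>C B x) = T x - w *\<^sub>C x" for x
    proof -
      have "T (x - (w - z) *\<^sub>C B x) - z *\<^sub>C (x - (w - z) *\<^sub>C B x)
          = T x - z *\<^sub>C x - (w - z) *\<^sub>C (T (B x) - z *\<^sub>C B x)"
        using bounded_clinearD[OF T]
        by (simp add: linear_diff[OF bounded_linear.linear] scaleC_diff_right scaleC_scaleC mult.commute)
      also have "\<dots> = T x - w *\<^sub>C x" by (simp add: B(2) scaleC_diff_left)
      finally show ?thesis .
    qed
    ultimately show ?thesis by (simp add: spectrum_def)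
  qed
  with K(1) show "\<exists>e>0. ball z e \<subseteq> - spectrum T" by (intro exI[of _ "1 / K"]) auto
qed

lemma resolvent_identity:
  fixes T :: "'a::complex_banach \<Rightarrow> 'a"
  assumes "z \<notin> spectrum T" "w \<notin> spectrum T" "bounded_clinear T"
  shows "resolvent T w x - resolvent T z x = (w - z) *\<^sub>C resolvent T w (resolvent T z x)"
proof -
  let ?R = "resolvent T z x"
  interpret R: bounded_linear "resolvent T w"
    using resolvent(1)[OF assms(2)] by (rule bounded_clinearD)
  have "x = (T ?R - w *\<^sub>C ?R) + (w - z) *\<^sub>C ?R"
    using resolvent(2)[OF assms(1), of x] by (simp add: scaleC_diff_left)
  then have "resolvent T w x = resolvent T w ((T ?R - w *\<^sub>C ?R) + (w - z) *\<^sub>C ?R)"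
    by simp
  also have "\<dots> = ?R + (w - z) *\<^sub>C resolvent T w ?R"
    unfolding R.add using resolvent[OF assms(2)] bounded_clinearD(2) by simp
  finally show ?thesis by simp
qed

text \<open>Continuity on a fixed vector is all that the derivative of a functional of the resolvent
  requires. The resolvent identity first gives a bound for \<open>resolvent T w y\<close> near
  \<open>z\<close>, then a difference of order |w - z|.\<close>

lemma resolvent_tendsto:
  fixes T :: "'a::complex_banach \<Rightarrow> 'a"
  assumes T: "bounded_clinear T" and z: "z \<notin> spectrum T"
  shows "((\<lambda>w. resolvent T w y) \<longlongrightarrow> resolvent T z y) (at z)"
proof -
  obtain K where K: "K > 0" "\<And>x. norm (resolvent T z x) \<le> norm x * K"
    using bounded_linear.pos_bounded[OF bounded_clinearD(1)[OF resolvent(1)[OF z]]] by auto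
  have "open (- spectrum T)" using closed_spectrum[OF T] by (simp add: open_closed)
  then have ev: "\<forall>\<^sub>F w in at z. w \<notin> spectrum T"
    using eventually_at_in_open'[of "- spectrum T" z] z by simp
  have ev2: "\<forall>\<^sub>F w in at z. dist w z < 1 / (2 * K)"
    using K(1) by (auto simp: eventually_at intro!: exI[of _ "1 / (2 * K)"])
  have "\<forall>\<^sub>F w in at z. norm (resolvent T w y - resolvent T z y) \<le> cmod (w - z) * (norm y * K * K * 2)"
    using ev ev2
  proof eventually_elim
    case (elim w)
    have eq: "resolvent T w y - resolvent T z y = (w - z) *\<^sub>C resolvent T z (resolvent T w y)"
      using resolvent_identity[OF elim(1) z T, of y] by (simp add: scaleC_diff_left algebra_simps)
    have n: "norm (resolvent T w y - resolvent T z y) \<le> cmod (w - z) * (norm (resolvent T w y) * K)"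
      unfolding eq norm_scaleC by (intro mult_left_mono K(2)) auto
    \<comment> \<open>At this distance the term with \<open>resolvent T w y\<close> on the right has
      the factor 1/2 and is absorbed by the left side.\<close>
    have "cmod (w - z) * K \<le> 1/2" using elim(2) K(1) by (simp add: dist_norm field_simps)
    then have "cmod (w - z) * K * norm (resolvent T w y) \<le> 1/2 * norm (resolvent T w y)"
      by (rule mult_right_mono) simp
    then have "norm (resolvent T w y) \<le> norm (resolvent T z y) + 1/2 * norm (resolvent T w y)"
      using n norm_triangle_ineq2[of "resolvent T w y" "resolvent T z y"] by (simp add: algebra_simps)
    then have "norm (resolvent T w y) \<le> 2 * (norm y * K)" using K(2)[of y] by simp
    then have "cmod (w - z) * (norm (resolvent T w y) * K) \<le> cmod (w - z) * (2 * (norm y * K) * K)"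
      using K(1) by (intro mult_left_mono mult_right_mono) auto
    with n show ?case by (simp add: algebra_simps)
  qed
  moreover have "((\<lambda>w. cmod (w - z) * (norm y * K * K * 2)) \<longlongrightarrow> 0) (at z)"
    by (rule tendsto_eq_intros refl | simp)+
  ultimately have "((\<lambda>w. resolvent T w y - resolvent T z y) \<longlongrightarrow> 0) (at z)"
    by (rule Lim_null_comparison)
  then show ?thesis by (simp add: LIM_zero_iff)
qed

text \<open>By the resolvent identity the difference quotient equals
  \<open>l (resolvent T w (resolvent T z x))\<close>, so continuity on the vector
  \<open>resolvent T z x\<close> gives the derivative.\<close>

lemma holomorphic_on_resolvent:
  fixes T :: "'a::complex_banach \<Rightarrow> 'a"
  assumes T: "bounded_clinear T" and l: "bounded_clinear (l :: 'a \<Rightarrow> complex)"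
  shows "(\<lambda>z. l (resolvent T z x)) holomorphic_on - spectrum T"
proof -
  have "((\<lambda>z. l (resolvent T z x)) has_field_derivative l (resolvent T z (resolvent T z x))) (at z)"
    if z: "z \<notin> spectrum T" for z
    unfolding DERIV_def has_field_derivative_iff
  proof (rule Lim_transform_eventually)
    show "((\<lambda>w. l (resolvent T w (resolvent T z x))) \<longlongrightarrow> l (resolvent T z (resolvent T z x))) (at z)"
      by (rule bounded_linear.tendsto[OF bounded_clinearD(1)[OF l] resolvent_tendsto[OF T z]])
    have "open (- spectrum T)" using closed_spectrum[OF T] by (simp add: open_closed)
    then have ev: "\<forall>\<^sub>F w in at z. w \<notin> spectrum T"
      using eventually_at_in_open'[of "- spectrum T" z] z by simp
    have ev2: "\<forall>\<^sub>F w in at z. w \<noteq> z" by (simp add: eventually_neq_at_within)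
    show "\<forall>\<^sub>F w in at z. l (resolvent T w (resolvent T z x)) =
        (l (resolvent T w x) - l (resolvent T z x)) / (w - z)"
      using ev ev2
    proof eventually_elim
      case (elim w)
      have "l (resolvent T w x) - l (resolvent T z x) = l (resolvent T w x - resolvent T z x)"
        using bounded_clinearD(1)[OF l] by (simp add: linear_diff[OF bounded_linear.linear])
      also have "\<dots> = (w - z) * l (resolvent T w (resolvent T z x))"
        unfolding resolvent_identity[OF z elim(1) T] bounded_clinearD(2)[OF l]
        by (simp add: scaleC_complex_def)
      finally show ?case using elim(2) by simp
    qed
  qed
  then show ?thesis
    by (auto simp: holomorphic_on_def field_differentiable_def intro: DERIV_subset)
qed

text \<open>The sum y of z^-n T^n x telescopes under T - z to - z x. The coefficients are forward
  powers, so the bound on T^n controls the resolvent outside the disc.\<close>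

lemma resolvent_Laurent_outside:
  fixes T :: "'a::complex_banach \<Rightarrow> 'a"
  assumes T: "bounded_clinear T" and l: "bounded_clinear (l :: 'a \<Rightarrow> complex)" and z: "z \<notin> spectrum T"
    and z0: "z \<noteq> 0" and summ: "summable (\<lambda>n. norm ((T ^^ n) x) * inverse (cmod z) ^ n)"
  shows "(\<lambda>n. l ((T ^^ n) x) * inverse z ^ n) sums (- (z * l (resolvent T z x)))"
proof -
  define y where "y n = inverse z ^ n *\<^sub>C (T ^^ n) x" for n
  have "summable (\<lambda>n. norm (y n))"
    using summ by (simp add: y_def norm_scaleC norm_power norm_inverse mult.commute)
  then have "summable y" by (rule summable_norm_cancel)
  then have Y: "y sums suminf y" by (rule summable_sums)
  have "(\<lambda>n. T (y n)) sums T (suminf y)"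
    by (rule bounded_linear.sums[OF bounded_clinearD(1)[OF T] Y])
  moreover have "T (y n) = z *\<^sub>C y (Suc n)" for n
    using z0 by (simp add: y_def bounded_clinearD(2)[OF T] scaleC_scaleC flip: mult.assoc)
  moreover have "(\<lambda>n. z *\<^sub>C y (Suc n)) sums (z *\<^sub>C (suminf y - y 0))"
    by (rule bounded_linear.sums[OF bounded_clinearD(1)[OF bounded_clinear_scaleC]])
       (use Y sums_Suc_iff in fastforce)
  ultimately have "T (suminf y) = z *\<^sub>C (suminf y - y 0)" using sums_unique2 by force
  then have "T (suminf y) - z *\<^sub>C suminf y = (- z) *\<^sub>C x"
    by (simp add: y_def scaleC_diff_right scaleC_minus_left scaleC_one)
  then have "suminf y = (- z) *\<^sub>C resolvent T z x"
    using resolvent(3)[OF z, of "suminf y"] bounded_clinearD(2)[OF resolvent(1)[OF z]] by metis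
  then have "l (suminf y) = - (z * l (resolvent T z x))"
    by (simp add: bounded_clinearD(2)[OF l] scaleC_complex_def)
  moreover have "(\<lambda>n. l (y n)) sums l (suminf y)"
    by (rule bounded_linear.sums[OF bounded_clinearD(1)[OF l] Y])
  moreover have "l (y n) = l ((T ^^ n) x) * inverse z ^ n" for n
    by (simp add: y_def bounded_clinearD(2)[OF l] scaleC_complex_def)
  ultimately show ?thesis by simp
qed

text \<open>The sum of z^n T^-(n+1) x telescopes under T - z to x, so the bound on the inverse
  powers controls the resolvent inside the disc.\<close>

lemma resolvent_power_series_inside:
  fixes T :: "'a::complex_banach \<Rightarrow> 'a"
  assumes T: "invertible_operator T" and l: "bounded_clinear (l :: 'a \<Rightarrow> complex)"
    and z: "z \<notin> spectrum T"
    and summ: "summable (\<lambda>n. norm ((inv T ^^ Suc n) x) * cmod z ^ n)"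
  shows "(\<lambda>n. l ((inv T ^^ Suc n) x) * z ^ n) sums l (resolvent T z x)"
proof -
  note T' = invertible_operatorD[OF T]
  define y where "y n = z ^ n *\<^sub>C (inv T ^^ Suc n) x" for n
  have "summable (\<lambda>n. norm (y n))"
    using summ by (simp add: y_def norm_scaleC norm_power mult.commute)
  then have "summable y" by (rule summable_norm_cancel)
  then have Y: "y sums suminf y" by (rule summable_sums)
  have "(\<lambda>n. T (y (Suc n))) sums T (suminf y - y 0)"
    by (rule bounded_linear.sums[OF bounded_clinearD(1)[OF T'(1)]]) (use Y sums_Suc_iff in fastforce)
  moreover have "T (y (Suc n)) = z *\<^sub>C y n" for n
    by (simp add: y_def bounded_clinearD(2)[OF T'(1)] scaleC_scaleC T'(3))
  moreover have "(\<lambda>n. z *\<^sub>C y n) sums (z *\<^sub>C suminf y)"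
    by (rule bounded_linear.sums[OF bounded_clinearD(1)[OF bounded_clinear_scaleC] Y])
  ultimately have "T (suminf y - y 0) = z *\<^sub>C suminf y" using sums_unique2 by force
  moreover have "T (suminf y - y 0) = T (suminf y) - x"
    using bounded_clinearD(1)[OF T'(1)] T'(3)
    by (simp add: y_def linear_diff[OF bounded_linear.linear] scaleC_one)
  ultimately have "T (suminf y) - z *\<^sub>C suminf y = x" by (simp add: algebra_simps)
  then have eq: "suminf y = resolvent T z x"
    using resolvent(3)[OF z, of "suminf y"] by metis
  have "(\<lambda>n. l (y n)) sums l (suminf y)"
    by (rule bounded_linear.sums[OF bounded_clinearD(1)[OF l] Y])
  moreover have "l (y n) = l ((inv T ^^ Suc n) x) * z ^ n" for n
    by (simp add: y_def bounded_clinearD(2)[OF l] scaleC_complex_def mult.commute)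
  ultimately show ?thesis by (simp add: eq)
qed

section \<open>The Cantor set\<close>

text \<open>As (1 - 1/q) q^-n = (q - 1) q^-(n+1), these are the numbers in [0, 1] that have a base q
  expansion with digits 0 and q - 1 only.\<close>

definition cantor_arguments :: "nat \<Rightarrow> real set" where
  "cantor_arguments q =
     {(1 - 1 / real q) * (\<Sum>n. \<epsilon> n * (1 / real q) ^ n) | \<epsilon>. \<forall>n. \<epsilon> n \<in> {0, 1 :: real}}"

text \<open>The covering map of period 1: the real line goes to the circle, the upper half-plane to
  the punctured disc. In this coordinate the cells become rectangles.\<close>

definition unit_exp :: "complex \<Rightarrow> complex" where
  "unit_exp v = exp (2 * of_real pi * \<i> * v)"

lemma unit_exp_add: "unit_exp (v + w) = unit_exp v * unit_exp w"
  by (simp add: unit_exp_def ring_distribs exp_add)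

lemma unit_exp_of_int: "unit_exp (of_int n) = 1"
  unfolding unit_exp_def using exp_integer_2pi[of "of_int n"] by (simp add: mult_ac)

lemma unit_exp_of_nat: "unit_exp (of_nat n) = 1"
  using unit_exp_of_int[of "int n"] by simp

lemma unit_exp_power: "unit_exp v ^ n = unit_exp (of_nat n * v)"
  by (simp add: unit_exp_def mult_ac flip: exp_of_nat_mult)

lemma norm_unit_exp: "norm (unit_exp v) = exp (- 2 * pi * Im v)"
  by (simp add: unit_exp_def)

lemma holomorphic_on_unit_exp: "unit_exp holomorphic_on S"
  unfolding unit_exp_def by (intro holomorphic_intros)

text \<open>On the closed upper half-plane, which is convex, the derivative has modulus at most 2
  pi.\<close>

lemma norm_unit_exp_diff_le:
  assumes "Im v \<ge> 0" "Im w \<ge> 0"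
  shows "norm (unit_exp v - unit_exp w) \<le> 2 * pi * norm (v - w)"
proof -
  define S where "S = {v. Im v \<ge> 0}"
  have "convex S" unfolding S_def by (rule convex_halfspace_Im_ge)
  moreover have "(unit_exp has_field_derivative 2 * of_real pi * \<i> * unit_exp x) (at x within S)" for x
    unfolding unit_exp_def by (auto intro!: derivative_eq_intros)
  moreover have "norm (2 * of_real pi * \<i> * unit_exp x) \<le> 2 * pi" if "x \<in> S" for x
    using that by (simp add: norm_mult norm_unit_exp S_def)
  ultimately show ?thesis
    using assms by (intro field_differentiable_bound[of S]) (auto simp: S_def)
qed

lemma perfect_symmetric_set_eq:
  "perfect_symmetric_set (1 / real q) = (\<lambda>v. unit_exp (of_real v)) ` cantor_arguments q"
proof (rule set_eqI)
  fix z
  have *: "exp (2 * \<i> * complex_of_real (pi * (1 - 1 / real q) * S)) = unit_exp (of_real ((1 - 1 / real q) * S))" for S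
    by (simp add: unit_exp_def mult_ac)
  show "z \<in> perfect_symmetric_set (1 / real q) \<longleftrightarrow> z \<in> (\<lambda>v. unit_exp (of_real v)) ` cantor_arguments q"
  proof
    assume "z \<in> perfect_symmetric_set (1 / real q)"
    then obtain \<epsilon> :: "nat \<Rightarrow> real" where "\<forall>n\<ge>1. \<epsilon> n \<in> {0, 1}"
      "z = unit_exp (of_real ((1 - 1 / real q) * (\<Sum>n. \<epsilon> (Suc n) * (1 / real q) ^ n)))"
      unfolding perfect_symmetric_set_def * by blast
    then show "z \<in> (\<lambda>v. unit_exp (of_real v)) ` cantor_arguments q"
      unfolding cantor_arguments_def by (intro image_eqI) (auto intro!: exI[of _ "\<lambda>n. \<epsilon> (Suc n)"])
  next
    assume "z \<in> (\<lambda>v. unit_exp (of_real v)) ` cantor_arguments q"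
    then obtain \<epsilon> :: "nat \<Rightarrow> real" where "\<forall>n. \<epsilon> n \<in> {0, 1}"
      "z = unit_exp (of_real ((1 - 1 / real q) * (\<Sum>n. \<epsilon> n * (1 / real q) ^ n)))"
      unfolding cantor_arguments_def by blast
    then show "z \<in> perfect_symmetric_set (1 / real q)"
      unfolding perfect_symmetric_set_def *
      by (intro CollectI exI[of _ "\<lambda>n. \<epsilon> (n - 1)"]) auto
  qed
qed

text \<open>Self-similarity, obtained by splitting off the first digit \<open>e\<close>.\<close>

lemma cantor_arguments_split:
  assumes q: "q \<ge> 3"
  shows "x \<in> cantor_arguments q \<longleftrightarrow>
    (\<exists>e\<in>{0,1}. \<exists>y\<in>cantor_arguments q. x = (1 - 1 / real q) * e + y / real q)"
proof -
  have summ: "summable (\<lambda>n. \<epsilon> n * (1 / real q) ^ n)" if "\<forall>n. \<epsilon> n \<in> {0, 1 :: real}" for \<epsilon>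
  proof (rule summable_comparison_test')
    show "summable (\<lambda>n. (1 / real q) ^ n)" using q by (intro summable_geometric) auto
    show "norm (\<epsilon> n * (1 / real q) ^ n) \<le> (1 / real q) ^ n" for n
      using that[rule_format, of n] by auto
  qed
  have split: "(\<Sum>n. \<epsilon> n * (1 / real q) ^ n) = \<epsilon> 0 + (\<Sum>n. \<epsilon> (Suc n) * (1 / real q) ^ n) / real q"
    if "\<forall>n. \<epsilon> n \<in> {0, 1 :: real}" for \<epsilon>
  proof -
    have "(\<Sum>n. \<epsilon> (Suc n) * (1 / real q) ^ Suc n) = (\<Sum>n. \<epsilon> (Suc n) * (1 / real q) ^ n / real q)"
      by (simp add: mult_ac)
    also have "\<dots> = (\<Sum>n. \<epsilon> (Suc n) * (1 / real q) ^ n) / real q"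
      using that by (intro suminf_divide summ) auto
    finally show ?thesis using suminf_split_head[OF summ[OF that]] by simp
  qed
  show ?thesis
  proof
    assume "x \<in> cantor_arguments q"
    then obtain \<epsilon> where \<epsilon>: "\<forall>n. \<epsilon> n \<in> {0, 1}" "x = (1 - 1 / real q) * (\<Sum>n. \<epsilon> n * (1 / real q) ^ n)"
      by (auto simp: cantor_arguments_def)
    have "(1 - 1 / real q) * (\<Sum>n. \<epsilon> (Suc n) * (1 / real q) ^ n) \<in> cantor_arguments q"
      using \<epsilon>(1) by (auto simp: cantor_arguments_def intro!: exI[of _ "\<lambda>n. \<epsilon> (Suc n)"])
    moreover have "x = (1 - 1 / real q) * \<epsilon> 0 +
        ((1 - 1 / real q) * (\<Sum>n. \<epsilon> (Suc n) * (1 / real q) ^ n)) / real q"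
      unfolding \<epsilon>(2) split[OF \<epsilon>(1)] by (simp add: algebra_simps)
    ultimately show "\<exists>e\<in>{0,1}. \<exists>y\<in>cantor_arguments q. x = (1 - 1 / real q) * e + y / real q"
      using \<epsilon>(1) by blast
  next
    assume "\<exists>e\<in>{0,1}. \<exists>y\<in>cantor_arguments q. x = (1 - 1 / real q) * e + y / real q"
    then obtain e \<epsilon> where e: "e \<in> {0, 1}" and \<epsilon>: "\<forall>n. \<epsilon> n \<in> {0, 1}"
      and x: "x = (1 - 1 / real q) * e + (1 - 1 / real q) * (\<Sum>n. \<epsilon> n * (1 / real q) ^ n) / real q"
      unfolding cantor_arguments_def by blast
    define \<eta> where "\<eta> = case_nat e \<epsilon>"
    have \<eta>: "\<forall>n. \<eta> n \<in> {0, 1}" using e \<epsilon> by (auto simp: \<eta>_def split: nat.split)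
    have "x = (1 - 1 / real q) * (\<Sum>n. \<eta> n * (1 / real q) ^ n)"
      unfolding split[OF \<eta>] x by (simp add: \<eta>_def algebra_simps)
    with \<eta> show "x \<in> cantor_arguments q" by (auto simp: cantor_arguments_def)
  qed
qed

lemma zero_in_cantor_arguments: "0 \<in> cantor_arguments q"
  by (auto simp: cantor_arguments_def intro!: exI[of _ "\<lambda>_. 0"])

lemma cantor_arguments_bounds:
  assumes q: "q \<ge> 3" and x: "x \<in> cantor_arguments q"
  shows "0 \<le> x" "x \<le> 1"
proof -
  obtain \<epsilon> where \<epsilon>: "\<forall>n. \<epsilon> n \<in> {0, 1}" "x = (1 - 1 / real q) * (\<Sum>n. \<epsilon> n * (1 / real q) ^ n)"
    using x by (auto simp: cantor_arguments_def)
  have \<epsilon>01: "0 \<le> \<epsilon> n" "\<epsilon> n \<le> 1" for n using \<epsilon>(1)[rule_format, of n] by auto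
  have geo: "summable (\<lambda>n. (1 / real q) ^ n)" using q by (intro summable_geometric) auto
  have le: "\<epsilon> n * (1 / real q) ^ n \<le> (1 / real q) ^ n" for n
    using \<epsilon>01[of n] by (intro mult_left_le_one_le) auto
  have summ: "summable (\<lambda>n. \<epsilon> n * (1 / real q) ^ n)"
    using le \<epsilon>01 by (intro summable_comparison_test'[OF geo]) auto
  have "(\<Sum>n. \<epsilon> n * (1 / real q) ^ n) \<ge> 0" using \<epsilon>01 by (intro suminf_nonneg summ) auto
  then show "0 \<le> x" using q by (simp add: \<epsilon>(2))
  have "(\<Sum>n. \<epsilon> n * (1 / real q) ^ n) \<le> (\<Sum>n. (1 / real q) ^ n)" by (intro suminf_le le summ geo)
  also have "\<dots> = 1 / (1 - 1 / real q)" using q by (intro suminf_geometric) auto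
  finally show "x \<le> 1" using q by (simp add: \<epsilon>(2) field_simps)
qed

text \<open>The first digit puts \<open>x\<close> into [0, 1/q] or [1 - 1/q, 1], hence outside the
  open interval (1/3, 2/3); the value 1/6 belongs to the worst case q = 3.\<close>

lemma cantor_arguments_away_from_half:
  assumes q: "q \<ge> 3" and x: "x \<in> cantor_arguments q"
  shows "\<bar>of_int n + 1 / 2 - x\<bar> \<ge> 1 / 6"
proof -
  obtain e y where ey: "e \<in> {0,1}" "y \<in> cantor_arguments q" "x = (1 - 1 / real q) * e + y / real q"
    using x cantor_arguments_split[OF q, of x] by blast
  have y: "0 \<le> y" "y \<le> 1" using cantor_arguments_bounds[OF q ey(2)] by auto
  have q3: "1 / real q \<le> 1 / 3" "0 < 1 / real q" using q by (auto simp: field_simps)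
  have "y / real q \<le> 1 / 3" "0 \<le> y / real q"
    using y q mult_mono[of y 1 "1 / real q" "1/3"] q3 by auto
  moreover from ey(1) have "x = y / real q \<or> x = (1 - 1 / real q) + y / real q"
    by (auto simp: ey(3))
  ultimately have "(0 \<le> x \<and> x \<le> 1 / 3) \<or> (2 / 3 \<le> x \<and> x \<le> 1)"
    using q3(1) cantor_arguments_bounds[OF q x] by linarith
  moreover have "n \<le> - 1 \<or> n = 0 \<or> n \<ge> 1" by linarith
  then have "real_of_int n \<le> - 1 \<or> real_of_int n = 0 \<or> real_of_int n \<ge> 1" by auto
  ultimately show ?thesis by linarith
qed

text \<open>The integers below q^k whose base q digits are 0 or q - 1. Divided by q^k, they are the
  left end points of the 2^k intervals of level k.\<close>

primrec cantor_numerators :: "nat \<Rightarrow> nat \<Rightarrow> nat set" where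
  "cantor_numerators q 0 = {0}"
| "cantor_numerators q (Suc k) = (\<lambda>m. q * m) ` cantor_numerators q k \<union> (\<lambda>m. q * m + (q - 1)) ` cantor_numerators q k"

lemma finite_cantor_numerators: "finite (cantor_numerators q k)"
  by (induction k) auto

lemma card_cantor_numerators_le: "card (cantor_numerators q k) \<le> 2 ^ k"
proof (induction k)
  case (Suc k)
  have "card (cantor_numerators q (Suc k)) \<le>
      card ((\<lambda>m. q * m) ` cantor_numerators q k) + card ((\<lambda>m. q * m + (q - 1)) ` cantor_numerators q k)"
    by (simp add: card_Un_le)
  also have "\<dots> \<le> card (cantor_numerators q k) + card (cantor_numerators q k)"
    by (intro add_mono card_image_le finite_cantor_numerators)
  finally show ?case using Suc by simp
qed auto

lemma cantor_arguments_expand: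
  assumes q: "q \<ge> 3" and x: "x \<in> cantor_arguments q"
  obtains m y where "m \<in> cantor_numerators q k" "y \<in> cantor_arguments q" "real q ^ k * x = real m + y"
proof -
  have "\<exists>m\<in>cantor_numerators q k. \<exists>y\<in>cantor_arguments q. real q ^ k * x = real m + y"
  proof (induction k)
    case 0
    then show ?case using x by simp
  next
    case (Suc k)
    then obtain m y where my: "m \<in> cantor_numerators q k" "y \<in> cantor_arguments q" "real q ^ k * x = real m + y"
      by blast
    obtain e y' where ey: "e \<in> {0,1}" "y' \<in> cantor_arguments q" "y = (1 - 1 / real q) * e + y' / real q"
      using my(2) cantor_arguments_split[OF q, of y] by blast
    have "real q * y = (real q - 1) * e + y'" using q by (simp add: ey(3) field_simps)
    moreover have "real q ^ Suc k * x = real q * real m + real q * y"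
      using my(3) by (simp add: mult.assoc flip: distrib_left)
    ultimately have *: "real q ^ Suc k * x = real q * real m + (real q - 1) * e + y'"
      by simp
    from ey(1) consider "e = 0" | "e = 1" by auto
    then show ?case
    proof cases
      case 1
      with * my(1) ey(2) show ?thesis
        by (intro bexI[of _ "q * m"] bexI[of _ y']) auto
    next
      case 2
      with * my(1) ey(2) q show ?thesis
        by (intro bexI[of _ "q * m + (q - 1)"] bexI[of _ y']) (auto simp: of_nat_diff)
    qed
  qed
  with that show ?thesis by blast
qed

lemma cantor_numerators_arguments:
  assumes q: "q \<ge> 3" and m: "m \<in> cantor_numerators q k" and y: "y \<in> cantor_arguments q"
  shows "(real m + y) / real q ^ k \<in> cantor_arguments q"
  using m y
proof (induction k arbitrary: m y)
  case (Suc k)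
  from Suc.prems(1) obtain m' e where m': "m' \<in> cantor_numerators q k" and e: "e \<in> {0, 1 :: real}"
    and m: "real m = real q * real m' + (real q - 1) * e"
    using q by (force simp: of_nat_diff)
  have "(1 - 1 / real q) * e + y / real q \<in> cantor_arguments q"
    using e Suc.prems(2) by (subst cantor_arguments_split[OF q]) blast
  from Suc.IH[OF m' this] show ?case using q by (simp add: m field_simps)
qed auto

text \<open>Raising to the power q^k shifts the digits of the argument by k places; the integer part
  \<open>m\<close> that appears is invisible to \<open>unit_exp\<close>.\<close>

lemma unit_exp_power_in_cantor:
  assumes q: "q \<ge> 3" and z: "z \<in> perfect_symmetric_set (1 / real q)"
  shows "z ^ (q ^ k) \<in> perfect_symmetric_set (1 / real q)"
proof -
  obtain x where x: "x \<in> cantor_arguments q" "z = unit_exp (of_real x)"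
    using z by (auto simp: perfect_symmetric_set_eq)
  obtain m y where my: "y \<in> cantor_arguments q" "real q ^ k * x = real m + y"
    using cantor_arguments_expand[OF q x(1)] by metis
  have "z ^ (q ^ k) = unit_exp (of_real (real q ^ k * x))"
    by (simp add: x unit_exp_power)
  also have "\<dots> = unit_exp (of_real y)"
    by (simp add: my(2) unit_exp_add unit_exp_of_nat)
  finally show ?thesis using my(1) by (auto simp: perfect_symmetric_set_eq)
qed

lemma norm_perfect_symmetric_set:
  "z \<in> perfect_symmetric_set (1 / real q) \<Longrightarrow> norm z = 1"
  by (auto simp: perfect_symmetric_set_eq norm_unit_exp)

lemma one_in_perfect_symmetric_set: "1 \<in> perfect_symmetric_set (1 / real q)"
  unfolding perfect_symmetric_set_eq
  by (rule image_eqI[OF _ zero_in_cantor_arguments]) (simp add: unit_exp_def)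

lemma infdist_perfect_symmetric_set:
  assumes "z \<in> ball 0 1"
  shows "infdist z (perfect_symmetric_set (1 / real q)) > 0" "infdist z (perfect_symmetric_set (1 / real q)) \<le> 2"
proof -
  let ?E = "perfect_symmetric_set (1 / real q)"
  have "1 - norm z \<le> dist z \<zeta>" if "\<zeta> \<in> ?E" for \<zeta>
    using norm_perfect_symmetric_set[OF that] norm_triangle_ineq2[of \<zeta> z] by (simp add: dist_norm norm_minus_commute)
  then have "1 - norm z \<le> infdist z ?E"
    using one_in_perfect_symmetric_set[of q] by (auto simp: infdist_def intro!: cINF_greatest)
  then show "infdist z ?E > 0" using assms by simp
  have "infdist z ?E \<le> dist z 1" by (rule infdist_le[OF one_in_perfect_symmetric_set])
  also have "\<dots> \<le> 2" using assms norm_triangle_ineq4[of z 1] by (simp add: dist_norm)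
  finally show "infdist z ?E \<le> 2" .
qed

lemma unit_exp_eq_iff: "unit_exp v = unit_exp w \<longleftrightarrow> (\<exists>n::int. v = w + of_int n)"
proof -
  have "2 * of_real pi * \<i> * v = 2 * of_real pi * \<i> * w + of_int (2 * n) * of_real pi * \<i> \<longleftrightarrow> v = w + of_int n" for n
  proof -
    have "2 * of_real pi * \<i> * w + of_int (2 * n) * of_real pi * \<i> = 2 * of_real pi * \<i> * (w + of_int n)"
      by (simp add: algebra_simps)
    then show ?thesis by simp
  qed
  then show ?thesis unfolding unit_exp_def exp_eq by simp
qed

text \<open>Scaling by q^k and dropping integers reduces this to the distance from half-integers.
  The shift by \<open>n\<close> is there because arguments of points of the circle are determined
  modulo 1.\<close>

lemma cantor_arguments_midpoint_dist:
  assumes q: "q \<ge> 3" and x: "x \<in> cantor_arguments q"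
  shows "\<bar>(of_int j + 1 / 2) / real q ^ k - (x + of_int n)\<bar> \<ge> 1 / (6 * real q ^ k)"
proof -
  obtain m y where my: "y \<in> cantor_arguments q" "real q ^ k * x = real m + y"
    using cantor_arguments_expand[OF q x] by metis
  have pos: "real q ^ k > 0" using q by simp
  have "of_int (j - int m - int q ^ k * n) + 1 / 2 - y =
      real q ^ k * ((of_int j + 1 / 2) / real q ^ k - (x + of_int n))"
    using pos my(2) by (simp add: field_simps)
  then have "1 / 6 \<le> real q ^ k * \<bar>(of_int j + 1 / 2) / real q ^ k - (x + of_int n)\<bar>"
    using cantor_arguments_away_from_half[OF q my(1), of "j - int m - int q ^ k * n"] pos
    by (simp only: abs_mult abs_of_pos)
  then show ?thesis using pos by (simp add: field_simps)
qed

section \<open>Majorants crossing a line\<close>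

lemma power_le_exp:
  assumes "(x::real) \<ge> 0"
  shows "x ^ n \<le> fact n * exp x"
proof -
  have "(\<Sum>k\<in>{n}. x ^ k /\<^sub>R fact k) \<le> (\<Sum>k. x ^ k /\<^sub>R fact k)"
    using assms by (intro sum_le_suminf summable_exp_generic) auto
  then have "x ^ n / fact n \<le> exp x" by (simp add: exp_def field_simps)
  then show ?thesis by (simp add: field_simps)
qed

lemma complex_powr_minus_polar:
  assumes "w \<noteq> 0"
  shows "w powr (- complex_of_real a) = of_real (norm w powr (- a)) * cis (- (a * Arg w))"
  using assms by (simp add: powr_def exp_eq_polar Arg_eq_Im_Ln)

lemma norm_complex_powr_minus:
  assumes "w \<noteq> 0"
  shows "norm (w powr (- complex_of_real a)) = norm w powr (- a)"
  unfolding complex_powr_minus_polar[OF assms] by (simp add: norm_mult)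

text \<open>The hypothesis on \<open>Re w\<close> says |Arg w| \<le> \<phi>, and
  \<open>w powr (- a)\<close> has argument - a Arg w. The half-plane \<phi> = pi/2 serves for
  crossing the line; a wider sector serves for the flat function.\<close>

lemma Re_powr_minus_ge:
  assumes a: "0 < a" and w: "w \<noteq> 0" and phi: "0 \<le> \<phi>" "\<phi> \<le> pi" "a * \<phi> \<le> pi" and Re: "Re w \<ge> cos \<phi> * norm w"
  shows "Re (w powr (- complex_of_real a)) \<ge> cos (a * \<phi>) * norm w powr (- a)"
proof -
  have "cos (Arg w) = Re w / norm w" using cos_Arg[of w] w by simp
  then have "cos \<phi> \<le> cos \<bar>Arg w\<bar>"
    using Re w by (simp add: pos_le_divide_eq)
  then have Arg: "\<bar>Arg w\<bar> \<le> \<phi>"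
    using phi Arg_bounded[of w] by (subst (asm) cos_mono_le_eq) auto
  have "Re (w powr (- complex_of_real a)) = norm w powr (- a) * cos (a * Arg w)"
    unfolding complex_powr_minus_polar[OF w] by simp
  also have "cos (a * Arg w) = cos (a * \<bar>Arg w\<bar>)" by (simp add: abs_if)
  finally have "Re (w powr (- complex_of_real a)) = norm w powr (- a) * cos (a * \<bar>Arg w\<bar>)" .
  moreover have "cos (a * \<phi>) \<le> cos (a * \<bar>Arg w\<bar>)"
    using a Arg phi by (intro cos_monotone_0_pi_le) (auto intro: mult_left_mono)
  ultimately show ?thesis by (metis mult.commute mult_left_mono powr_ge_zero)
qed

lemma exp_minus_powr_tendsto_0:
  fixes a B :: real
  assumes "0 < a" "0 < B"
  shows "((\<lambda>x. exp (- (B * x powr (- a)))) \<longlongrightarrow> 0) (at_right 0)"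
proof -
  have "filterlim (\<lambda>x::real. x powr (- a)) at_top (at_right 0)"
    using assms(1) by real_asymp
  then have "filterlim (\<lambda>x::real. B * x powr (- a)) at_top (at_right 0)"
    by (rule filterlim_tendsto_pos_mult_at_top[OF tendsto_const assms(2)])
  then have "filterlim (\<lambda>x::real. - (B * x powr (- a))) at_bot (at_right 0)"
    by (simp add: filterlim_uminus_at_bot)
  then show ?thesis by (rule filterlim_compose[OF exp_at_bot])
qed

text \<open>The two singularities of the majorant on the sphere are cancelled by
  \<open>exp (- B' (w\<^sub>1 powr (- a) + w\<^sub>2 powr (- a)))\<close>, where \<open>w\<^sub>1\<close> and \<open>w\<^sub>2\<close>
  vanish at the two points where the sphere meets the real line.\<close>

lemma holomorphic_bound_across_line:
  fixes H :: "complex \<Rightarrow> complex"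
  assumes hol: "H holomorphic_on cball (of_real x) \<rho>" and \<rho>: "\<rho> > 0" and a: "0 < a" "a < 1" and B: "B > 0"
    and bound: "\<And>v. v \<in> cball (of_real x) \<rho> \<Longrightarrow> Im v \<noteq> 0 \<Longrightarrow> norm (H v) \<le> A * exp (B * \<bar>Im v\<bar> powr (- a))"
    and v0: "norm (v0 - of_real x) \<le> \<rho> / 2"
  shows "norm (H v0) \<le> A * exp (8 / cos (a * (pi / 2)) * B * (\<rho> / 2) powr (- a))"
proof -
  define c where "c = cos (a * (pi / 2))"
  have c: "c > 0" unfolding c_def using a by (intro cos_gt_zero) (auto simp: field_simps)
  \<comment> \<open>Chosen so that on the sphere B' c (n1^-a + n2^-a) is at least B |Im v|^-a, where
    n1 and n2 are the moduli of \<open>w1 v\<close> and \<open>w2 v\<close>.\<close>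
  define B' where "B' = B * (\<rho> / 2) powr (- a) / c"
  have B': "B' > 0" using B c \<rho> by (simp add: B'_def)
  define w1 where "w1 v = (of_real (x + \<rho>) - v) / of_real \<rho>" for v :: complex
  define w2 where "w2 v = (v - of_real (x - \<rho>)) / of_real \<rho>" for v :: complex
  define G where "G v = H v * exp (- of_real B' * (w1 v powr (- of_real a) + w2 v powr (- of_real a)))" for v
  define p1 p2 where "p1 = complex_of_real (x + \<rho>)" and "p2 = complex_of_real (x - \<rho>)"
  \<comment> \<open>Since \<open>0 powr _ = 0\<close>, the expression \<open>G\<close> has the wrong
    values at \<open>p1\<close> and \<open>p2\<close>. Its limit there is 0, because
    \<open>H\<close> is bounded and the exponential factor decays.\<close>
  define Q where "Q v = (if v = p1 \<or> v = p2 then 0 else G v)" for v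
  have w_zero: "w1 v = 0 \<longleftrightarrow> v = p1" "w2 v = 0 \<longleftrightarrow> v = p2" for v
    using \<rho> by (auto simp: w1_def w2_def p1_def p2_def)
  have w_Re: "Re (w1 v) \<ge> 0" "Re (w2 v) \<ge> 0" if "v \<in> cball (of_real x) \<rho>" for v
    using that \<rho> abs_Re_le_cmod[of "v - of_real x"] by (auto simp: w1_def w2_def dist_norm norm_minus_commute)
  have Rep: "Re (w powr (- of_real a)) \<ge> c * norm w powr (- a)" if "Re w \<ge> 0" "w \<noteq> 0" for w
    using Re_powr_minus_ge[of a w "pi/2"] a that by (auto simp: c_def)
  have Gle: "norm (G v) \<le> norm (H v) * exp (- (B' * c * (norm (w1 v) powr (- a) + norm (w2 v) powr (- a))))"
    if v: "v \<in> cball (of_real x) \<rho>" "v \<noteq> p1" "v \<noteq> p2" for v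
  proof -
    have "B' * (c * norm (w1 v) powr (- a) + c * norm (w2 v) powr (- a)) \<le>
        B' * (Re (w1 v powr (- of_real a)) + Re (w2 v powr (- of_real a)))"
      using B' v by (intro mult_left_mono add_mono Rep w_Re) (auto simp: w_zero)
    then show ?thesis
      unfolding G_def norm_mult norm_exp_eq_Re by (intro mult_left_mono) (auto simp: algebra_simps)
  qed
  have nonpos: "w1 v \<notin> \<real>\<^sub>\<le>\<^sub>0" "w2 v \<notin> \<real>\<^sub>\<le>\<^sub>0" if "v \<in> cball (of_real x) \<rho>" "v \<noteq> p1" "v \<noteq> p2" for v
  proof -
    have "w \<notin> \<real>\<^sub>\<le>\<^sub>0" if "Re w \<ge> 0" "w \<noteq> 0" for w
      using that by (auto simp: complex_nonpos_Reals_iff complex_eq_iff)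
    then show "w1 v \<notin> \<real>\<^sub>\<le>\<^sub>0" "w2 v \<notin> \<real>\<^sub>\<le>\<^sub>0" using that w_Re w_zero by blast+
  qed
  have holG: "G holomorphic_on cball (of_real x) \<rho> - {p1, p2}"
  proof -
    have "w1 holomorphic_on cball (of_real x) \<rho> - {p1, p2}" "w2 holomorphic_on cball (of_real x) \<rho> - {p1, p2}"
      unfolding w1_def[abs_def] w2_def[abs_def] using \<rho> by (auto intro!: holomorphic_intros)
    then show ?thesis
      unfolding G_def[abs_def] using nonpos
      by (intro holomorphic_intros holomorphic_on_subset[OF hol]) auto
  qed
  have contH: "continuous_on (cball (of_real x) \<rho>) H" by (rule holomorphic_on_imp_continuous_on[OF hol])
  then obtain M where M: "\<And>v. v \<in> cball (of_real x) \<rho> \<Longrightarrow> norm (H v) \<le> M"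
    using compact_continuous_image[OF contH] by (force dest!: compact_imp_bounded simp: bounded_iff)
  have M0: "M \<ge> 0"
    using M[of "of_real x"] \<rho> order_trans[OF norm_ge_zero[of "H (of_real x)"]] by simp
  have lim0: "(Q \<longlongrightarrow> 0) (at p within cball (of_real x) \<rho>)"
    if p: "p \<in> {p1, p2}" and w: "w = w1 \<or> w = w2" "w p = 0" for p w
  proof -
    have wcont: "(w \<longlongrightarrow> w p) (at p within cball (of_real x) \<rho>)"
      using w(1) unfolding w1_def[abs_def] w2_def[abs_def] using \<rho> by (auto intro!: tendsto_intros)
    have w_nz: "w v \<noteq> 0" if "v \<noteq> p" for v
      using w w_zero that by auto
    have "filterlim (\<lambda>v. norm (w v)) (at_right 0) (at p within cball (of_real x) \<rho>)"
    proof (rule tendsto_imp_filterlim_at_right)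
      show "((\<lambda>v. norm (w v)) \<longlongrightarrow> 0) (at p within cball (of_real x) \<rho>)"
        using tendsto_norm[OF wcont] w(2) by simp
      show "\<forall>\<^sub>F v in at p within cball (of_real x) \<rho>. 0 < norm (w v)"
        using w_nz by (auto simp: eventually_at intro!: exI[of _ 1])
    qed
    then have "((\<lambda>v. exp (- (B' * c * norm (w v) powr (- a)))) \<longlongrightarrow> 0) (at p within cball (of_real x) \<rho>)"
      using exp_minus_powr_tendsto_0[of a "B' * c"] a B' c by (auto intro: filterlim_compose)
    then have lim: "((\<lambda>v. M * exp (- (B' * c * norm (w v) powr (- a)))) \<longlongrightarrow> 0) (at p within cball (of_real x) \<rho>)"
      by (rule tendsto_mult_right_zero)
    have "norm (Q v) \<le> M * exp (- (B' * c * norm (w v) powr (- a)))" if v: "v \<in> cball (of_real x) \<rho>" for v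
    proof (cases "v = p1 \<or> v = p2")
      case True
      then show ?thesis using M0 by (simp add: Q_def)
    next
      case False
      have "norm (Q v) \<le> norm (H v) * exp (- (B' * c * (norm (w1 v) powr (- a) + norm (w2 v) powr (- a))))"
        using Gle[OF v] False by (simp add: Q_def)
      also have "\<dots> \<le> M * exp (- (B' * c * norm (w v) powr (- a)))"
        using w(1) B' c M0 by (intro mult_mono M v) (auto simp: algebra_simps)
      finally show ?thesis .
    qed
    then have "\<forall>\<^sub>F v in at p within cball (of_real x) \<rho>. norm (Q v) \<le> M * exp (- (B' * c * norm (w v) powr (- a)))"
      by (auto simp: eventually_at intro!: exI[of _ 1])
    from this lim show ?thesis by (rule Lim_null_comparison)
  qed
  have contQ: "continuous_on (cball (of_real x) \<rho>) Q"
    unfolding continuous_on_def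
  proof
    fix v assume v: "v \<in> cball (complex_of_real x) \<rho>"
    show "(Q \<longlongrightarrow> Q v) (at v within cball (of_real x) \<rho>)"
    proof (cases "v = p1 \<or> v = p2")
      case True
      then show ?thesis using lim0[of p1 w1] lim0[of p2 w2] w_zero by (auto simp: Q_def)
    next
      case False
      define U where "U = - {p1, p2}"
      have U: "open U" "v \<in> U" using False by (auto simp: U_def intro!: open_Compl finite_imp_closed)
      have "continuous_on (cball (of_real x) \<rho> - {p1, p2}) G"
        by (rule holomorphic_on_imp_continuous_on[OF holG])
      then have "(G \<longlongrightarrow> G v) (at v within cball (of_real x) \<rho> \<inter> U)"
        using v False by (auto simp: continuous_on_def U_def Diff_eq)
      then have "(G \<longlongrightarrow> G v) (at v within cball (of_real x) \<rho>)"
        using at_within_nhd[OF U(2,1), of "cball (of_real x) \<rho> \<inter> U" "cball (of_real x) \<rho>"] by auto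
      moreover have "\<forall>\<^sub>F v in at v within cball (of_real x) \<rho>. G v = Q v"
        using U eventually_at_topological by (auto simp: Q_def U_def eventually_at_topological intro!: exI[of _ U])
      ultimately have "(Q \<longlongrightarrow> G v) (at v within cball (of_real x) \<rho>)" by (rule Lim_transform_eventually)
      then show ?thesis using False by (simp add: Q_def)
    qed
  qed
  have p_sphere: "p1 \<notin> ball (of_real x) \<rho>" "p2 \<notin> ball (of_real x) \<rho>"
    using \<rho> by (auto simp: p1_def p2_def dist_norm)
  have holQ: "Q holomorphic_on ball (of_real x) \<rho>"
  proof (rule holomorphic_transform[of G])
    show "G holomorphic_on ball (of_real x) \<rho>"
      using p_sphere by (intro holomorphic_on_subset[OF holG]) auto
  qed (use p_sphere in \<open>auto simp: Q_def\<close>)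
  have A: "A \<ge> 0"
  proof -
    have "0 \<le> norm (H (of_real x + \<i> * of_real \<rho>))" by simp
    also have "\<dots> \<le> A * exp (B * \<bar>\<rho>\<bar> powr (- a))"
      using bound[of "of_real x + \<i> * of_real \<rho>"] \<rho> by (simp add: dist_norm norm_mult)
    finally show ?thesis by (simp add: zero_le_mult_iff)
  qed
  have sphere: "norm (Q v) \<le> A" if v: "v \<in> sphere (of_real x) \<rho>" for v
  proof (cases "v = p1 \<or> v = p2")
    case True
    then show ?thesis using A by (simp add: Q_def)
  next
    case False
    have vc: "v \<in> cball (of_real x) \<rho>" using v by auto
    define n1 n2 where "n1 = norm (w1 v)" and "n2 = norm (w2 v)"
    have n_pos: "n1 > 0" "n2 > 0" using False w_zero by (auto simp: n1_def n2_def)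
    have "w1 v + w2 v = 2" using \<rho> by (simp add: w1_def w2_def field_simps)
    then have n_sum: "n1 + n2 \<ge> 2" using norm_triangle_ineq[of "w1 v" "w2 v"] by (simp add: n1_def n2_def)
    \<comment> \<open>Thales: \<open>v\<close> sees the diameter from \<open>p2\<close> to
      \<open>p1\<close> under a right angle. The legs are \<rho> n1 and \<rho> n2, the hypotenuse is
      2 \<rho>, and |Im v| is the altitude.\<close>
    have Im: "\<bar>Im v\<bar> = \<rho> / 2 * (n1 * n2)"
    proof -
      define X Y where "X = Re v - x" and "Y = Im v"
      have XY: "X\<^sup>2 + Y\<^sup>2 = \<rho>\<^sup>2"
        using v by (auto simp: X_def Y_def dist_norm cmod_def norm_minus_commute power2_eq_square
            real_sqrt_eq_iff real_sqrt_unique dest!: sym[of _ \<rho>] simp flip: power2_eq_square)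
           (simp add: power2_commute)
      have "n1\<^sup>2 = ((\<rho> - X)\<^sup>2 + Y\<^sup>2) / \<rho>\<^sup>2" "n2\<^sup>2 = ((\<rho> + X)\<^sup>2 + Y\<^sup>2) / \<rho>\<^sup>2"
        using \<rho> unfolding n1_def n2_def w1_def w2_def norm_divide power_divide cmod_power2
        by (simp_all add: X_def Y_def algebra_simps)
      moreover have "(\<rho> - X)\<^sup>2 + Y\<^sup>2 = 2 * \<rho> * (\<rho> - X)" "(\<rho> + X)\<^sup>2 + Y\<^sup>2 = 2 * \<rho> * (\<rho> + X)"
        using XY by (auto simp: power2_eq_square algebra_simps)
      ultimately have "n1\<^sup>2 = 2 * (\<rho> - X) / \<rho>" "n2\<^sup>2 = 2 * (\<rho> + X) / \<rho>"
        using \<rho> by (simp_all add: power2_eq_square)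
      then have "(n1 * n2)\<^sup>2 = 4 * (\<rho>\<^sup>2 - X\<^sup>2) / \<rho>\<^sup>2"
        by (simp add: power_mult_distrib) (simp add: power2_eq_square algebra_simps)
      also have "\<dots> = (2 * \<bar>Y\<bar> / \<rho>)\<^sup>2" using XY by (simp add: power_divide power_mult_distrib)
      finally have "n1 * n2 = 2 * \<bar>Y\<bar> / \<rho>"
        using n_pos \<rho> by (subst (asm) power2_eq_iff_nonneg) auto
      then show ?thesis using \<rho> by (simp add: Y_def)
    qed
    then have Im_nz: "Im v \<noteq> 0" using n_pos \<rho> by auto
    \<comment> \<open>As n1 + n2 \<ge> 2, one of the two numbers is at least 1 and its negative
      power is at most 1.\<close>
    have "(n1 * n2) powr (- a) \<le> n1 powr (- a) + n2 powr (- a)"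
    proof -
      have "n1 \<ge> 1 \<or> n2 \<ge> 1" using n_sum by linarith
      then have "n1 powr (- a) \<le> 1 \<or> n2 powr (- a) \<le> 1"
        using a powr_mono[of "- a" 0 n1] powr_mono[of "- a" 0 n2] by auto
      then show ?thesis
        using n_pos by (auto simp: powr_mult intro: order_trans[OF mult_left_le_one_le] order_trans[OF mult_right_le_one_le])
    qed
    then have "B * \<bar>Im v\<bar> powr (- a) \<le> B * ((\<rho> / 2) powr (- a) * (n1 powr (- a) + n2 powr (- a)))"
      unfolding Im using \<rho> n_pos B by (subst powr_mult) (auto intro!: mult_left_mono)
    also have "\<dots> = B' * c * (n1 powr (- a) + n2 powr (- a))" using c by (simp add: B'_def)
    finally have e: "B * \<bar>Im v\<bar> powr (- a) \<le> B' * c * (n1 powr (- a) + n2 powr (- a))" .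
    have "norm (Q v) \<le> norm (H v) * exp (- (B' * c * (n1 powr (- a) + n2 powr (- a))))"
      using Gle[OF vc] False by (simp add: Q_def n1_def n2_def)
    also have "\<dots> \<le> (A * exp (B * \<bar>Im v\<bar> powr (- a))) * exp (- (B * \<bar>Im v\<bar> powr (- a)))"
      using e A by (intro mult_mono bound vc Im_nz) auto
    also have "\<dots> = A" by (simp add: exp_minus)
    finally show ?thesis .
  qed
  have v0c: "v0 \<in> ball (of_real x) \<rho>" using v0 \<rho> by (simp add: dist_norm norm_minus_commute)
  have "norm (Q v0) \<le> A"
  proof (rule maximum_modulus_frontier[of Q "cball (of_real x) \<rho>"])
    show "norm (Q v) \<le> A" if "v \<in> frontier (cball (of_real x) \<rho>)" for v
      using that sphere by simp
  qed (use holQ contQ v0c in auto)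
  moreover have "Q v0 = G v0" using v0c p_sphere by (auto simp: Q_def)
  ultimately have "norm (G v0) \<le> A" by simp
  define S where "S = w1 v0 powr (- of_real a) + w2 v0 powr (- of_real a)"
  \<comment> \<open>\<open>w v0\<close> is within 1/2 of 1, so its modulus is at least 1/2 and the
    power is at most 2; the coarser 4, taken twice, gives the 8 of the statement.\<close>
  have le4: "norm (w v0 powr (- of_real a)) \<le> 4" if "w \<in> {w1, w2}" for w
  proof -
    have "norm (w v0) \<ge> 1 / 2"
    proof -
      have "norm (1 - w v0) \<le> 1 / 2"
      proof -
        have "norm (1 - w v0) = norm (v0 - of_real x) / \<rho>"
        proof -
          have "1 - w1 v0 = (v0 - of_real x) / of_real \<rho>" "1 - w2 v0 = - ((v0 - of_real x) / of_real \<rho>)"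
            using \<rho> by (auto simp: w1_def w2_def field_simps)
          then have "norm (1 - w1 v0) = norm (v0 - of_real x) / \<rho>" "norm (1 - w2 v0) = norm (v0 - of_real x) / \<rho>"
            using \<rho> by (simp_all only: norm_minus_cancel norm_divide norm_of_real abs_of_pos)
          then show ?thesis using that by auto
        qed
        then show ?thesis using v0 \<rho> by (simp add: pos_divide_le_eq)
      qed
      then show ?thesis using norm_triangle_ineq2[of 1 "1 - w v0"] by simp
    qed
    then have nz: "w v0 \<noteq> 0" and "norm (w v0) powr (- a) \<le> (1 / 2) powr (- a)"
      using a by (auto intro!: powr_mono2')
    moreover have "(1 / 2) powr (- a) \<le> (1/2) powr (- 1 :: real)"
      using a by (intro powr_mono') auto
    moreover have "(1/2) powr (- 1 :: real) = 2" by (simp add: powr_minus)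
    ultimately show ?thesis unfolding norm_complex_powr_minus[OF nz] by linarith
  qed
  have "norm S \<le> 8"
    unfolding S_def using le4[of w1] le4[of w2] by (intro order_trans[OF norm_triangle_ineq]) simp
  then have "Re S \<le> 8" using complex_Re_le_cmod[of S] by simp
  have "norm (H v0) = norm (G v0) * exp (B' * Re S)"
    by (simp add: G_def S_def norm_mult norm_exp_eq_Re flip: exp_add)
  also have "\<dots> \<le> A * exp (B' * 8)"
    using \<open>norm (G v0) \<le> A\<close> \<open>Re S \<le> 8\<close> B' A by (intro mult_mono) auto
  finally show ?thesis by (simp add: B'_def c_def mult_ac)
qed

section \<open>A bounded holomorphic function that is flat on the Cantor set\<close>

text \<open>Flatness outweighs every negative power of the distance. With X = d^-a, the factor d^-p
  is X^(p/a), a power of X that the exponential absorbs.\<close>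

lemma exp_minus_powr_over_power_bounded:
  fixes a c :: real
  assumes "0 < a" "0 < c"
  obtains C where "\<And>d. d > 0 \<Longrightarrow> exp (- (c * d powr (- a))) / d ^ p \<le> C"
proof
  define n where "n = nat \<lceil>real p / a\<rceil>"
  fix d :: real assume d: "d > 0"
  define X where "X = d powr (- a)"
  have X: "X > 0" using d by (simp add: X_def)
  have "X powr (real p / a) = d powr (- real p)"
    using assms by (simp add: X_def powr_powr)
  also have "\<dots> = 1 / d ^ p" using d by (simp add: powr_minus_divide powr_realpow)
  finally have "1 / d ^ p = X powr (real p / a)" ..
  also have "\<dots> \<le> 1 + X ^ n"
  proof (cases "X \<le> 1")
    case True
    then have "X powr (real p / a) \<le> 1" using powr_mono2[of "real p / a" X 1] assms X by simp
    then show ?thesis using X by (smt (verit) zero_le_power)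
  next
    case False
    then have "X powr (real p / a) \<le> X powr real n"
      by (intro powr_mono) (auto simp: n_def real_nat_ceiling_ge)
    then show ?thesis using X by (simp add: powr_realpow)
  qed
  finally have "exp (- (c * X)) / d ^ p \<le> exp (- (c * X)) * (1 + X ^ n)"
    using mult_left_mono[of "1 / d ^ p" "1 + X ^ n" "exp (- (c * X))"] by simp
  also have "\<dots> \<le> 1 + fact n / c ^ n"
  proof -
    have "exp (- (c * X)) * (c ^ n * X ^ n) \<le> exp (- (c * X)) * (fact n * exp (c * X))"
      using power_le_exp[of "c * X" n] assms X by (intro mult_left_mono) (auto simp: power_mult_distrib)
    also have "\<dots> = fact n" by (simp add: exp_minus)
    finally have "exp (- (c * X)) * X ^ n \<le> fact n / c ^ n" using assms by (simp add: field_simps)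
    moreover have "exp (- (c * X)) \<le> 1" using assms X by simp
    moreover have "exp (- (c * X)) * (1 + X ^ n) = exp (- (c * X)) + exp (- (c * X)) * X ^ n"
      by (simp add: algebra_simps)
    ultimately show ?thesis by linarith
  qed
  finally show "exp (- (c * d powr (- a))) / d ^ p \<le> 1 + fact n / c ^ n" by (simp add: X_def)
qed

lemma norm_one_minus_cnj:
  assumes "norm \<zeta> = 1"
  shows "norm (1 - cnj \<zeta> * w) = norm (\<zeta> - w)"
proof -
  have "1 - cnj \<zeta> * w = cnj \<zeta> * (\<zeta> - w)"
    using assms by (simp add: algebra_simps complex_norm_square[symmetric] mult.commute[of "cnj \<zeta>" \<zeta>])
  then show ?thesis using assms by (simp add: norm_mult)
qed

text \<open>Here \<open>a\<close> is the order of flatness to be reached and \<sigma> the order of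
  the singularity of a single term; \<open>small\<close> says that \<sigma> - a exceeds the
  dimension ln 2 / ln q.\<close>

locale cantor_flat_function =
  fixes q :: nat and a \<sigma> :: real
  assumes q: "q \<ge> 3" and a: "0 < a" and \<sigma>: "a < \<sigma>" "\<sigma> < 1"
    and small: "2 * real q powr a < real q powr \<sigma>"
begin

abbreviation "E \<equiv> perfect_symmetric_set (1 / real q)"

text \<open>Level \<open>k\<close> has at most \<open>2\<^sup>k\<close> atoms of weight \<open>\<gamma>\<^sup>k\<close>, so the sum converges because \<open>2 \<gamma> < 1\<close>,
  while a single atom at distance \<open>q\<^sup>-\<^sup>k\<close> already contributes \<open>\<gamma>\<^sup>k q\<^bsup>k \<sigma>\<^esup> = q\<^bsup>k a\<^esup>\<close>.
  If \<open>w\<close> moves away from \<open>z\<close> in the disc by less than \<open>\<kappa>\<close> times the distance from \<open>z\<close> to \<open>E\<close>, then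
  \<open>1 - cnj \<zeta> w\<close> stays in the sector of half-angle \<open>\<phi>\<close>, on which the real part of \<open>v powr (- \<sigma>)\<close> is
  positive since \<open>\<sigma> \<phi> < pi / 2\<close>. This extra room is what Cauchy's inequality needs.\<close>

definition "\<gamma> = real q powr (a - \<sigma>)"
text \<open>Chosen with \<phi> + \<sigma> \<phi> = pi: since \<sigma> < 1, the angle \<phi> exceeds
  pi/2 while \<sigma> \<phi> stays below pi/2.\<close>

definition "\<phi> = pi / (1 + \<sigma>)"
definition "c = cos (\<sigma> * \<phi>)"
text \<open>The solution of \<kappa> = - cos \<phi> (1 - \<kappa>), the largest relative
  displacement for which the estimate in \<open>sector\<close> works.\<close>

definition "\<kappa> = - cos \<phi> / (1 - cos \<phi>)"

definition atom :: "nat \<Rightarrow> nat \<Rightarrow> complex" where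
  "atom k m = unit_exp (of_real (real m / real q ^ k))"

definition h :: "nat \<Rightarrow> complex \<Rightarrow> complex" where
  "h k w = of_real (\<gamma> ^ k) * (\<Sum>m\<in>cantor_numerators q k. (1 - cnj (atom k m) * w) powr (- of_real \<sigma>))"

definition f :: "complex \<Rightarrow> complex" where
  "f w = exp (- (\<Sum>k. h k w))"

text \<open>A Whitney ball relative to \<open>E\<close>, not to the circle: near the gaps of
  \<open>E\<close> it reaches beyond the disc, and \<open>f\<close> is holomorphic and small there
  too.\<close>

definition U :: "complex \<Rightarrow> complex set" where
  "U z = ball z (\<kappa> * infdist z E)"

lemma \<gamma>: "0 < \<gamma>" "2 * \<gamma> < 1"
proof -
  have "2 * (real q powr a / real q powr \<sigma>) < 1" using small q by (simp add: field_simps)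
  then show "2 * \<gamma> < 1" by (simp add: \<gamma>_def powr_diff)
qed (use q in \<open>simp add: \<gamma>_def\<close>)

lemma \<phi>: "0 \<le> \<phi>" "\<phi> \<le> pi" "\<sigma> * \<phi> \<le> pi" "cos \<phi> < 0"
proof -
  have s: "0 < \<sigma>" using a \<sigma> by simp
  show "0 \<le> \<phi>" "\<phi> \<le> pi" using s by (auto simp: \<phi>_def field_simps)
  show "\<sigma> * \<phi> \<le> pi" using s by (simp add: \<phi>_def field_simps)
  have "pi / 2 < \<phi>" using s \<sigma> by (simp add: \<phi>_def field_simps)
  then show "cos \<phi> < 0" using \<open>\<phi> \<le> pi\<close> cos_monotone_0_pi[of "pi / 2" \<phi>] by simp
qed

lemma c_pos: "c > 0"
proof -
  have s: "0 < \<sigma>" using a \<sigma> by simp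
  then have "\<sigma> * \<phi> < pi / 2" using \<sigma> by (simp add: \<phi>_def field_simps)
  moreover have "0 < \<sigma> * \<phi>" using s by (simp add: \<phi>_def)
  ultimately show ?thesis unfolding c_def by (intro cos_gt_zero) auto
qed

lemma \<kappa>: "0 < \<kappa>" "\<kappa> < 1" "\<kappa> = - cos \<phi> * (1 - \<kappa>)"
  using \<phi>(4) by (auto simp: \<kappa>_def field_simps)

lemma atom_in_E: "m \<in> cantor_numerators q k \<Longrightarrow> atom k m \<in> E"
  unfolding perfect_symmetric_set_eq atom_def
  using cantor_numerators_arguments[OF q _ zero_in_cantor_arguments, of m k] by (intro imageI) simp

text \<open>At \<open>z\<close> the point \<open>v0\<close> lies in the right half-plane. Passing to
  \<open>w\<close> moves it by less than \<kappa> |v0|, which by the equation for \<kappa> is at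
  most - cos \<phi> |v|; hence the bound for \<open>Re v\<close>.\<close>

lemma sector:
  assumes z: "z \<in> ball 0 1" and w: "w \<in> U z" and \<zeta>: "\<zeta> \<in> E"
  defines "v \<equiv> 1 - cnj \<zeta> * w"
  shows "v \<noteq> 0" "Re v \<ge> cos \<phi> * norm v" "norm v \<ge> (1 - \<kappa>) * infdist z E"
proof -
  define v0 where "v0 = 1 - cnj \<zeta> * z"
  have n1: "norm \<zeta> = 1" by (rule norm_perfect_symmetric_set[OF \<zeta>])
  have "norm (cnj \<zeta> * z) < 1" using z n1 by (simp add: norm_mult)
  then have Re0: "Re v0 > 0" using complex_Re_le_cmod[of "cnj \<zeta> * z"] unfolding v0_def by simp
  have "infdist z E \<le> norm v0"
    using infdist_le[OF \<zeta>, of z] norm_one_minus_cnj[OF n1, of z] by (simp add: v0_def dist_norm norm_minus_commute)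
  moreover have "norm (v - v0) < \<kappa> * infdist z E"
  proof -
    have "v - v0 = cnj \<zeta> * (z - w)" by (simp add: v_def v0_def algebra_simps)
    then show ?thesis using w n1 by (simp add: U_def norm_mult dist_norm)
  qed
  moreover have "\<kappa> * infdist z E \<le> \<kappa> * norm v0" using calculation(1) \<kappa> by (intro mult_left_mono) auto
  ultimately have vv0: "norm (v - v0) < \<kappa> * norm v0" by linarith
  have "norm v0 - norm v \<le> norm (v - v0)" by (metis norm_minus_commute norm_triangle_ineq2)
  with vv0 have v_ge: "norm v > (1 - \<kappa>) * norm v0" by (simp add: algebra_simps)
  have "(1 - \<kappa>) * norm v0 \<ge> 0" using \<kappa> by simp
  with v_ge show "v \<noteq> 0" by auto
  have "(1 - \<kappa>) * infdist z E \<le> (1 - \<kappa>) * norm v0"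
    using \<open>infdist z E \<le> norm v0\<close> \<kappa> by (intro mult_left_mono) auto
  with v_ge show "norm v \<ge> (1 - \<kappa>) * infdist z E" by simp
  have "\<kappa> * norm v0 = - cos \<phi> * ((1 - \<kappa>) * norm v0)"
    by (subst \<kappa>(3)) simp
  also have "\<dots> \<le> - cos \<phi> * norm v" using v_ge \<phi>(4) by (intro mult_left_mono) auto
  finally have "norm (v - v0) \<le> - cos \<phi> * norm v" using vv0 by simp
  then have "Re (v0 - v) \<le> - cos \<phi> * norm v"
    using complex_Re_le_cmod[of "v0 - v"] by (simp add: norm_minus_commute)
  with Re0 show "Re v \<ge> cos \<phi> * norm v" by simp
qed

lemma Re_term:
  assumes "z \<in> ball 0 1" "w \<in> U z" "m \<in> cantor_numerators q k"
  shows "Re ((1 - cnj (atom k m) * w) powr (- of_real \<sigma>)) \<ge> c * norm (atom k m - w) powr (- \<sigma>)"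
  using Re_powr_minus_ge[of \<sigma> "1 - cnj (atom k m) * w" \<phi>] sector[OF assms(1,2) atom_in_E[OF assms(3)]] a \<sigma> \<phi>
    norm_one_minus_cnj[OF norm_perfect_symmetric_set[OF atom_in_E[OF assms(3)]], of w]
  by (simp add: c_def)

text \<open>All terms have nonnegative real part on \<open>U z\<close>, so nothing cancels and any
  single atom gives a lower bound.\<close>

lemma Re_h:
  assumes "z \<in> ball 0 1" "w \<in> U z" "m \<in> cantor_numerators q k"
  shows "Re (h k w) \<ge> \<gamma> ^ k * (c * norm (atom k m - w) powr (- \<sigma>))"
proof -
  have nn: "0 \<le> Re ((1 - cnj (atom k m) * w) powr (- of_real \<sigma>))" if "m \<in> cantor_numerators q k" for m
    using Re_term[OF assms(1,2) that] c_pos by (smt (verit) mult_nonneg_nonneg powr_ge_zero)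
  have "c * norm (atom k m - w) powr (- \<sigma>) \<le> Re ((1 - cnj (atom k m) * w) powr (- of_real \<sigma>))"
    by (rule Re_term[OF assms])
  also have "\<dots> \<le> (\<Sum>m\<in>cantor_numerators q k. Re ((1 - cnj (atom k m) * w) powr (- of_real \<sigma>)))"
    using assms(3) nn by (intro member_le_sum finite_cantor_numerators) auto
  finally show ?thesis using \<gamma>(1) by (simp add: h_def Re_sum del: of_real_power)
qed

lemma cantor_numerators_nonempty: "0 \<in> cantor_numerators q k"
  by (induction k) auto

lemma Re_h_nonneg:
  assumes "z \<in> ball 0 1" "w \<in> U z"
  shows "Re (h k w) \<ge> 0"
  using Re_h[OF assms cantor_numerators_nonempty[of k]] c_pos \<gamma>(1) by (smt (verit) mult_nonneg_nonneg powr_ge_zero zero_le_power)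

lemma norm_h_le:
  assumes "z \<in> ball 0 1" "w \<in> U z"
  shows "norm (h k w) \<le> (2 * \<gamma>) ^ k * ((1 - \<kappa>) * infdist z E) powr (- \<sigma>)"
proof -
  let ?B = "((1 - \<kappa>) * infdist z E) powr (- \<sigma>)"
  have "norm ((1 - cnj (atom k m) * w) powr (- of_real \<sigma>)) \<le> ?B" if "m \<in> cantor_numerators q k" for m
    using sector[OF assms atom_in_E[OF that]] a \<sigma> \<kappa> infdist_perfect_symmetric_set[OF assms(1), of q]
    by (simp add: norm_complex_powr_minus powr_mono2')
  then have "norm (\<Sum>m\<in>cantor_numerators q k. (1 - cnj (atom k m) * w) powr (- of_real \<sigma>)) \<le>
      real (card (cantor_numerators q k)) * ?B"
    by (intro sum_norm_bound)
  also have "\<dots> \<le> 2 ^ k * ?B"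
    using card_cantor_numerators_le[of q k] by (intro mult_right_mono) (auto simp flip: of_nat_le_iff)
  finally show ?thesis
    using \<gamma>(1) by (simp add: h_def norm_mult norm_power power_mult_distrib mult_ac)
qed

text \<open>The sector avoids the branch cut of \<open>powr\<close>, because \<phi> < pi gives cos
  \<phi> > - 1.\<close>

lemma holomorphic_on_h:
  assumes "z \<in> ball 0 1"
  shows "h k holomorphic_on U z"
proof -
  have "1 - cnj (atom k m) * w \<notin> \<real>\<^sub>\<le>\<^sub>0" if "w \<in> U z" "m \<in> cantor_numerators q k" for w m
  proof
    define v where "v = 1 - cnj (atom k m) * w"
    assume "1 - cnj (atom k m) * w \<in> \<real>\<^sub>\<le>\<^sub>0"
    then have "norm v = - Re v" unfolding v_def[symmetric] by (auto simp: complex_nonpos_Reals_iff cmod_eq_Re)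
    moreover have "cos \<phi> > - 1"
    proof -
      have "cos pi < cos \<phi>"
        using \<phi> a \<sigma> by (intro cos_monotone_0_pi) (auto simp: \<phi>_def field_simps)
      then show ?thesis by simp
    qed
    moreover have "v \<noteq> 0" "Re v \<ge> cos \<phi> * norm v"
      using sector(1,2)[OF assms that(1) atom_in_E[OF that(2)]] by (simp_all add: v_def)
    moreover have "(cos \<phi> + 1) * norm v > 0"
      using calculation(2,3) by (intro mult_pos_pos) auto
    ultimately show False by (simp add: algebra_simps)
  qed
  then show ?thesis unfolding h_def[abs_def] by (intro holomorphic_intros) auto
qed

lemma summable_h:
  assumes "z \<in> ball 0 1" "w \<in> U z"
  shows "summable (\<lambda>k. h k w)"
proof (rule summable_comparison_test')
  show "summable (\<lambda>k. (2 * \<gamma>) ^ k * ((1 - \<kappa>) * infdist z E) powr (- \<sigma>))"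
    using \<gamma> by (intro summable_mult2 summable_geometric) auto
  show "norm (h k w) \<le> (2 * \<gamma>) ^ k * ((1 - \<kappa>) * infdist z E) powr (- \<sigma>)" for k
    by (rule norm_h_le[OF assms])
qed

lemma holomorphic_on_f_U:
  assumes z: "z \<in> ball 0 1"
  shows "f holomorphic_on U z"
proof -
  have "uniform_limit (U z) (\<lambda>n w. \<Sum>k<n. h k w) (\<lambda>w. \<Sum>k. h k w) sequentially"
  proof (rule Weierstrass_m_test)
    show "norm (h k w) \<le> (2 * \<gamma>) ^ k * ((1 - \<kappa>) * infdist z E) powr (- \<sigma>)" if "w \<in> U z" for k w
      by (rule norm_h_le[OF z that])
    show "summable (\<lambda>k. (2 * \<gamma>) ^ k * ((1 - \<kappa>) * infdist z E) powr (- \<sigma>))"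
      using \<gamma> by (intro summable_mult2 summable_geometric) auto
  qed
  note unif = this
  have op: "open (U z)" by (simp add: U_def)
  have "(\<lambda>w. \<Sum>k. h k w) holomorphic_on U z"
  proof (rule holomorphic_uniform_sequence[OF op])
    show "(\<lambda>w. \<Sum>k<n. h k w) holomorphic_on U z" for n
      using holomorphic_on_h[OF z] by (rule holomorphic_on_sum)
    show "\<exists>d. 0 < d \<and> cball x d \<subseteq> U z \<and>
        uniform_limit (cball x d) (\<lambda>n w. \<Sum>k<n. h k w) (\<lambda>w. \<Sum>k. h k w) sequentially"
      if "x \<in> U z" for x
      using op that uniform_limit_on_subset[OF unif] unfolding open_contains_cball by blast
  qed
  then show ?thesis unfolding f_def[abs_def] by (intro holomorphic_intros)
qed

lemma mem_U: "z \<in> ball 0 1 \<Longrightarrow> z \<in> U z"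
  using infdist_perfect_symmetric_set[of z q] \<kappa> by (simp add: U_def)

lemma holomorphic_on_f: "f holomorphic_on ball 0 1"
proof -
  have "f field_differentiable at z" if "z \<in> ball 0 1" for z
    using holomorphic_on_f_U[OF that] mem_U[OF that] by (auto simp: U_def holomorphic_on_open field_differentiable_def)
  then show ?thesis by (auto simp: holomorphic_on_def field_differentiable_at_within)
qed

text \<open>The power of q comes from the choice of the level, where q^-k is only known up to a
  factor q; 12 comes from the distance 12 d between \<open>w\<close> and the chosen atom.\<close>

definition "c0 = c * real q powr (a - \<sigma>) * 12 powr (- \<sigma>)"

lemma c0_pos: "c0 > 0"
  using c_pos q by (simp add: c0_def)

lemma norm_f_le:
  assumes z: "z \<in> ball 0 1" and w: "w \<in> U z"
  shows "norm (f w) \<le> exp (- (c0 * infdist z E powr (- a)))"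
proof -
  define d where "d = infdist z E"
  have d: "d > 0" "d \<le> 2" using infdist_perfect_symmetric_set[OF z, of q] by (auto simp: d_def)
  have "\<exists>k. (1 / real q) ^ k \<le> d"
    using real_arch_pow_inv[of d "1 / real q"] d q by (auto intro: less_imp_le)
  \<comment> \<open>Minimality also gives d/q \<le> q^-k; in the case k = 0 this follows from d
    \<le> 2 < q.\<close>
  then obtain k where k: "(1 / real q) ^ k \<le> d" and least: "\<And>j. (1 / real q) ^ j \<le> d \<Longrightarrow> k \<le> j"
    using LeastI_ex[of "\<lambda>k. (1 / real q) ^ k \<le> d"] Least_le[of "\<lambda>k. (1 / real q) ^ k \<le> d"] by metis
  have k': "d / real q \<le> (1 / real q) ^ k"
  proof (cases k)
    case 0
    then show ?thesis using d q by (simp add: field_simps)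
  next
    case (Suc j)
    then have "\<not> (1 / real q) ^ j \<le> d" using least[of j] by auto
    then show ?thesis using q by (simp add: Suc field_simps)
  qed
  \<comment> \<open>Doubling the distance provides a point of \<open>E\<close> without asking that
    the infimum be attained.\<close>
  have "\<exists>e\<in>E. dist z e < 2 * d"
  proof (rule ccontr)
    assume "\<not> (\<exists>e\<in>E. dist z e < 2 * d)"
    then have "2 * d \<le> infdist z E" using one_in_perfect_symmetric_set by (auto simp: infdist_def not_less intro!: cINF_greatest)
    with d show False by (simp add: d_def)
  qed
  then obtain e where e: "e \<in> E" "dist z e < 2 * d" by blast
  then obtain x where x: "x \<in> cantor_arguments q" "e = unit_exp (of_real x)" by (auto simp: perfect_symmetric_set_eq)
  obtain m y where my: "m \<in> cantor_numerators q k" "y \<in> cantor_arguments q" "real q ^ k * x = real m + y"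
    using cantor_arguments_expand[OF q x(1)] by metis
  have "norm (e - atom k m) \<le> 2 * pi * norm (complex_of_real x - of_real (real m / real q ^ k))"
    unfolding x(2) atom_def by (rule norm_unit_exp_diff_le) auto
  also have "complex_of_real x - of_real (real m / real q ^ k) = of_real (y * (1 / real q) ^ k)"
    using my(3) q by (simp add: field_simps flip: of_real_diff of_real_mult of_real_power)
  also have "norm (complex_of_real (y * (1 / real q) ^ k)) \<le> (1 / real q) ^ k"
    unfolding norm_of_real using cantor_arguments_bounds[OF q my(2)] by (simp add: abs_mult mult_left_le_one_le)
  also have "2 * pi * (1 / real q) ^ k \<le> 8 * d"
    using k pi_less_4 d by (intro mult_mono) auto
  finally have ea: "norm (e - atom k m) \<le> 8 * d" by simp
  have "norm (z - w) \<le> d"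
  proof -
    have "\<kappa> * d \<le> 1 * d" using \<kappa> d by (intro mult_right_mono) auto
    then show ?thesis using w by (simp add: U_def dist_norm d_def)
  qed
  moreover have "norm (atom k m - w) \<le> norm (atom k m - e) + norm (e - z) + norm (z - w)"
    using norm_triangle_ineq[of "atom k m - e" "e - z"] norm_triangle_ineq[of "atom k m - z" "z - w"] by simp
  \<comment> \<open>The three distances are at most 8 d, 2 d and d, where 8 stands for 2 pi.\<close>
  ultimately have aw: "norm (atom k m - w) \<le> 12 * d"
    using ea e(2) d by (simp add: dist_norm norm_minus_commute)
  have aw0: "norm (atom k m - w) > 0"
    using sector(1)[OF z w atom_in_E[OF my(1)]]
      norm_one_minus_cnj[OF norm_perfect_symmetric_set[OF atom_in_E[OF my(1)]], of w] by (metis zero_less_norm_iff)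
  have \<gamma>k: "\<gamma> ^ k \<ge> (d / real q) powr (\<sigma> - a)"
  proof -
    have "(d / real q) powr (\<sigma> - a) \<le> ((1 / real q) ^ k) powr (\<sigma> - a)"
      using k' d \<sigma> q by (intro powr_mono2) auto
    also have "\<dots> = \<gamma> ^ k"
      using q by (simp add: \<gamma>_def powr_power powr_powr powr_divide powr_realpow[symmetric] powr_minus_divide
          field_simps flip: powr_add)
    finally show ?thesis .
  qed
  have "c0 * d powr (- a) = (d / real q) powr (\<sigma> - a) * (c * (12 * d) powr (- \<sigma>))"
    using d q by (simp add: c0_def powr_mult powr_divide powr_diff powr_minus field_simps flip: powr_add)
  also have "\<dots> \<le> \<gamma> ^ k * (c * norm (atom k m - w) powr (- \<sigma>))"
    using aw aw0 \<gamma>k c_pos a \<sigma> \<gamma>(1) by (intro mult_mono powr_mono2') auto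
  also have "\<dots> \<le> Re (h k w)" by (rule Re_h[OF z w my(1)])
  also have "\<dots> = (\<Sum>j\<in>{k}. Re (h j w))" by simp
  also have "\<dots> \<le> (\<Sum>j. Re (h j w))"
    using Re_h_nonneg[OF z w] summable_h[OF z w] by (intro sum_le_suminf summable_Re) auto
  also have "\<dots> = Re (\<Sum>j. h j w)" using summable_h[OF z w] by (simp add: Re_suminf)
  finally show ?thesis by (simp add: f_def norm_exp_eq_Re d_def)
qed

text \<open>Cauchy's inequality on a circle of radius proportional to the distance from
  \<open>E\<close> loses only d^-p, which flatness absorbs. A radius limited by the distance to the
  unit circle would give no uniform bound.\<close>

lemma higher_deriv_f_bounded:
  obtains C where "\<And>z. z \<in> ball 0 1 \<Longrightarrow> norm ((deriv ^^ p) f z) \<le> C"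
proof -
  obtain C where C: "\<And>d. d > 0 \<Longrightarrow> exp (- (c0 * d powr (- a))) / d ^ p \<le> C"
    using exp_minus_powr_over_power_bounded[OF a c0_pos] by blast
  have "norm ((deriv ^^ p) f z) \<le> fact p * C / (\<kappa> / 2) ^ p" if z: "z \<in> ball 0 1" for z
  proof -
    define d where "d = infdist z E"
    have d: "d > 0" using infdist_perfect_symmetric_set[OF z, of q] by (simp add: d_def)
    define r where "r = \<kappa> * d / 2"
    have "\<kappa> * d > 0" using d \<kappa> by simp
    then have r: "r > 0" "cball z r \<subseteq> U z" by (auto simp: r_def U_def d_def)
    have hol: "f holomorphic_on cball z r" by (rule holomorphic_on_subset[OF holomorphic_on_f_U[OF z] r(2)])
    have "norm ((deriv ^^ p) f z) \<le> fact p * exp (- (c0 * d powr (- a))) / r ^ p"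
    proof (rule Cauchy_inequality)
      show "f holomorphic_on ball z r" using hol by (rule holomorphic_on_subset) auto
      show "continuous_on (cball z r) f" by (rule holomorphic_on_imp_continuous_on[OF hol])
      show "norm (f x) \<le> exp (- (c0 * d powr (- a)))" if "norm (z - x) = r" for x
        unfolding d_def using that r(2) by (intro norm_f_le[OF z]) (auto simp: dist_norm)
    qed (rule r(1))
    also have "\<dots> = fact p * (exp (- (c0 * d powr (- a))) / d ^ p) / (\<kappa> / 2) ^ p"
      by (simp add: r_def power_mult_distrib power_divide)
    also have "\<dots> \<le> fact p * C / (\<kappa> / 2) ^ p"
      using C[OF d] \<kappa> by (intro divide_right_mono mult_left_mono) auto
    finally show ?thesis .
  qed
  with that show ?thesis by blast
qed

section \<open>Taylor coefficients of the flat function\<close>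

definition coef :: "nat \<Rightarrow> complex" where
  "coef l = (deriv ^^ l) f 0 / fact l"

lemma coef_sums: "norm z < 1 \<Longrightarrow> (\<lambda>l. coef l * z ^ l) sums f z"
  using holomorphic_power_series[OF holomorphic_on_f, of z] by (simp add: coef_def)

lemma coef_0: "coef 0 \<noteq> 0"
  by (simp add: coef_def f_def)

text \<open>Cauchy's inequality for the p-th derivative, which is bounded on the disc; the gain (l +
  1)^p is a lower bound for (l + p)!/l!.\<close>

lemma coef_decay:
  obtains C where "\<And>l. norm (coef (l + p)) * (real l + 1) ^ p \<le> C"
proof -
  obtain C where C: "\<And>z. z \<in> ball 0 1 \<Longrightarrow> norm ((deriv ^^ p) f z) \<le> C"
    using higher_deriv_f_bounded by blast
  have "norm (coef (l + p)) * (real l + 1) ^ p \<le> C" for l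
  proof -
    have hol: "(deriv ^^ p) f holomorphic_on ball 0 1"
      by (intro holomorphic_higher_deriv holomorphic_on_f) auto
    define X where "X = norm ((deriv ^^ (l + p)) f 0)"
    have "X * r ^ l \<le> fact l * C" if r: "0 < r" "r < 1" for r
    proof -
      have sub: "cball 0 r \<subseteq> ball (0::complex) 1" using r by auto
      have "norm ((deriv ^^ l) ((deriv ^^ p) f) 0) \<le> fact l * C / r ^ l"
      proof (rule Cauchy_inequality)
        show "(deriv ^^ p) f holomorphic_on ball 0 r" using hol by (rule holomorphic_on_subset) (use r in auto)
        show "continuous_on (cball 0 r) ((deriv ^^ p) f)"
          by (rule holomorphic_on_imp_continuous_on[OF holomorphic_on_subset[OF hol sub]])
        show "norm ((deriv ^^ p) f x) \<le> C" if "norm (0 - x) = r" for x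
          using that r by (intro C) auto
      qed (rule r(1))
      then show ?thesis using r by (simp add: X_def funpow_add field_simps)
    qed
    \<comment> \<open>The derivative is bounded only on the open disc, so the radius 1 is reached as
      a limit.\<close>
    then have "\<forall>\<^sub>F r in at_left 1. X * r ^ l \<le> fact l * C"
      by (subst eventually_at_left[of 0]) (auto intro!: exI[of _ 0])
    moreover have "((\<lambda>r. X * r ^ l) \<longlongrightarrow> X * 1 ^ l) (at_left 1)" by (intro tendsto_intros)
    ultimately have "X * 1 ^ l \<le> fact l * C" by (intro tendsto_upperbound[of _ _ "at_left (1::real)"]) auto
    moreover have "fact l * (real l + 1) ^ p \<le> fact (l + p)"
    proof (induction p)
      case (Suc p)
      have "fact l * (real l + 1) ^ Suc p = (real l + 1) * (fact l * (real l + 1) ^ p)" by simp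
      also have "\<dots> \<le> (real l + real p + 1) * fact (l + p)" using Suc by (intro mult_mono) auto
      also have "\<dots> = fact (l + Suc p)" by (simp add: algebra_simps)
      finally show ?case .
    qed simp
    ultimately have "X * (fact l * (real l + 1) ^ p) \<le> (fact l * C) * fact (l + p)"
      by (intro mult_mono) (auto simp: X_def intro: order_trans[OF norm_ge_zero])
    then have "X * (real l + 1) ^ p \<le> C * fact (l + p)"
      by (simp add: field_simps)
    then show ?thesis by (simp add: coef_def X_def norm_divide field_simps)
  qed
  with that show ?thesis by blast
qed

lemma summable_coef: "summable (\<lambda>l. norm (coef l) * (real l + 1) powr s)"
proof -
  \<comment> \<open>Two powers beyond |s| leave the convergent series of (l + 1)^-2.\<close>
  define p where "p = nat \<lceil>\<bar>s\<bar>\<rceil> + 2"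
  have p: "real p \<ge> \<bar>s\<bar> + 2" unfolding p_def by linarith
  obtain C where C: "\<And>l. norm (coef (l + p)) * (real l + 1) ^ p \<le> C" using coef_decay by blast
  have "summable (\<lambda>l. norm (coef (l + p)) * (real (l + p) + 1) powr s)"
  proof (rule summable_comparison_test')
    have "summable (\<lambda>l. 1 / real (Suc l) ^ 2)"
      using inverse_power_summable[of 2, where 'a = real] by (subst summable_Suc_iff) (simp add: inverse_eq_divide)
    then show "summable (\<lambda>l. C * (real p + 1) powr \<bar>s\<bar> * (1 / real (Suc l) ^ 2))" by (rule summable_mult)
    show "norm (norm (coef (l + p)) * (real (l + p) + 1) powr s) \<le> C * (real p + 1) powr \<bar>s\<bar> * (1 / real (Suc l) ^ 2)" for l
    proof -
      have "(real (l + p) + 1) powr s \<le> (real (l + p) + 1) powr \<bar>s\<bar>" by (intro powr_mono) auto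
      also have "\<dots> \<le> ((real p + 1) * (real l + 1)) powr \<bar>s\<bar>"
        by (intro powr_mono2) (auto simp: algebra_simps)
      also have "\<dots> = (real p + 1) powr \<bar>s\<bar> * (real l + 1) powr \<bar>s\<bar>" by (simp add: powr_mult)
      finally have "norm (coef (l + p)) * (real (l + p) + 1) powr s \<le>
          norm (coef (l + p)) * ((real p + 1) powr \<bar>s\<bar> * (real l + 1) powr \<bar>s\<bar>)"
        by (intro mult_left_mono) auto
      also have "norm (coef (l + p)) \<le> C * (1 / (real l + 1) ^ p)" using C[of l] by (simp add: field_simps)
      also have "C * (1 / (real l + 1) ^ p) * ((real p + 1) powr \<bar>s\<bar> * (real l + 1) powr \<bar>s\<bar>)
          = C * (real p + 1) powr \<bar>s\<bar> * (real l + 1) powr (\<bar>s\<bar> - real p)"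
        by (simp add: powr_diff powr_realpow)
      also have "\<dots> \<le> C * (real p + 1) powr \<bar>s\<bar> * (real l + 1) powr (- 2)"
      proof -
        have "0 \<le> C" using C[of 0] by (smt (verit) mult_nonneg_nonneg norm_ge_zero zero_le_power of_nat_0_le_iff)
        then show ?thesis using p by (intro mult_left_mono powr_mono) auto
      qed
      finally show ?thesis by (simp add: powr_minus_divide powr_numeral add.commute)
    qed
  qed
  then show ?thesis by (subst (asm) summable_iff_shift)
qed

end

section \<open>Integrals over horizontal segments\<close>

lemma contour_integral_suminf_linepath:
  assumes cont: "\<And>n. continuous_on (closed_segment a b) (F n)"
    and le: "\<And>n v. v \<in> closed_segment a b \<Longrightarrow> norm (F n v) \<le> M n" and M: "summable M"
  shows "(\<lambda>n. contour_integral (linepath a b) (F n)) sums contour_integral (linepath a b) (\<lambda>v. \<Sum>n. F n v)"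
proof -
  have "uniform_limit (closed_segment a b) (\<lambda>N w. \<Sum>n<N. F n w) (\<lambda>v. \<Sum>n. F n v) sequentially"
    using le M by (intro Weierstrass_m_test[where M = M]) auto
  from contour_integral_sums_linepath[OF this cont] show ?thesis
    by (metis contour_integral_unique)
qed

lemma contour_integral_unit_exp:
  "contour_integral (linepath p (p + 1)) (\<lambda>v. unit_exp (of_int k * v)) = (if k = 0 then 1 else 0)"
proof (cases "k = 0")
  case True
  have "contour_integral (linepath p (p + 1)) (\<lambda>v. 1) = 1 * (p + 1 - p)"
    by (intro contour_integral_unique has_contour_integral_const_linepath)
  then show ?thesis using True by (simp add: unit_exp_def)
next
  case False
  let ?g = "\<lambda>v. unit_exp (of_int k * v) / (2 * of_real pi * \<i> * of_int k)"
  have "((\<lambda>v. unit_exp (of_int k * v)) has_contour_integral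
      (?g (pathfinish (linepath p (p + 1))) - ?g (pathstart (linepath p (p + 1))))) (linepath p (p + 1))"
  proof (rule contour_integral_primitive[where S = UNIV])
    show "(?g has_field_derivative unit_exp (of_int k * v)) (at v within UNIV)" for v
      unfolding unit_exp_def using False by (auto intro!: derivative_eq_intros)
  qed auto
  moreover have "unit_exp (of_int k * (p + 1)) = unit_exp (of_int k * p)"
    by (simp add: ring_distribs unit_exp_add unit_exp_of_int)
  ultimately show ?thesis using False by (simp add: contour_integral_unique)
qed

lemma Im_closed_segment_horizontal:
  assumes "v \<in> closed_segment p (p + 1)"
  shows "Im v = Im p"
proof -
  obtain u where "v = (1 - u) *\<^sub>R p + u *\<^sub>R (p + 1)" using assms by (auto simp: in_segment)
  then show ?thesis by (simp add: algebra_simps)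
qed

text \<open>Extraction of a Fourier coefficient: over one period only the term l = - k survives. The
  dilation \<open>r\<close> keeps the argument of \<open>g\<close> in the disc even on segments
  below the real line.\<close>

lemma contour_integral_unit_exp_power_series:
  assumes g: "\<And>z. norm z < 1 \<Longrightarrow> (\<lambda>l. G l * z ^ l) sums g z" and G: "summable (\<lambda>l. norm (G l))"
    and r: "0 \<le> r" "r * exp (- 2 * pi * Im p) < 1"
  shows "contour_integral (linepath p (p + 1)) (\<lambda>v. unit_exp (of_int k * v) * g (of_real r * unit_exp v)) =
    (if k \<le> 0 then G (nat (- k)) * of_real r ^ nat (- k) else 0)"
proof -
  define F where "F l v = G l * of_real r ^ l * unit_exp (of_int (k + int l) * v)" for l v
  have F_eq: "F l v = unit_exp (of_int k * v) * (G l * (of_real r * unit_exp v) ^ l)" for l v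
    by (simp add: F_def ring_distribs unit_exp_add unit_exp_power power_mult_distrib)
  have small: "norm (of_real r * unit_exp v) < 1" if "v \<in> closed_segment p (p + 1)" for v
    using Im_closed_segment_horizontal[OF that] r by (simp add: norm_mult norm_unit_exp)
  have "(\<lambda>l. contour_integral (linepath p (p + 1)) (F l)) sums
      contour_integral (linepath p (p + 1)) (\<lambda>v. \<Sum>l. F l v)"
  proof (rule contour_integral_suminf_linepath)
    show "continuous_on (closed_segment p (p + 1)) (F l)" for l
      unfolding F_def unit_exp_def by (intro continuous_intros)
    show "norm (F l v) \<le> exp (- 2 * pi * (of_int k * Im p)) * norm (G l)" if "v \<in> closed_segment p (p + 1)" for l v
    proof -
      have "norm (F l v) = exp (- 2 * pi * (of_int k * Im p)) * (norm (G l) * norm (of_real r * unit_exp v) ^ l)"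
        unfolding F_eq norm_mult norm_power using Im_closed_segment_horizontal[OF that]
        by (simp add: norm_unit_exp)
      also have "norm (of_real r * unit_exp v) ^ l \<le> 1"
        using small[OF that] by (intro power_le_one) auto
      finally show ?thesis by (simp add: mult_left_mono)
    qed
    show "summable (\<lambda>l. exp (- 2 * pi * (of_int k * Im p)) * norm (G l))" by (intro summable_mult G)
  qed
  moreover have "contour_integral (linepath p (p + 1)) (\<lambda>v. \<Sum>l. F l v) =
      contour_integral (linepath p (p + 1)) (\<lambda>v. unit_exp (of_int k * v) * g (of_real r * unit_exp v))"
  proof (rule contour_integral_eq)
    fix v assume "v \<in> path_image (linepath p (p + 1))"
    then have "(\<lambda>l. unit_exp (of_int k * v) * (G l * (of_real r * unit_exp v) ^ l)) sums
        (unit_exp (of_int k * v) * g (of_real r * unit_exp v))"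
      using small by (intro sums_mult g) auto
    then show "(\<Sum>l. F l v) = unit_exp (of_int k * v) * g (of_real r * unit_exp v)"
      unfolding F_eq by (rule sums_unique[symmetric])
  qed
  moreover have "contour_integral (linepath p (p + 1)) (F l) = (if k + int l = 0 then G l * of_real r ^ l else 0)" for l
  proof -
    have "contour_integral (linepath p (p + 1)) (F l) = G l * of_real r ^ l *
        contour_integral (linepath p (p + 1)) (\<lambda>v. unit_exp (of_int (k + int l) * v))"
      unfolding F_def[abs_def]
      by (intro contour_integral_lmul contour_integrable_continuous_linepath)
         (auto simp: unit_exp_def intro!: continuous_intros)
    then show ?thesis by (simp only: contour_integral_unit_exp) simp
  qed
  ultimately have sums: "(\<lambda>l. if k + int l = 0 then G l * of_real r ^ l else 0) sums
      contour_integral (linepath p (p + 1)) (\<lambda>v. unit_exp (of_int k * v) * g (of_real r * unit_exp v))"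
    by simp
  show ?thesis
  proof (cases "k \<le> 0")
    case True
    then have "(\<lambda>l. if k + int l = 0 then G l * of_real r ^ l else 0) =
        (\<lambda>l. if l = nat (- k) then G l * of_real r ^ l else 0)"
      by (intro ext if_cong) auto
    then have "(\<lambda>l. if k + int l = 0 then G l * of_real r ^ l else 0) sums (G (nat (- k)) * of_real r ^ nat (- k))"
      using sums_single[of "nat (- k)" "\<lambda>l. G l * of_real r ^ l"] by simp
    from sums_unique2[OF sums this] show ?thesis using True by simp
  next
    case False
    then have "(\<lambda>l. if k + int l = 0 then G l * of_real r ^ l else 0) = (\<lambda>_. 0)" by auto
    then show ?thesis using sums False sums_unique2[OF sums] by (simp add: sums_iff)
  qed
qed

text \<open>A Young type inequality. The threshold (2/y)^(1/(1-\<beta>)) is where n^\<beta> = n y/2;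
  the exponent \<beta>/(1-\<beta>) of the resolvent bound originates here.\<close>

lemma powr_le_linear_plus_powr:
  fixes \<beta> n y :: real
  assumes \<beta>: "0 < \<beta>" "\<beta> < 1" and y: "y > 0" and n: "n \<ge> 0"
  shows "n powr \<beta> \<le> n * y / 2 + (2 / y) powr (\<beta> / (1 - \<beta>))"
proof (cases "n \<le> (2 / y) powr (1 / (1 - \<beta>))")
  case True
  then have "n powr \<beta> \<le> ((2 / y) powr (1 / (1 - \<beta>))) powr \<beta>"
    using n \<beta> by (intro powr_mono2) auto
  also have "\<dots> = (2 / y) powr (\<beta> / (1 - \<beta>))" by (simp add: powr_powr)
  finally show ?thesis using n y by (simp add: add_increasing)
next
  case False
  then have n0: "n > 0" using n by (smt (verit) powr_ge_zero)
  have "2 / y = ((2 / y) powr (1 / (1 - \<beta>))) powr (1 - \<beta>)" using \<beta> y by (simp add: powr_powr)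
  also have "\<dots> \<le> n powr (1 - \<beta>)" using False \<beta> by (intro powr_mono2) auto
  finally have "2 / y * n powr \<beta> \<le> n powr (1 - \<beta>) * n powr \<beta>" by (intro mult_right_mono) auto
  also have "\<dots> = n" using n0 by (simp flip: powr_add)
  finally have "n powr \<beta> \<le> n * y / 2" using y by (simp add: field_simps)
  then show ?thesis by (simp add: add_increasing2)
qed

text \<open>Half of the decay y n compensates n^\<beta>, the other half sums a geometric series. The
  sum 1 + 2/y of upper bound type is a power of X = (2/y)^\<alpha> up to constants and is absorbed
  by doubling the exponent.\<close>

lemma sum_exp_powr_bound:
  fixes \<beta> :: real
  assumes \<beta>: "0 < \<beta>" "\<beta> < 1"
  shows "\<exists>A>0. \<forall>y>0. summable (\<lambda>n. exp (real n powr \<beta> - y * real n)) \<and>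
    (\<Sum>n. exp (real n powr \<beta> - y * real n)) \<le> A * exp (2 * (2 / y) powr (\<beta> / (1 - \<beta>)))"
proof -
  define \<alpha> where "\<alpha> = \<beta> / (1 - \<beta>)"
  have \<alpha>: "\<alpha> > 0" using \<beta> by (simp add: \<alpha>_def)
  define n where "n = nat \<lceil>1 / \<alpha>\<rceil>"
  define A :: real where "A = 2 + fact n"
  have term_le: "exp (real k powr \<beta> - y * real k) \<le> exp ((2 / y) powr \<alpha>) * exp (- (y / 2)) ^ k" if "y > 0" for k y
    using powr_le_linear_plus_powr[OF \<beta> that, of "real k"]
    by (simp add: \<alpha>_def field_simps flip: exp_of_nat_mult exp_add)
  have geo: "summable (\<lambda>k. exp ((2 / y) powr \<alpha>) * exp (- (y / 2)) ^ k)" if "y > 0" for y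
    using that by (intro summable_mult summable_geometric) auto
  have summ: "summable (\<lambda>n. exp (real n powr \<beta> - y * real n))" if "y > 0" for y
    using term_le[OF that] by (intro summable_comparison_test'[OF geo[OF that]]) auto
  moreover have "(\<Sum>n. exp (real n powr \<beta> - y * real n)) \<le> A * exp (2 * (2 / y) powr \<alpha>)" if y: "y > 0" for y
  proof -
    define X where "X = (2 / y) powr \<alpha>"
    have X: "X > 0" using y by (simp add: X_def)
    have "(\<Sum>k. exp (real k powr \<beta> - y * real k)) \<le> (\<Sum>k. exp X * exp (- (y / 2)) ^ k)"
      unfolding X_def by (intro suminf_le term_le summ geo y)
    also have "\<dots> = exp X * (1 / (1 - exp (- (y / 2))))"
      using y by (subst suminf_mult) (auto intro!: summable_geometric simp: suminf_geometric)
    also have "1 / (1 - exp (- (y / 2))) \<le> 1 + 2 / y"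
    proof -
      have "1 + y / 2 \<le> exp (y / 2)" by (rule exp_ge_add_one_self)
      then have "exp (- (y / 2)) \<le> 1 / (1 + y / 2)"
        using y by (simp add: exp_minus field_simps)
      then have "1 - exp (- (y / 2)) \<ge> (y / 2) / (1 + y / 2)" using y by (simp add: field_simps)
      then have "1 / (1 - exp (- (y / 2))) \<le> 1 / ((y / 2) / (1 + y / 2))"
        using y by (intro divide_left_mono mult_pos_pos) (auto intro: less_le_trans[rotated])
      also have "\<dots> = 1 + 2 / y" using y by (simp add: field_simps)
      finally show ?thesis .
    qed
    also have "2 / y = X powr (1 / \<alpha>)" using y \<alpha> by (simp add: X_def powr_powr)
    also have "1 + X powr (1 / \<alpha>) \<le> 2 + X ^ n"
    proof (cases "X \<le> 1")
      case True
      then have "X powr (1 / \<alpha>) \<le> 1" using powr_mono2[of "1 / \<alpha>" X 1] X \<alpha> by simp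
      then show ?thesis using X by (smt (verit) zero_le_power)
    next
      case False
      then have "X powr (1 / \<alpha>) \<le> X powr real n"
        by (intro powr_mono) (auto simp: n_def real_nat_ceiling_ge)
      then show ?thesis using X by (simp add: powr_realpow)
    qed
    also have "2 + X ^ n \<le> A * exp X"
    proof -
      have "1 \<le> exp X" using X by simp
      then have "2 + X ^ n \<le> 2 * exp X + fact n * exp X"
        using power_le_exp[of X n] X by linarith
      then show ?thesis by (simp add: A_def algebra_simps)
    qed
    finally show ?thesis using X by (simp add: X_def mult_exp_exp mult.left_commute)
  qed
  moreover have "A > 0" by (simp add: A_def add_pos_pos)
  ultimately show ?thesis unfolding \<alpha>_def[symmetric] by blast
qed

section \<open>The pairing of the resolvent with a flat function\<close>

text \<open>On the convex set \<open>S\<close> the function has a primitive up to the boundary, and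
  the four integrals telescope.\<close>

lemma contour_integral_rectangle_zero:
  assumes hol: "h holomorphic_on S" and S: "convex S" and pts: "a \<in> S" "b \<in> S" "c \<in> S" "d \<in> S"
  shows "contour_integral (linepath a b) h + contour_integral (linepath b c) h +
    contour_integral (linepath c d) h + contour_integral (linepath d a) h = 0"
proof -
  have diff: "h field_differentiable at x" if "x \<in> interior S - {}" for x
    using that holomorphic_on_subset[OF hol interior_subset] by (auto intro: holomorphic_on_imp_differentiable_at)
  obtain P where P: "\<And>x. x \<in> S \<Longrightarrow> (P has_field_derivative h x) (at x within S)"
    using holomorphic_convex_primitive[OF S finite.emptyI holomorphic_on_imp_continuous_on[OF hol] diff] by metis
  have "contour_integral (linepath x y) h = P y - P x" if "x \<in> S" "y \<in> S" for x y
  proof -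
    have "closed_segment x y \<subseteq> S" using that S by (simp add: closed_segment_subset)
    then have "(h has_contour_integral (P (pathfinish (linepath x y)) - P (pathstart (linepath x y)))) (linepath x y)"
      by (intro contour_integral_primitive[where S = S] P) auto
    then show ?thesis by (simp add: contour_integral_unique)
  qed
  then show ?thesis using pts by simp
qed

lemma contour_integral_split_horizontal:
  assumes cont: "continuous_on {v. Im v = y} h" and x: "\<And>i j. i \<le> j \<Longrightarrow> x i \<le> x j"
  shows "(\<Sum>j<n. contour_integral (linepath (Complex (x j) y) (Complex (x (Suc j)) y)) h) =
    contour_integral (linepath (Complex (x 0) y) (Complex (x n) y)) h"
proof (induction n)
  case 0
  show ?case by (simp only: lessThan_0 sum.empty contour_integral_trivial)
next
  case (Suc n)
  have "contour_integral (linepath (Complex (x 0) y) (Complex (x (Suc n)) y)) h =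
      contour_integral (linepath (Complex (x 0) y) (Complex (x n) y)) h +
      contour_integral (linepath (Complex (x n) y) (Complex (x (Suc n)) y)) h"
  proof (rule contour_integral_split_linepath)
    show "continuous_on (closed_segment (Complex (x 0) y) (Complex (x (Suc n)) y)) h"
      by (rule continuous_on_subset[OF cont]) (auto simp: closed_segment_same_Im)
    show "Complex (x n) y \<in> closed_segment (Complex (x 0) y) (Complex (x (Suc n)) y)"
      using x[of 0 n] x[of n "Suc n"] by (auto simp: closed_segment_same_Im closed_segment_eq_real_ivl)
  qed
  then show ?case using Suc by simp
qed

lemma contour_integral_linepath_periodic:
  assumes "\<And>v. h (v + w) = h v"
  shows "contour_integral (linepath (a + w) (b + w)) h = contour_integral (linepath a b) h"
proof -
  have "linepath (a + w) (b + w) t = linepath a b t + w" for t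
    by (simp add: linepath_def algebra_simps)
  then show ?thesis by (simp add: contour_integral_integral assms)
qed

lemma continuous_on_unit_exp: "continuous_on S f \<Longrightarrow> continuous_on S (\<lambda>v. unit_exp (f v))"
  unfolding unit_exp_def by (intro continuous_intros)

lemma unit_exp_minus: "unit_exp (- v) = inverse (unit_exp v)"
  by (simp add: unit_exp_def exp_minus)

text \<open>The comparison that makes \<open>f (T)\<close> vanish: for \<alpha> < a flatness beats
  the growth of the resolvent, whatever the constants.\<close>

lemma exp_powr_difference_tendsto_0:
  fixes \<alpha> a B c :: real
  assumes "0 < c" "\<alpha> < a" "0 < \<alpha>"
  shows "((\<lambda>d. exp (B * d powr (- \<alpha>) - c * d powr (- a))) \<longlongrightarrow> 0) (at_right 0)"
proof -
  have "((\<lambda>d::real. B * d powr (a - \<alpha>)) \<longlongrightarrow> B * 0) (at_right 0)"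
    using assms by (intro tendsto_mult tendsto_const) real_asymp
  then have "((\<lambda>d::real. c - B * d powr (a - \<alpha>)) \<longlongrightarrow> c - B * 0) (at_right 0)"
    by (intro tendsto_diff tendsto_const)
  moreover have "filterlim (\<lambda>d::real. d powr (- a)) at_top (at_right 0)"
    using assms by real_asymp
  ultimately have "filterlim (\<lambda>d::real. (c - B * d powr (a - \<alpha>)) * d powr (- a)) at_top (at_right 0)"
    using assms by (intro filterlim_tendsto_pos_mult_at_top) auto
  then have "filterlim (\<lambda>d::real. - ((c - B * d powr (a - \<alpha>)) * d powr (- a))) at_bot (at_right 0)"
    by (simp add: filterlim_uminus_at_bot)
  then have "((\<lambda>d. exp (- ((c - B * d powr (a - \<alpha>)) * d powr (- a)))) \<longlongrightarrow> 0) (at_right 0)"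
    by (rule filterlim_compose[OF exp_at_bot])
  moreover have "- ((c - B * d powr (a - \<alpha>)) * d powr (- a)) = B * d powr (- \<alpha>) - c * d powr (- a)" for d
    by (simp add: algebra_simps flip: powr_add)
  ultimately show ?thesis by simp
qed

lemma summable_exp_powr:
  fixes \<beta> y :: real
  assumes "0 < \<beta>" "\<beta> < 1" "0 < y"
  shows "summable (\<lambda>n. exp (real n powr \<beta> - y * real n))"
  using sum_exp_powr_bound[OF assms(1,2)] assms(3) by blast

text \<open>The scalar form of g(T) x = 0. \<open>V\<close> stands for a functional k of the
  resolvent at x, \<open>u n\<close> for k(T^n x) and \<open>u' n\<close> for k(T^-(n+1) x); the sum
  of \<open>u n * G n\<close> is then k(g(T) x).\<close>

locale cantor_pairing =
  fixes q :: nat and K :: "complex set" and V :: "complex \<Rightarrow> complex" and u u' :: "nat \<Rightarrow> complex" and C \<beta> :: real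
    and g :: "complex \<Rightarrow> complex" and G :: "nat \<Rightarrow> complex" and c a :: real
  assumes q: "q \<ge> 3" and K: "closed K" "K \<subseteq> perfect_symmetric_set (1 / real q)"
    and V: "V holomorphic_on - K"
    and V_out: "\<And>z. 1 < norm z \<Longrightarrow> (\<lambda>n. u n * inverse z ^ n) sums (- (z * V z))"
    and V_in: "\<And>z. norm z < 1 \<Longrightarrow> (\<lambda>n. u' n * z ^ n) sums V z"
    and u: "\<And>n. norm (u n) \<le> C * exp (real n powr \<beta>)"
    and u': "\<And>n. norm (u' n) \<le> C * exp (real (Suc n) powr \<beta>)"
    and \<beta>: "0 < \<beta>" "\<beta> < 1 / 2"
    and g: "g holomorphic_on ball 0 1" "\<And>z. norm z < 1 \<Longrightarrow> (\<lambda>l. G l * z ^ l) sums g z"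
    and G: "summable (\<lambda>l. norm (G l))" "summable (\<lambda>l. norm (u l * G l))"
    and c: "c > 0" and flat: "\<And>z. z \<in> ball 0 1 \<Longrightarrow>
      norm (g z) \<le> exp (- (c * infdist z (perfect_symmetric_set (1 / real q)) powr (- a)))"
    and a: "\<beta> / (1 - \<beta>) < a"
begin

abbreviation "E \<equiv> perfect_symmetric_set (1 / real q)"

definition "\<alpha> = \<beta> / (1 - \<beta>)"

lemma \<alpha>: "0 < \<alpha>" "\<alpha> < 1"
  using \<beta> by (auto simp: \<alpha>_def field_simps)

lemma C_nonneg: "C \<ge> 0"
  using order_trans[OF norm_ge_zero u[of 0]] by (simp add: zero_le_mult_iff)

lemma unit_exp_notin_K: "Im v \<noteq> 0 \<Longrightarrow> unit_exp v \<notin> K"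
  using K(2) norm_perfect_symmetric_set[of "unit_exp v" q] by (auto simp: norm_unit_exp)

lemma V_bound:
  obtains A where "A > 0" "\<And>v. Im v \<noteq> 0 \<Longrightarrow> \<bar>Im v\<bar> \<le> 1 \<Longrightarrow>
    norm (V (unit_exp v)) \<le> A * exp (2 * \<bar>Im v\<bar> powr (- \<alpha>))"
proof -
  have beta1: "\<beta> < 1" using \<beta> by simp
  obtain A0 where A0: "A0 > 0" "\<And>y. y > 0 \<Longrightarrow> summable (\<lambda>n. exp (real n powr \<beta> - y * real n))"
    "\<And>y. y > 0 \<Longrightarrow> (\<Sum>n. exp (real n powr \<beta> - y * real n)) \<le> A0 * exp (2 * (2 / y) powr \<alpha>)"
    using sum_exp_powr_bound[OF \<beta>(1) beta1] unfolding \<alpha>_def by blast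
  \<comment> \<open>The factor exp(2 pi) pays for the shift from n to n + 1 in the series inside the
    disc, where y \<le> 2 pi; C + 1 keeps \<open>A\<close> positive when C = 0.\<close>
  define A where "A = exp (2 * pi) * ((C + 1) * A0)"
  have "norm (V (unit_exp v)) \<le> A * exp (2 * \<bar>Im v\<bar> powr (- \<alpha>))" if v: "Im v \<noteq> 0" "\<bar>Im v\<bar> \<le> 1" for v
  proof -
    define z where "z = unit_exp v"
    define y where "y = 2 * pi * \<bar>Im v\<bar>"
    have y: "y > 0" "y \<le> 2 * pi" using v by (auto simp: y_def)
    define S where "S = (\<Sum>n. exp (real n powr \<beta> - y * real n))"
    have S0: "S \<ge> 0" unfolding S_def by (intro suminf_nonneg A0 y) auto
    have VS: "norm (V z) \<le> exp (2 * pi) * (C * S)"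
    proof (cases "Im v > 0")
      case True
      have nz: "norm z = exp (- y)" using True by (simp add: z_def norm_unit_exp y_def)
      have le: "norm (u' n * z ^ n) \<le> exp y * C * exp (real (Suc n) powr \<beta> - y * real (Suc n))" for n
      proof -
        have "norm (u' n * z ^ n) \<le> (C * exp (real (Suc n) powr \<beta>)) * exp (- y) ^ n"
          unfolding norm_mult norm_power nz by (intro mult_right_mono u') auto
        also have "\<dots> = exp y * C * exp (real (Suc n) powr \<beta> - y * real (Suc n))"
          by (simp add: exp_diff exp_minus exp_add ring_distribs field_simps flip: exp_of_nat_mult)
        finally show ?thesis .
      qed
      have summ: "summable (\<lambda>n. exp (real (Suc n) powr \<beta> - y * real (Suc n)))"
        using A0(2)[OF y(1)] by (subst summable_Suc_iff)
      have "norm (V z) = norm (\<Sum>n. u' n * z ^ n)"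
        using V_in[of z] y nz by (simp add: sums_iff)
      also have "\<dots> \<le> (\<Sum>n. exp y * C * exp (real (Suc n) powr \<beta> - y * real (Suc n)))"
        using le summ by (intro norm_suminf_le summable_mult)
      also have "\<dots> = exp y * (C * (\<Sum>n. exp (real (Suc n) powr \<beta> - y * real (Suc n))))"
        using summ by (simp add: suminf_mult mult.assoc)
      also have "\<dots> \<le> exp (2 * pi) * (C * S)"
      proof (intro mult_mono)
        show "(\<Sum>n. exp (real (Suc n) powr \<beta> - y * real (Suc n))) \<le> S"
          using suminf_split_head[OF A0(2)[OF y(1)]] by (simp add: S_def)
        show pos: "0 \<le> (\<Sum>n. exp (real (Suc n) powr \<beta> - y * real (Suc n)))"
          by (intro suminf_nonneg summ) simp
        show "0 \<le> C * (\<Sum>n. exp (real (Suc n) powr \<beta> - y * real (Suc n)))"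
          by (intro mult_nonneg_nonneg C_nonneg pos)
      qed (use y C_nonneg in simp_all)
      finally show ?thesis .
    next
      case False
      have nz: "norm z = exp y" using False by (simp add: z_def norm_unit_exp y_def)
      have le: "norm (u n * inverse z ^ n) \<le> C * exp (real n powr \<beta> - y * real n)" for n
      proof -
        have "norm (u n * inverse z ^ n) \<le> (C * exp (real n powr \<beta>)) * inverse (exp y) ^ n"
          unfolding norm_mult norm_power norm_inverse nz by (intro mult_right_mono u) auto
        also have "\<dots> = C * exp (real n powr \<beta> - y * real n)"
          by (simp add: exp_diff field_simps flip: exp_of_nat_mult exp_minus)
        finally show ?thesis .
      qed
      have "norm (V z) \<le> norm z * norm (V z)" using nz y by (intro mult_le_cancel_right1[THEN iffD2]) auto
      also have "\<dots> = norm (- (z * V z))" by (simp add: norm_mult)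
      also have "\<dots> = norm (\<Sum>n. u n * inverse z ^ n)"
        using V_out[of z] y nz by (simp add: sums_iff)
      also have "\<dots> \<le> (\<Sum>n. C * exp (real n powr \<beta> - y * real n))"
        using le A0(2)[OF y(1)] by (intro norm_suminf_le summable_mult)
      also have "\<dots> = C * S" unfolding S_def by (rule suminf_mult[OF A0(2)[OF y(1)]])
      also have "\<dots> \<le> exp (2 * pi) * (C * S)"
        using mult_right_mono[of 1 "exp (2 * pi)" "C * S"] C_nonneg S0 by simp
      finally show ?thesis .
    qed
    have "S \<le> A0 * exp (2 * (2 / y) powr \<alpha>)" unfolding S_def by (rule A0(3)[OF y(1)])
    also have "(2 / y) powr \<alpha> \<le> \<bar>Im v\<bar> powr (- \<alpha>)"
    proof -
      have "2 / y = 1 / (pi * \<bar>Im v\<bar>)" by (simp add: y_def)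
      also have "\<dots> \<le> 1 / \<bar>Im v\<bar>"
        using v pi_gt3 by (intro divide_left_mono) (auto intro!: mult_pos_pos)
      finally have "(2 / y) powr \<alpha> \<le> (1 / \<bar>Im v\<bar>) powr \<alpha>" using y \<alpha> by (intro powr_mono2) auto
      then show ?thesis by (simp add: powr_divide powr_minus_divide)
    qed
    finally have "S \<le> A0 * exp (2 * \<bar>Im v\<bar> powr (- \<alpha>))" using A0(1) by simp
    then have "C * S \<le> (C + 1) * (A0 * exp (2 * \<bar>Im v\<bar> powr (- \<alpha>)))"
      using C_nonneg S0 by (intro mult_mono) auto
    then have "exp (2 * pi) * (C * S) \<le> A * exp (2 * \<bar>Im v\<bar> powr (- \<alpha>))"
      unfolding A_def mult.assoc by (intro mult_left_mono) auto
    with VS show ?thesis by (simp add: z_def)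
  qed
  moreover have "A > 0" using A0(1) C_nonneg by (simp add: A_def)
  ultimately show ?thesis using that by blast
qed

text \<open>The integrand of the Cauchy integral of g(r z) V(z) dz in the coordinate z =
  \<open>unit_exp v\<close>; the last factor comes from dz, with the constant 2 pi i left
  out.\<close>

definition h :: "real \<Rightarrow> complex \<Rightarrow> complex" where
  "h r v = g (of_real r * unit_exp v) * V (unit_exp v) * unit_exp v"

lemma h_periodic: "h r (v + 1) = h r v"
  using unit_exp_of_int[of 1] by (simp add: h_def unit_exp_add)

lemma norm_g_le: "norm z < 1 \<Longrightarrow> norm (g z) \<le> (\<Sum>l. norm (G l))"
proof -
  assume z: "norm z < 1"
  have "norm (\<Sum>l. G l * z ^ l) \<le> (\<Sum>l. norm (G l))"
  proof (rule norm_suminf_le[OF _ G(1)])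
    show "norm (G l * z ^ l) \<le> norm (G l)" for l
      using z power_le_one[of "norm z" l] by (simp add: norm_mult norm_power mult_left_le)
  qed
  then show ?thesis using g(2)[OF z] by (simp add: sums_iff)
qed

text \<open>In the strip |Im v| \<le> \<delta> the modulus of \<open>unit_exp v\<close> is at most
  exp(2 pi \<delta>), so the factor exp(- 4 pi \<delta>) brings the whole strip into the disc with
  room to spare.\<close>

lemma norm_scaled_unit_exp:
  assumes "\<bar>Im v\<bar> \<le> \<delta>" "0 < \<delta>"
  shows "norm (of_real (exp (- 4 * pi * \<delta>)) * unit_exp v) < 1"
proof -
  have "- (4 * pi * \<delta>) - 2 * pi * Im v < 0"
  proof -
    have "0 < 2 * pi * (2 * \<delta> + Im v)" using assms by (intro mult_pos_pos) auto
    then show ?thesis by (simp add: algebra_simps)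
  qed
  then show ?thesis by (simp add: norm_mult norm_unit_exp flip: exp_add)
qed

lemma holomorphic_g_scaled:
  assumes "0 < \<delta>"
  shows "(\<lambda>v. g (of_real (exp (- 4 * pi * \<delta>)) * unit_exp v)) holomorphic_on {v. \<bar>Im v\<bar> \<le> \<delta>}"
proof -
  have "(g \<circ> (\<lambda>v. of_real (exp (- 4 * pi * \<delta>)) * unit_exp v)) holomorphic_on {v. \<bar>Im v\<bar> \<le> \<delta>}"
  proof (rule holomorphic_on_compose_gen[OF _ g(1)])
    show "(\<lambda>v. of_real (exp (- 4 * pi * \<delta>)) * unit_exp v) holomorphic_on {v. \<bar>Im v\<bar> \<le> \<delta>}"
      by (intro holomorphic_intros holomorphic_on_unit_exp)
  qed (use norm_scaled_unit_exp[OF _ assms] in auto)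
  then show ?thesis by (simp add: o_def)
qed

text \<open>Below the real line \<open>unit_exp\<close> is outside the disc, where \<open>V\<close>
  has a series in negative powers; integrating it against the series of \<open>g\<close> pairs
  \<open>u\<close> with \<open>G\<close>.\<close>

lemma lower_integral:
  assumes \<delta>: "0 < \<delta>" and p: "Im p = - \<delta>"
  shows "(\<lambda>n. - (u n * G n * of_real (exp (- 4 * pi * \<delta>)) ^ n)) sums
    contour_integral (linepath p (p + 1)) (h (exp (- 4 * pi * \<delta>)))"
proof -
  define r where "r = exp (- 4 * pi * \<delta>)"
  define B where "B = (\<Sum>l. norm (G l))"
  define F where "F n v = - u n * (unit_exp (of_int (- int n) * v) * g (of_real r * unit_exp v))" for n v
  have seg: "Im v = - \<delta>" if "v \<in> closed_segment p (p + 1)" for v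
    using Im_closed_segment_horizontal[OF that] p by simp
  have small: "norm (of_real r * unit_exp v) < 1" if "v \<in> closed_segment p (p + 1)" for v
    unfolding r_def using seg[OF that] \<delta> by (intro norm_scaled_unit_exp) auto
  have cont: "continuous_on (closed_segment p (p + 1)) (\<lambda>v. g (of_real r * unit_exp v))"
    unfolding r_def using seg \<delta>
    by (intro continuous_on_subset[OF holomorphic_on_imp_continuous_on[OF holomorphic_g_scaled[OF \<delta>]]]) auto
  have A0: "summable (\<lambda>n. exp (real n powr \<beta> - y * real n))" if "y > 0" for y
    using summable_exp_powr[of \<beta> y] \<beta> that by simp
  have "(\<lambda>n. contour_integral (linepath p (p + 1)) (F n)) sums
      contour_integral (linepath p (p + 1)) (\<lambda>v. \<Sum>n. F n v)"
  proof (rule contour_integral_suminf_linepath)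
    show "continuous_on (closed_segment p (p + 1)) (F n)" for n
      unfolding F_def[abs_def] by (intro continuous_on_mult continuous_on_const continuous_on_unit_exp cont continuous_on_id)
    show "norm (F n v) \<le> C * B * exp (real n powr \<beta> - 2 * pi * \<delta> * real n)"
      if v: "v \<in> closed_segment p (p + 1)" for n v
    proof -
      have "norm (F n v) = norm (u n) * exp (- (2 * pi * \<delta> * real n)) * norm (g (of_real r * unit_exp v))"
        unfolding F_def norm_mult norm_unit_exp using seg[OF v] by simp
      also have "\<dots> \<le> (C * exp (real n powr \<beta>)) * exp (- (2 * pi * \<delta> * real n)) * B"
        unfolding B_def using C_nonneg by (intro mult_mono u norm_g_le small v) auto
      also have "\<dots> = C * B * exp (real n powr \<beta> - 2 * pi * \<delta> * real n)"
        by (simp add: exp_diff exp_minus field_simps)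
      finally show ?thesis .
    qed
    show "summable (\<lambda>n. C * B * exp (real n powr \<beta> - 2 * pi * \<delta> * real n))"
      using \<delta> by (intro summable_mult A0) auto
  qed
  moreover have "contour_integral (linepath p (p + 1)) (\<lambda>v. \<Sum>n. F n v) =
      contour_integral (linepath p (p + 1)) (h r)"
  proof (rule contour_integral_eq)
    fix v assume "v \<in> path_image (linepath p (p + 1))"
    then have v: "v \<in> closed_segment p (p + 1)" by simp
    have "(\<lambda>n. u n * inverse (unit_exp v) ^ n) sums (- (unit_exp v * V (unit_exp v)))"
      using seg[OF v] \<delta> by (intro V_out) (simp add: norm_unit_exp)
    then have "(\<lambda>n. (u n * inverse (unit_exp v) ^ n) * (- g (of_real r * unit_exp v))) sums
        ((- (unit_exp v * V (unit_exp v))) * (- g (of_real r * unit_exp v)))"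
      by (rule sums_mult2)
    moreover have "(u n * inverse (unit_exp v) ^ n) * (- g (of_real r * unit_exp v)) = F n v" for n
      using unit_exp_power[of "- v" n] by (simp add: F_def unit_exp_minus)
    ultimately show "(\<Sum>n. F n v) = h r v" by (simp add: sums_iff h_def mult_ac)
  qed
  moreover have "contour_integral (linepath p (p + 1)) (F n) = - (u n * G n * of_real r ^ n)" for n
  proof -
    have "contour_integral (linepath p (p + 1)) (F n) = - u n *
        contour_integral (linepath p (p + 1)) (\<lambda>v. unit_exp (of_int (- int n) * v) * g (of_real r * unit_exp v))"
      unfolding F_def[abs_def]
      by (intro contour_integral_lmul contour_integrable_continuous_linepath continuous_on_mult
          continuous_on_const continuous_on_unit_exp cont continuous_on_id)
    also have "\<dots> = - u n * (G n * of_real r ^ n)"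
    proof -
      have "r * exp (- 2 * pi * Im p) < 1"
        using p \<delta> by (simp add: r_def flip: exp_add)
      then show ?thesis
        by (subst contour_integral_unit_exp_power_series[OF g(2) G(1)]) (auto simp: r_def)
    qed
    finally show ?thesis by simp
  qed
  ultimately show ?thesis by (simp add: r_def)
qed

text \<open>Above the real line both series are in nonnegative powers, and the factor from dz
  removes the constant term, so every term integrates to 0.\<close>

lemma upper_integral:
  assumes \<delta>: "0 < \<delta>" and p: "Im p = \<delta>"
  shows "contour_integral (linepath p (p + 1)) (h (exp (- 4 * pi * \<delta>))) = 0"
proof -
  define r where "r = exp (- 4 * pi * \<delta>)"
  define B where "B = (\<Sum>l. norm (G l))"
  define F where "F n v = u' n * (unit_exp (of_int (int (Suc n)) * v) * g (of_real r * unit_exp v))" for n v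
  have seg: "Im v = \<delta>" if "v \<in> closed_segment p (p + 1)" for v
    using Im_closed_segment_horizontal[OF that] p by simp
  have small: "norm (of_real r * unit_exp v) < 1" if "v \<in> closed_segment p (p + 1)" for v
    unfolding r_def using seg[OF that] \<delta> by (intro norm_scaled_unit_exp) auto
  have cont: "continuous_on (closed_segment p (p + 1)) (\<lambda>v. g (of_real r * unit_exp v))"
    unfolding r_def using seg \<delta>
    by (intro continuous_on_subset[OF holomorphic_on_imp_continuous_on[OF holomorphic_g_scaled[OF \<delta>]]]) auto
  have A0: "summable (\<lambda>n. exp (real n powr \<beta> - y * real n))" if "y > 0" for y
    using summable_exp_powr[of \<beta> y] \<beta> that by simp
  have "(\<lambda>n. contour_integral (linepath p (p + 1)) (F n)) sums
      contour_integral (linepath p (p + 1)) (\<lambda>v. \<Sum>n. F n v)"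
  proof (rule contour_integral_suminf_linepath)
    show "continuous_on (closed_segment p (p + 1)) (F n)" for n
      unfolding F_def[abs_def] by (intro continuous_on_mult continuous_on_const continuous_on_unit_exp cont continuous_on_id)
    show "norm (F n v) \<le> C * B * exp (real (Suc n) powr \<beta> - 2 * pi * \<delta> * real (Suc n))"
      if v: "v \<in> closed_segment p (p + 1)" for n v
    proof -
      have "norm (F n v) = norm (u' n) * exp (- (2 * pi * \<delta> * real (Suc n))) * norm (g (of_real r * unit_exp v))"
        unfolding F_def norm_mult norm_unit_exp using seg[OF v] by (simp add: algebra_simps)
      also have "\<dots> \<le> (C * exp (real (Suc n) powr \<beta>)) * exp (- (2 * pi * \<delta> * real (Suc n))) * B"
        unfolding B_def using C_nonneg by (intro mult_mono u' norm_g_le small v) auto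
      also have "\<dots> = C * B * exp (real (Suc n) powr \<beta> - 2 * pi * \<delta> * real (Suc n))"
        unfolding exp_diff exp_minus by (simp add: field_simps del: of_nat_Suc)
      finally show ?thesis .
    qed
    show "summable (\<lambda>n. C * B * exp (real (Suc n) powr \<beta> - 2 * pi * \<delta> * real (Suc n)))"
      using A0[of "2 * pi * \<delta>"] \<delta> by (intro summable_mult) (subst summable_Suc_iff, auto)
  qed
  moreover have "contour_integral (linepath p (p + 1)) (\<lambda>v. \<Sum>n. F n v) =
      contour_integral (linepath p (p + 1)) (h r)"
  proof (rule contour_integral_eq)
    fix v assume "v \<in> path_image (linepath p (p + 1))"
    then have v: "v \<in> closed_segment p (p + 1)" by simp
    have "(\<lambda>n. u' n * unit_exp v ^ n) sums V (unit_exp v)"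
      using seg[OF v] \<delta> by (intro V_in) (simp add: norm_unit_exp)
    then have "(\<lambda>n. (u' n * unit_exp v ^ n) * (unit_exp v * g (of_real r * unit_exp v))) sums
        (V (unit_exp v) * (unit_exp v * g (of_real r * unit_exp v)))"
      by (rule sums_mult2)
    moreover have "(u' n * unit_exp v ^ n) * (unit_exp v * g (of_real r * unit_exp v)) = F n v" for n
    proof -
      have "unit_exp v ^ n * unit_exp v = unit_exp (of_int (int (Suc n)) * v)"
        using unit_exp_power[of v "Suc n"] by (simp add: mult.commute)
      then show ?thesis unfolding F_def by (metis mult.assoc)
    qed
    ultimately show "(\<Sum>n. F n v) = h r v" by (simp add: sums_iff h_def mult_ac)
  qed
  moreover have "contour_integral (linepath p (p + 1)) (F n) = 0" for n
  proof -
    have "contour_integral (linepath p (p + 1)) (F n) = u' n *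
        contour_integral (linepath p (p + 1)) (\<lambda>v. unit_exp (of_int (int (Suc n)) * v) * g (of_real r * unit_exp v))"
      unfolding F_def[abs_def]
      by (intro contour_integral_lmul contour_integrable_continuous_linepath continuous_on_mult
          continuous_on_const continuous_on_unit_exp cont continuous_on_id)
    also have "\<dots> = 0"
    proof -
      have "r * exp (- 2 * pi * Im p) < 1"
        using p \<delta> by (simp add: r_def flip: exp_add)
      then show ?thesis
        by (subst contour_integral_unit_exp_power_series[OF g(2) G(1)]) (auto simp: r_def)
    qed
    finally show ?thesis .
  qed
  ultimately show ?thesis by (simp add: r_def sums_iff)
qed

lemma h_holomorphic:
  assumes "0 < \<delta>" and "\<And>v. v \<in> S \<Longrightarrow> \<bar>Im v\<bar> \<le> \<delta>" and "\<And>v. v \<in> S \<Longrightarrow> unit_exp v \<notin> K"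
  shows "h (exp (- 4 * pi * \<delta>)) holomorphic_on S"
proof -
  have "(V \<circ> unit_exp) holomorphic_on S"
    by (rule holomorphic_on_compose_gen[OF holomorphic_on_unit_exp V]) (use assms(3) in auto)
  moreover have "(\<lambda>v. g (of_real (exp (- 4 * pi * \<delta>)) * unit_exp v)) holomorphic_on S"
    by (rule holomorphic_on_subset[OF holomorphic_g_scaled[OF assms(1)]]) (use assms(2) in auto)
  ultimately show ?thesis
    unfolding h_def[abs_def] by (intro holomorphic_on_mult holomorphic_on_unit_exp) (simp_all add: o_def)
qed

text \<open>The cells are centred at the points \<open>j / q\<^sup>k\<close>, many of which belong to \<open>E\<close>; their vertical sides then
  pass through the middle gaps of the pieces of level \<open>k\<close>.\<close>

definition grid :: "nat \<Rightarrow> nat \<Rightarrow> real" where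
  "grid k j = (real j - 1 / 2) / real q ^ k"

text \<open>One twenty-fourth of the cell width, so that discs of radius 2 \<open>height k\<close>
  about grid points stay well inside gaps of half-width at least a sixth of that width.\<close>

definition height :: "nat \<Rightarrow> real" where
  "height k = 1 / (24 * real q ^ k)"

lemma height_pos: "height k > 0"
  using q by (simp add: height_def)

lemma height_le: "height k \<le> 1 / 24"
  using q one_le_power[of "real q" k] by (simp add: height_def field_simps)

lemma grid_Suc: "grid k (Suc j) - grid k j = 24 * height k"
  using q by (simp add: grid_def height_def field_simps)

lemma grid_period: "grid k (q ^ k) = grid k 0 + 1"
  using q by (simp add: grid_def field_simps)

lemma grid_mono: "i \<le> j \<Longrightarrow> grid k i \<le> grid k j"
  by (simp add: grid_def divide_right_mono)

lemma near_grid_notin_E: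
  assumes v: "v \<in> cball (of_real (grid k j)) (2 * height k)"
  shows "unit_exp v \<notin> E"
proof
  assume "unit_exp v \<in> E"
  then obtain t where t: "t \<in> cantor_arguments q" "unit_exp v = unit_exp (of_real t)"
    by (auto simp: perfect_symmetric_set_eq)
  then obtain n where n: "v = of_real t + of_int n" by (auto simp: unit_exp_eq_iff)
  \<comment> \<open>j - 1/2 is written as (j - 1) + 1/2 over the integers, since j = 0
    occurs.\<close>
  have "1 / (6 * real q ^ k) \<le> \<bar>(of_int (int j - 1) + 1 / 2) / real q ^ k - (t + of_int n)\<bar>"
    by (rule cantor_arguments_midpoint_dist[OF q t(1)])
  also have "\<dots> = dist (complex_of_real (grid k j)) v"
  proof -
    have "complex_of_real (grid k j) - v = of_real (grid k j - (t + of_int n))" by (simp add: n)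
    then have "dist (complex_of_real (grid k j)) v = \<bar>grid k j - (t + of_int n)\<bar>"
      unfolding dist_norm by (simp only: norm_of_real)
    then show ?thesis by (simp add: grid_def)
  qed
  also have "\<dots> \<le> 2 * height k" using v by simp
  also have "\<dots> < 1 / (6 * real q ^ k)" using q by (simp add: height_def field_simps)
  finally show False by simp
qed

text \<open>The factor 8 / cos of \<open>holomorphic_bound_across_line\<close> times the constant 2
  in the exponent of \<open>V_bound\<close>.\<close>

definition "B = 16 / cos (\<alpha> * (pi / 2))"

text \<open>On horizontal sides this is \<open>V_bound\<close>. A vertical side crosses the circle,
  where that bound blows up, but it lies in the half-radius disc about a grid point in a gap, where
  the crossing lemma applies.\<close>

lemma V_boundary_bound:
  obtains A where "A > 0" "\<And>k j v. \<bar>Im v\<bar> = height k \<or> (Re v = grid k j \<and> \<bar>Im v\<bar> \<le> height k) \<Longrightarrow>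
    norm (V (unit_exp v)) \<le> A * exp (B * height k powr (- \<alpha>))"
proof -
  obtain A where A: "A > 0" "\<And>v. Im v \<noteq> 0 \<Longrightarrow> \<bar>Im v\<bar> \<le> 1 \<Longrightarrow>
    norm (V (unit_exp v)) \<le> A * exp (2 * \<bar>Im v\<bar> powr (- \<alpha>))"
    using V_bound by blast
  have cos: "0 < cos (\<alpha> * (pi / 2))" using \<alpha> by (intro cos_gt_zero) (auto simp: field_simps)
  have B2: "2 \<le> B"
  proof -
    have "16 * 1 \<le> B" unfolding B_def using cos by (simp add: field_simps)
    then show ?thesis by simp
  qed
  have "norm (V (unit_exp v)) \<le> A * exp (B * height k powr (- \<alpha>))"
    if v: "\<bar>Im v\<bar> = height k \<or> (Re v = grid k j \<and> \<bar>Im v\<bar> \<le> height k)" for k j v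
    using v
  proof
    assume Im: "\<bar>Im v\<bar> = height k"
    then have "norm (V (unit_exp v)) \<le> A * exp (2 * \<bar>Im v\<bar> powr (- \<alpha>))"
      using height_pos[of k] height_le[of k] by (intro A(2)) auto
    also have "\<dots> \<le> A * exp (B * height k powr (- \<alpha>))"
      unfolding Im using A(1) B2 by (intro mult_left_mono) (auto intro: mult_right_mono)
    finally show ?thesis .
  next
    assume v: "Re v = grid k j \<and> \<bar>Im v\<bar> \<le> height k"
    have "norm ((V \<circ> unit_exp) v) \<le> A * exp (8 / cos (\<alpha> * (pi / 2)) * 2 * ((2 * height k) / 2) powr (- \<alpha>))"
    proof (rule holomorphic_bound_across_line[where H = "V \<circ> unit_exp" and ?v0.0 = v and x = "grid k j" and \<rho> = "2 * height k"])
      show "(V \<circ> unit_exp) holomorphic_on cball (of_real (grid k j)) (2 * height k)"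
        by (rule holomorphic_on_compose_gen[OF holomorphic_on_unit_exp V])
           (use near_grid_notin_E K(2) in fastforce)
      show "norm ((V \<circ> unit_exp) w) \<le> A * exp (2 * \<bar>Im w\<bar> powr (- \<alpha>))"
        if w: "w \<in> cball (of_real (grid k j)) (2 * height k)" "Im w \<noteq> 0" for w
      proof -
        have "\<bar>Im w\<bar> \<le> norm (of_real (grid k j) - w)"
          using abs_Im_le_cmod[of "of_real (grid k j) - w"] by simp
        also have "\<dots> \<le> 1" using w(1) height_le[of k] by (simp add: dist_norm)
        finally show ?thesis using A(2)[OF w(2)] by simp
      qed
      have "v - of_real (grid k j) = \<i> * of_real (Im v)" using v by (simp add: complex_eq_iff)
      then have "norm (v - of_real (grid k j)) = \<bar>Im v\<bar>" by (simp add: norm_mult)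
      then show "norm (v - of_real (grid k j)) \<le> 2 * height k / 2" using v by simp
    qed (use height_pos[of k] \<alpha> in auto)
    then show ?thesis by (simp add: B_def)
  qed
  with A(1) show ?thesis using that by blast
qed

text \<open>The dilation is the shift of \<open>v\<close> by 2 i \<open>height k\<close>, so
  \<open>w\<close> has imaginary part between 1 and 3 heights. Its distance from \<open>t\<close> is
  at most 24 + 3 = 27 heights, and 216 = 8 * 27 with 8 in place of 2 pi.\<close>

lemma g_near_E_bound:
  assumes t: "unit_exp (of_real t) \<in> E" "grid k j \<le> t" "t \<le> grid k (Suc j)"
    and v: "grid k j \<le> Re v" "Re v \<le> grid k (Suc j)" "\<bar>Im v\<bar> \<le> height k"
  shows "norm (g (of_real (exp (- 4 * pi * height k)) * unit_exp v)) \<le> exp (- (c * (216 * height k) powr (- a)))"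
proof -
  let ?z = "of_real (exp (- 4 * pi * height k)) * unit_exp v"
  define w where "w = v + 2 * \<i> * of_real (height k)"
  have z: "?z = unit_exp w"
    by (simp add: unit_exp_def w_def algebra_simps exp_of_real[symmetric] flip: exp_add)
  have zb: "?z \<in> ball 0 1"
    using norm_scaled_unit_exp[OF v(3) height_pos] by simp
  have "norm (g ?z) \<le> exp (- (c * infdist ?z E powr (- a)))" by (rule flat[OF zb])
  also have "\<dots> \<le> exp (- (c * (216 * height k) powr (- a)))"
  proof -
    have "infdist ?z E \<le> dist ?z (unit_exp (of_real t))" by (rule infdist_le[OF t(1)])
    also have "\<dots> \<le> 2 * pi * norm (w - of_real t)"
      unfolding z dist_norm using v(3) height_pos[of k] by (intro norm_unit_exp_diff_le) (auto simp: w_def)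
    also have "\<dots> \<le> 8 * (27 * height k)"
    proof (rule mult_mono)
      have "norm (w - of_real t) \<le> \<bar>Re (w - of_real t)\<bar> + \<bar>Im (w - of_real t)\<bar>" by (rule cmod_le)
      also have "\<dots> \<le> 24 * height k + 3 * height k"
        using t v grid_Suc[of k j] by (intro add_mono) (auto simp: w_def)
      finally show "norm (w - of_real t) \<le> 27 * height k" by simp
    qed (use pi_less_4 in auto)
    finally have "infdist ?z E \<le> 216 * height k" by simp
    moreover have "infdist ?z E > 0" by (rule infdist_perfect_symmetric_set[OF zb])
    moreover have "a > 0" using a \<alpha> by (simp add: \<alpha>_def)
    ultimately have "(216 * height k) powr (- a) \<le> infdist ?z E powr (- a)"
      by (intro powr_mono2') auto
    then show ?thesis using c by simp
  qed
  finally show ?thesis .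
qed

section \<open>Integrals over the cells and their sum\<close>

definition low :: "nat \<Rightarrow> nat \<Rightarrow> complex" where "low k j = Complex (grid k j) (- height k)"
definition high :: "nat \<Rightarrow> nat \<Rightarrow> complex" where "high k j = Complex (grid k j) (height k)"

text \<open>If no point of \<open>E\<close> has an argument in the cell, Cauchy's theorem gives 0.
  Otherwise each of the four sides has length at most q^-k, and the integrand on it is small by
  flatness.\<close>

lemma cell_integral_bound:
  obtains A where "A > 0" "\<And>k j. norm (
      contour_integral (linepath (low k j) (low k (Suc j))) (h (exp (- 4 * pi * height k))) +
      contour_integral (linepath (low k (Suc j)) (high k (Suc j))) (h (exp (- 4 * pi * height k))) +
      contour_integral (linepath (high k (Suc j)) (high k j)) (h (exp (- 4 * pi * height k))) +
      contour_integral (linepath (high k j) (low k j)) (h (exp (- 4 * pi * height k))))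
    \<le> A * exp (B * height k powr (- \<alpha>) - c * (216 * height k) powr (- a)) / real q ^ k"
proof -
  obtain A where A: "A > 0" "\<And>k j v. \<bar>Im v\<bar> = height k \<or> (Re v = grid k j \<and> \<bar>Im v\<bar> \<le> height k) \<Longrightarrow>
    norm (V (unit_exp v)) \<le> A * exp (B * height k powr (- \<alpha>))"
    using V_boundary_bound by blast
  have "norm (
      contour_integral (linepath (low k j) (low k (Suc j))) (h (exp (- 4 * pi * height k))) +
      contour_integral (linepath (low k (Suc j)) (high k (Suc j))) (h (exp (- 4 * pi * height k))) +
      contour_integral (linepath (high k (Suc j)) (high k j)) (h (exp (- 4 * pi * height k))) +
      contour_integral (linepath (high k j) (low k j)) (h (exp (- 4 * pi * height k))))
    \<le> (4 * exp (2 * pi) * A) * exp (B * height k powr (- \<alpha>) - c * (216 * height k) powr (- a)) / real q ^ k" for k j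
  proof -
    define \<delta> where "\<delta> = height k"
    define H where "H = h (exp (- 4 * pi * \<delta>))"
    have \<delta>: "\<delta> > 0" by (simp add: \<delta>_def height_pos)
    define R where "R = cbox (low k j) (high k (Suc j))"
    have R: "v \<in> R \<longleftrightarrow> grid k j \<le> Re v \<and> Re v \<le> grid k (Suc j) \<and> \<bar>Im v\<bar> \<le> \<delta>" for v
      by (auto simp: R_def in_cbox_complex_iff low_def high_def \<delta>_def)
    have grid_le: "grid k j \<le> grid k (Suc j)" by (rule grid_mono) simp
    have corners: "low k j \<in> R" "low k (Suc j) \<in> R" "high k j \<in> R" "high k (Suc j) \<in> R"
      using grid_le \<delta> by (simp_all add: R low_def high_def \<delta>_def)
    define M where "M = exp (2 * pi) * A * exp (B * \<delta> powr (- \<alpha>) - c * (216 * \<delta>) powr (- a))"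
    have M: "M > 0" using A(1) by (simp add: M_def)
    let ?I = "\<lambda>x y. contour_integral (linepath x y) H"
    have "norm (?I (low k j) (low k (Suc j)) + ?I (low k (Suc j)) (high k (Suc j)) +
        ?I (high k (Suc j)) (high k j) + ?I (high k j) (low k j)) \<le> 4 * M / real q ^ k"
    proof (cases "\<exists>t. unit_exp (of_real t) \<in> E \<and> grid k j \<le> t \<and> t \<le> grid k (Suc j)")
      case False
      have "unit_exp v \<notin> K" if "v \<in> R" for v
      proof (cases "Im v = 0")
        case True
        then have "v = of_real (Re v)" by (simp add: complex_eq_iff)
        then show ?thesis using False K(2) that R by (metis subsetD)
      qed (rule unit_exp_notin_K)
      then have "H holomorphic_on R"
        unfolding H_def using \<delta> R by (intro h_holomorphic) auto
      then have "?I (low k j) (low k (Suc j)) + ?I (low k (Suc j)) (high k (Suc j)) +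
        ?I (high k (Suc j)) (high k j) + ?I (high k j) (low k j) = 0"
        using corners by (intro contour_integral_rectangle_zero[where S = R]) (auto simp: R_def convex_box)
      then show ?thesis using M q by simp
    next
      case True
      then obtain t where t: "unit_exp (of_real t) \<in> E" "grid k j \<le> t" "t \<le> grid k (Suc j)" by blast
      \<comment> \<open>The boundary of the cell. Its intersections with the real line are grid
        points, so it avoids \<open>K\<close> even if the cell does not.\<close>
      define D where "D = {v \<in> R. \<bar>Im v\<bar> = \<delta> \<or> (\<exists>i. Re v = grid k i)}"
      have HM: "norm (H v) \<le> M" if v: "v \<in> D" for v
      proof -
        have vR: "grid k j \<le> Re v" "Re v \<le> grid k (Suc j)" "\<bar>Im v\<bar> \<le> \<delta>" using v by (auto simp: D_def R)
        have "norm (H v) \<le> exp (- (c * (216 * \<delta>) powr (- a))) * (A * exp (B * \<delta> powr (- \<alpha>))) * exp (2 * pi)"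
          unfolding H_def h_def norm_mult
        proof (intro mult_mono)
          show "norm (g (of_real (exp (- 4 * pi * \<delta>)) * unit_exp v)) \<le> exp (- (c * (216 * \<delta>) powr (- a)))"
            unfolding \<delta>_def by (rule g_near_E_bound[OF t]) (use vR in \<open>auto simp: \<delta>_def\<close>)
          show "norm (V (unit_exp v)) \<le> A * exp (B * \<delta> powr (- \<alpha>))"
          proof -
            obtain i where "\<bar>Im v\<bar> = height k \<or> (Re v = grid k i \<and> \<bar>Im v\<bar> \<le> height k)"
              using v by (auto simp: D_def R \<delta>_def)
            then show ?thesis unfolding \<delta>_def by (rule A(2))
          qed
          have "- Im v \<le> 1" using vR(3) height_le[of k] unfolding \<delta>_def by linarith
          then have "2 * pi * (- Im v) \<le> 2 * pi * 1" by (intro mult_left_mono) auto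
          then show "norm (unit_exp v) \<le> exp (2 * pi)" by (simp add: norm_unit_exp)
        qed (use A(1) in auto)
        also have "\<dots> = M" by (simp add: M_def exp_diff exp_minus field_simps)
        finally show ?thesis .
      qed
      have bound: "norm (?I x y) \<le> M / real q ^ k"
        if seg: "closed_segment x y \<subseteq> D" and len: "norm (y - x) \<le> 1 / real q ^ k" for x y
      proof -
        have notin: "unit_exp v \<notin> K" if vD: "v \<in> D" for v
        proof (cases "Im v = 0")
          case True
          then obtain i where "Re v = grid k i" using vD \<delta> by (auto simp: D_def)
          then have "v = of_real (grid k i)" using True by (simp add: complex_eq_iff)
          then show ?thesis using near_grid_notin_E[of v k i] K(2) height_pos[of k] by auto
        qed (rule unit_exp_notin_K)
        have "H holomorphic_on D"
          unfolding H_def using \<delta> notin by (intro h_holomorphic) (auto simp: D_def R)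
        then have "H contour_integrable_on linepath x y"
          using seg by (intro contour_integrable_continuous_linepath)
            (auto intro: continuous_on_subset holomorphic_on_imp_continuous_on)
        then have "norm (?I x y) \<le> M * norm (y - x)"
          using M HM seg by (intro contour_integral_bound_linepath) auto
        also have "\<dots> \<le> M * (1 / real q ^ k)" using M len by (intro mult_left_mono) auto
        finally show ?thesis by simp
      qed
      have w: "24 * \<delta> = 1 / real q ^ k" by (simp add: \<delta>_def height_def)
      have d1: "low k (Suc j) - low k j = of_real (24 * \<delta>)" "high k j - high k (Suc j) = - of_real (24 * \<delta>)"
        "high k (Suc j) - low k (Suc j) = \<i> * of_real (2 * \<delta>)" "low k j - high k j = - (\<i> * of_real (2 * \<delta>))"
        using grid_Suc[of k j] by (auto simp: low_def high_def complex_eq_iff \<delta>_def)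
      have hor: "closed_segment (low k j) (low k (Suc j)) \<subseteq> D" "closed_segment (high k (Suc j)) (high k j) \<subseteq> D"
        using grid_le \<delta> unfolding low_def high_def
        by (auto simp: closed_segment_same_Im closed_segment_eq_real_ivl D_def R \<delta>_def)
      have ver: "closed_segment (low k (Suc j)) (high k (Suc j)) \<subseteq> D" "closed_segment (high k j) (low k j) \<subseteq> D"
        using grid_le \<delta> unfolding low_def high_def
        by (auto simp: closed_segment_same_Re closed_segment_eq_real_ivl D_def R \<delta>_def)
      have n: "norm (complex_of_real (24 * \<delta>)) = 24 * \<delta>" "norm (\<i> * complex_of_real (2 * \<delta>)) = 2 * \<delta>"
        using \<delta> unfolding norm_mult norm_of_real by auto
      have "norm (?I (low k j) (low k (Suc j))) \<le> M / real q ^ k"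
        "norm (?I (low k (Suc j)) (high k (Suc j))) \<le> M / real q ^ k"
        "norm (?I (high k (Suc j)) (high k j)) \<le> M / real q ^ k"
        "norm (?I (high k j) (low k j)) \<le> M / real q ^ k"
        using \<delta> by (intro bound hor ver; simp only: d1 norm_minus_cancel n w[symmetric]; simp)+
      then have "norm (?I (low k j) (low k (Suc j)) + ?I (low k (Suc j)) (high k (Suc j)) +
        ?I (high k (Suc j)) (high k j) + ?I (high k j) (low k j)) \<le>
        M / real q ^ k + M / real q ^ k + M / real q ^ k + M / real q ^ k"
        by (intro norm_triangle_mono)
      then show ?thesis by simp
    qed
    then show ?thesis by (simp add: H_def M_def \<delta>_def mult_ac)
  qed
  moreover have "4 * exp (2 * pi) * A > 0" using A(1) by simp
  ultimately show ?thesis using that by blast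
qed

text \<open>In the sum over the cells the inner vertical sides cancel, the two outer ones cancel by
  periodicity, and the upper sides add up to 0. The lower sides give the pairing, and the number q^k
  of cells cancels the q^-k of each bound.\<close>

lemma partial_pairing_bound:
  obtains A where "A > 0" "\<And>k. norm (\<Sum>n. u n * G n * of_real (exp (- 4 * pi * height k)) ^ n)
    \<le> A * exp (B * height k powr (- \<alpha>) - c * (216 * height k) powr (- a))"
proof -
  obtain A where A: "A > 0" "\<And>k j. norm (
      contour_integral (linepath (low k j) (low k (Suc j))) (h (exp (- 4 * pi * height k))) +
      contour_integral (linepath (low k (Suc j)) (high k (Suc j))) (h (exp (- 4 * pi * height k))) +
      contour_integral (linepath (high k (Suc j)) (high k j)) (h (exp (- 4 * pi * height k))) +
      contour_integral (linepath (high k j) (low k j)) (h (exp (- 4 * pi * height k))))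
    \<le> A * exp (B * height k powr (- \<alpha>) - c * (216 * height k) powr (- a)) / real q ^ k"
    using cell_integral_bound by blast
  have "norm (\<Sum>n. u n * G n * of_real (exp (- 4 * pi * height k)) ^ n)
    \<le> A * exp (B * height k powr (- \<alpha>) - c * (216 * height k) powr (- a))" for k
  proof -
    define \<delta> where "\<delta> = height k"
    define H where "H = h (exp (- 4 * pi * \<delta>))"
    have \<delta>: "\<delta> > 0" by (simp add: \<delta>_def height_pos)
    let ?I = "\<lambda>x y. contour_integral (linepath x y) H"
    define N where "N = q ^ k"
    have contH: "continuous_on {v. Im v = y} H" if "\<bar>y\<bar> = \<delta>" for y
      unfolding H_def using that \<delta>
      by (intro holomorphic_on_imp_continuous_on h_holomorphic unit_exp_notin_K) auto
    have rev: "?I (high k (Suc j)) (high k j) = - ?I (high k j) (high k (Suc j))" for j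
      by (intro contour_integral_reverse_linepath continuous_on_subset[OF contH[of \<delta>]])
         (use \<delta> in \<open>auto simp: high_def closed_segment_same_Im \<delta>_def\<close>)
    have rev': "?I (high k j) (low k j) = - ?I (low k j) (high k j)" for j
    proof (intro contour_integral_reverse_linepath continuous_on_subset[OF holomorphic_on_imp_continuous_on])
      show "H holomorphic_on {v. Re v = grid k j \<and> \<bar>Im v\<bar> \<le> \<delta>}"
        unfolding H_def
      proof (intro h_holomorphic[OF \<delta>])
        fix v assume v: "v \<in> {v. Re v = grid k j \<and> \<bar>Im v\<bar> \<le> \<delta>}"
        show "unit_exp v \<notin> K"
        proof (cases "Im v = 0")
          case True
          then have "v = of_real (grid k j)" using v by (simp add: complex_eq_iff)
          then show ?thesis using near_grid_notin_E[of v k j] K(2) height_pos[of k] by auto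
        qed (rule unit_exp_notin_K)
      qed auto
      show "closed_segment (high k j) (low k j) \<subseteq> {v. Re v = grid k j \<and> \<bar>Im v\<bar> \<le> \<delta>}"
        using \<delta> by (auto simp: high_def low_def closed_segment_same_Re closed_segment_eq_real_ivl \<delta>_def)
    qed
    have ends: "low k N = low k 0 + 1" "high k N = high k 0 + 1"
      by (simp_all add: low_def high_def N_def grid_period complex_eq_iff)
    have "(\<Sum>j<N. ?I (low k j) (low k (Suc j)) + ?I (low k (Suc j)) (high k (Suc j)) +
        ?I (high k (Suc j)) (high k j) + ?I (high k j) (low k j)) =
      (\<Sum>j<N. ?I (low k j) (low k (Suc j))) - (\<Sum>j<N. ?I (high k j) (high k (Suc j))) +
      (\<Sum>j<N. ?I (low k (Suc j)) (high k (Suc j)) - ?I (low k j) (high k j))"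
      by (simp add: rev rev' sum.distrib sum_subtractf)
    also have "(\<Sum>j<N. ?I (low k (Suc j)) (high k (Suc j)) - ?I (low k j) (high k j)) =
        ?I (low k N) (high k N) - ?I (low k 0) (high k 0)"
      by (rule sum_lessThan_telescope)
    also have "?I (low k N) (high k N) = ?I (low k 0) (high k 0)"
      unfolding ends by (rule contour_integral_linepath_periodic) (simp add: H_def h_periodic)
    also have "(\<Sum>j<N. ?I (low k j) (low k (Suc j))) = ?I (low k 0) (low k N)"
      unfolding low_def using \<delta> by (intro contour_integral_split_horizontal contH grid_mono) (auto simp: \<delta>_def)
    also have "(\<Sum>j<N. ?I (high k j) (high k (Suc j))) = ?I (high k 0) (high k N)"
      unfolding high_def using \<delta> by (intro contour_integral_split_horizontal contH grid_mono) (auto simp: \<delta>_def)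
    also have "?I (high k 0) (high k N) = 0"
      unfolding ends H_def by (rule upper_integral[OF \<delta>]) (simp add: high_def \<delta>_def)
    finally have eq: "?I (low k 0) (low k N) = (\<Sum>j<N. ?I (low k j) (low k (Suc j)) +
        ?I (low k (Suc j)) (high k (Suc j)) + ?I (high k (Suc j)) (high k j) + ?I (high k j) (low k j))"
      by simp
    have "(\<lambda>n. - (u n * G n * of_real (exp (- 4 * pi * \<delta>)) ^ n)) sums ?I (low k 0) (low k N)"
      unfolding ends H_def by (rule lower_integral[OF \<delta>]) (simp add: low_def \<delta>_def)
    then have "(\<Sum>n. u n * G n * of_real (exp (- 4 * pi * \<delta>)) ^ n) = - ?I (low k 0) (low k N)"
      using sums_minus by (force simp: sums_iff)
    then have "norm (\<Sum>n. u n * G n * of_real (exp (- 4 * pi * \<delta>)) ^ n) = norm (?I (low k 0) (low k N))"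
      by simp
    also have "\<dots> \<le> real (card {..<N}) * (A * exp (B * \<delta> powr (- \<alpha>) - c * (216 * \<delta>) powr (- a)) / real q ^ k)"
      by (subst eq) (unfold H_def \<delta>_def, intro sum_norm_bound A(2))
    also have "\<dots> = A * exp (B * \<delta> powr (- \<alpha>) - c * (216 * \<delta>) powr (- a))"
      using q by (simp add: N_def)
    finally show ?thesis by (simp add: \<delta>_def)
  qed
  with A(1) show ?thesis using that by blast
qed

text \<open>As k grows, the bound tends to 0 because \<alpha> < a, and the dilated pairing tends to
  the pairing itself.\<close>

lemma pairing_zero: "(\<lambda>n. u n * G n) sums 0"
proof -
  obtain A where A: "A > 0" "\<And>k. norm (\<Sum>n. u n * G n * of_real (exp (- 4 * pi * height k)) ^ n)
    \<le> A * exp (B * height k powr (- \<alpha>) - c * (216 * height k) powr (- a))"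
    using partial_pairing_bound by blast
  have "(\<lambda>k. inverse (real q) ^ k) \<longlonglongrightarrow> 0" using q by (intro LIMSEQ_realpow_zero) (auto simp: field_simps)
  then have "(\<lambda>k. inverse (real q) ^ k * (1 / 24)) \<longlonglongrightarrow> 0 * (1 / 24)" by (intro tendsto_mult_right)
  then have height_lim: "height \<longlonglongrightarrow> 0"
    by (simp add: height_def[abs_def] field_simps power_inverse inverse_eq_divide)
  then have height_right: "filterlim height (at_right 0) sequentially"
    using height_pos by (intro tendsto_imp_filterlim_at_right) auto
  have "c * 216 powr (- a) > 0" using c by simp
  then have "((\<lambda>d. exp (B * d powr (- \<alpha>) - (c * 216 powr (- a)) * d powr (- a))) \<longlongrightarrow> 0) (at_right 0)"
    using a \<alpha> by (intro exp_powr_difference_tendsto_0) (auto simp: \<alpha>_def)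
  from filterlim_compose[OF this height_right]
  have "(\<lambda>k. exp (B * height k powr (- \<alpha>) - (c * 216 powr (- a)) * height k powr (- a))) \<longlonglongrightarrow> 0" .
  then have "(\<lambda>k. exp (B * height k powr (- \<alpha>) - c * (216 * height k) powr (- a))) \<longlonglongrightarrow> 0"
    using height_pos by (simp add: powr_mult less_imp_le mult.assoc)
  then have rhs: "(\<lambda>k. A * exp (B * height k powr (- \<alpha>) - c * (216 * height k) powr (- a))) \<longlonglongrightarrow> 0"
    by (rule tendsto_mult_right_zero)
  have "(\<lambda>k. \<Sum>n. u n * G n * of_real (exp (- 4 * pi * height k)) ^ n) \<longlonglongrightarrow> 0"
    by (rule Lim_null_comparison[OF always_eventually rhs]) (use A(2) in blast)
  moreover have "(\<lambda>k. \<Sum>n. u n * G n * of_real (exp (- 4 * pi * height k)) ^ n) \<longlonglongrightarrow> (\<Sum>n. u n * G n)"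
  \<comment> \<open>Dominated convergence for series, with the summable majorant
    \<open>norm (u n * G n)\<close>.\<close>
  proof (rule tannerys_theorem[THEN conjunct2, THEN conjunct2])
    show "(\<lambda>k. u n * G n * of_real (exp (- 4 * pi * height k)) ^ n) \<longlonglongrightarrow> u n * G n" for n
    proof -
      have "(\<lambda>k. u n * G n * of_real (exp (- 4 * pi * height k)) ^ n) \<longlonglongrightarrow> u n * G n * of_real (exp (- 4 * pi * 0)) ^ n"
        by (intro tendsto_intros height_lim)
      then show ?thesis by simp
    qed
    have "norm (u n * G n * of_real (exp (- 4 * pi * height k)) ^ n) \<le> norm (u n * G n)" for n k
      using height_pos[of k] by (simp add: norm_mult norm_power mult_left_le power_le_one)
    then show "\<forall>\<^sub>F (n, k) in at_top \<times>\<^sub>F sequentially.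
        norm (u n * G n * of_real (exp (- 4 * pi * height k)) ^ n) \<le> norm (u n * G n)"
      by (intro always_eventually) auto
  qed (use G(2) in auto)
  ultimately have "(\<Sum>n. u n * G n) = 0" by (rule LIMSEQ_unique[rotated])
  moreover have "summable (\<lambda>n. u n * G n)" using G(2) by (rule summable_norm_cancel)
  ultimately show ?thesis by (simp add: sums_iff)
qed

end

section \<open>Growth of the inverse powers\<close>

text \<open>Positivity of \<open>h\<close> at every index lets the constant absorb the finitely many
  exceptional indices.\<close>

lemma bigo_bound_all:
  fixes f h :: "nat \<Rightarrow> real"
  assumes "f \<in> O(h)" and h: "\<And>n. h n > 0"
  obtains C where "C > 0" "\<And>n. \<bar>f n\<bar> \<le> C * h n"
proof -
  obtain c where "c > 0" "\<forall>\<^sub>F n in sequentially. norm (f n) \<le> c * norm (h n)"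
    using landau_o.bigE[OF assms(1)] by blast
  then obtain N where c: "c > 0" "\<And>n. n \<ge> N \<Longrightarrow> \<bar>f n\<bar> \<le> c * h n"
    using h by (auto simp: eventually_sequentially abs_of_pos)
  define C where "C = c + (\<Sum>n<N. \<bar>f n\<bar> / h n)"
  have nn: "0 \<le> \<bar>f n\<bar> / h n" for n using h[of n] by simp
  have "\<bar>f n\<bar> \<le> C * h n" for n
  proof (cases "n < N")
    case True
    then have "\<bar>f n\<bar> / h n \<le> (\<Sum>n<N. \<bar>f n\<bar> / h n)" by (intro member_le_sum nn) auto
    then have "\<bar>f n\<bar> / h n \<le> C" using c(1) by (simp add: C_def)
    then show ?thesis using h[of n] by (simp add: field_simps)
  next
    case False
    then have "\<bar>f n\<bar> \<le> c * h n" by (intro c(2)) simp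
    also have "\<dots> \<le> C * h n"
      using h[of n] nn by (intro mult_right_mono) (auto simp: C_def sum_nonneg)
    finally show ?thesis .
  qed
  moreover have "C > 0" using c(1) nn by (simp add: C_def sum_nonneg add_pos_nonneg)
  ultimately show ?thesis using that by blast
qed

lemma onorm_funpow_le:
  fixes T :: "'a::complex_banach \<Rightarrow> 'a"
  assumes "bounded_clinear T"
  shows "norm ((T ^^ n) x) \<le> onorm (T ^^ n) * norm x" "0 \<le> onorm (T ^^ n)"
  using onorm[OF bounded_clinearD(1)[OF bounded_clinear_funpow[OF assms]]]
    onorm_pos_le[OF bounded_clinearD(1)[OF bounded_clinear_funpow[OF assms]]] by auto

lemma sums_zero_if_functionals:
  fixes y :: "nat \<Rightarrow> 'a::complex_banach"
  assumes "summable (\<lambda>n. norm (y n))"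
    and l: "\<And>l :: 'a \<Rightarrow> complex. bounded_clinear l \<Longrightarrow> (\<lambda>n. l (y n)) sums 0"
  shows "y sums 0"
proof -
  have s: "y sums suminf y" using summable_norm_cancel[OF assms(1)] by (rule summable_sums)
  have "suminf y = 0"
  proof (rule ccontr)
    assume "suminf y \<noteq> 0"
    then obtain l :: "'a \<Rightarrow> complex" where k: "bounded_clinear l" "l (suminf y) \<noteq> 0"
      using complex_functional_separates by blast
    have "(\<lambda>n. l (y n)) sums l (suminf y)"
      by (rule bounded_linear.sums[OF bounded_clinearD(1)[OF k(1)] s])
    with l[OF k(1)] k(2) show False using sums_unique2 by blast
  qed
  with s show ?thesis by simp
qed

text \<open>Both growth bounds feed the expansions of the resolvent on the two sides of the circle.
  Each functional of the series is then an instance of \<open>pairing_zero\<close>, and functionals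
  separate points.\<close>

lemma flat_series_annihilates:
  fixes T :: "'a::complex_banach \<Rightarrow> 'a"
  assumes q: "q \<ge> 3" and T: "invertible_operator T" and spec: "spectrum T \<subseteq> perfect_symmetric_set (1 / real q)"
    and fwd: "\<And>n. onorm (T ^^ n) \<le> C * exp (real n powr \<beta>)"
    and bwd: "\<And>n. onorm (inv T ^^ n) \<le> C * exp (real n powr \<beta>)"
    and \<beta>: "0 < \<beta>" "\<beta> < 1 / 2" and a: "\<beta> / (1 - \<beta>) < a"
    and g: "g holomorphic_on ball 0 1" "\<And>z. norm z < 1 \<Longrightarrow> (\<lambda>l. G l * z ^ l) sums g z"
    and G: "summable (\<lambda>l. norm (G l))" "summable (\<lambda>l. norm (G l) * onorm (T ^^ l))"
    and c: "c > 0" and flat: "\<And>z. z \<in> ball 0 1 \<Longrightarrow>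
      norm (g z) \<le> exp (- (c * infdist z (perfect_symmetric_set (1 / real q)) powr (- a)))"
  shows "(\<lambda>l. G l *\<^sub>C (T ^^ l) x) sums 0"
proof (rule sums_zero_if_functionals)
  note T' = invertible_operatorD[OF T]
  have fwd': "norm ((T ^^ n) x) \<le> C * norm x * exp (real n powr \<beta>)" for n
    using onorm_funpow_le(1)[OF T'(1), of n x] mult_right_mono[OF fwd[of n] norm_ge_zero[of x]]
    by (simp add: mult_ac)
  have bwd': "norm ((inv T ^^ n) x) \<le> C * norm x * exp (real n powr \<beta>)" for n
    using onorm_funpow_le(1)[OF T'(2), of n x] mult_right_mono[OF bwd[of n] norm_ge_zero[of x]]
    by (simp add: mult_ac)
  have G2: "summable (\<lambda>l. norm (G l *\<^sub>C (T ^^ l) x))"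
  proof (rule summable_comparison_test')
    show "summable (\<lambda>l. norm (G l) * onorm (T ^^ l) * norm x)" by (rule summable_mult2[OF G(2)])
    show "norm (norm (G l *\<^sub>C (T ^^ l) x)) \<le> norm (G l) * onorm (T ^^ l) * norm x" for l
      using mult_left_mono[OF onorm_funpow_le(1)[OF T'(1), of l x], of "norm (G l)"]
      by (simp add: norm_scaleC mult_ac)
  qed
  then show "summable (\<lambda>l. norm (G l *\<^sub>C (T ^^ l) x))" .
  have A0: "summable (\<lambda>n. exp (real n powr \<beta> - y * real n))" if "y > 0" for y
    using summable_exp_powr[of \<beta> y] \<beta> that by simp
  fix k :: "'a \<Rightarrow> complex" assume k: "bounded_clinear k"
  obtain L where L: "L > 0" "\<And>x. norm (k x) \<le> norm x * L"
    using bounded_linear.pos_bounded[OF bounded_clinearD(1)[OF k]] by auto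
  have kb: "norm (k y) \<le> L * (C * norm x) * e" if "norm y \<le> C * norm x * e" for y e
  proof -
    have "norm y * L \<le> (C * norm x * e) * L" using that L(1) by (intro mult_right_mono) auto
    moreover have "(C * norm x * e) * L = L * (C * norm x) * e" by simp
    ultimately show ?thesis using L(2)[of y] by linarith
  qed
  have notin: "z \<notin> spectrum T" if "norm z \<noteq> 1" for z
    using that spec norm_perfect_symmetric_set by blast
  interpret cantor_pairing q "spectrum T" "\<lambda>z. k (resolvent T z x)" "\<lambda>n. k ((T ^^ n) x)"
    "\<lambda>n. k ((inv T ^^ Suc n) x)" "L * (C * norm x)" \<beta> g G c a
  proof
    show "3 \<le> q" "closed (spectrum T)" "spectrum T \<subseteq> perfect_symmetric_set (1 / real q)"
      using q spec closed_spectrum[OF T'(1)] by auto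
    show "(\<lambda>z. k (resolvent T z x)) holomorphic_on - spectrum T"
      by (rule holomorphic_on_resolvent[OF T'(1) k])
    show "(\<lambda>n. k ((T ^^ n) x) * inverse z ^ n) sums - (z * k (resolvent T z x))" if z: "1 < norm z" for z
    proof (rule resolvent_Laurent_outside[OF T'(1) k])
      show "z \<notin> spectrum T" using z by (intro notin) simp
      show "z \<noteq> 0" using z by auto
      show "summable (\<lambda>n. norm ((T ^^ n) x) * inverse (norm z) ^ n)"
      proof (rule summable_comparison_test')
        show "summable (\<lambda>n. C * norm x * exp (real n powr \<beta> - ln (norm z) * real n))"
          using z by (intro summable_mult A0 ln_gt_zero)
        show "norm (norm ((T ^^ n) x) * inverse (norm z) ^ n) \<le> C * norm x * exp (real n powr \<beta> - ln (norm z) * real n)" for n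
        proof -
          have "0 < norm z" using z by linarith
          then have "exp (ln (norm z) * real n) = norm z ^ n"
            by (simp add: exp_of_nat2_mult)
          then have "exp (real n powr \<beta> - ln (norm z) * real n) = exp (real n powr \<beta>) * inverse (norm z) ^ n"
            by (simp add: exp_diff field_simps)
          then show ?thesis
            using mult_right_mono[OF fwd'[of n], of "inverse (norm z) ^ n"] by (simp add: mult_ac)
        qed
      qed
    qed
    show "(\<lambda>n. k ((inv T ^^ Suc n) x) * z ^ n) sums k (resolvent T z x)" if z: "norm z < 1" for z
    proof (rule resolvent_power_series_inside[OF T k])
      show "z \<notin> spectrum T" using z by (intro notin) simp
      show "summable (\<lambda>n. norm ((inv T ^^ Suc n) x) * norm z ^ n)"
      proof (cases "z = 0")
        case True
        then show ?thesis by (intro summable_finite[of "{0}"]) auto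
      next
        case False
        define y where "y = - ln (norm z)"
        have y: "y > 0" "norm z = exp (- y)" using z False by (auto simp: y_def)
        show ?thesis
        proof (rule summable_comparison_test')
          show "summable (\<lambda>n. C * norm x * exp y * exp (real (Suc n) powr \<beta> - y * real (Suc n)))"
            using A0[OF y(1)] by (intro summable_mult) (subst summable_Suc_iff)
          show "norm (norm ((inv T ^^ Suc n) x) * norm z ^ n) \<le>
              C * norm x * exp y * exp (real (Suc n) powr \<beta> - y * real (Suc n))" for n
          proof -
            have "exp y * exp (real (Suc n) powr \<beta> - y * real (Suc n)) = exp (real (Suc n) powr \<beta>) * norm z ^ n"
              unfolding y(2) by (simp add: exp_diff exp_minus exp_add ring_distribs field_simps flip: exp_of_nat_mult)
            then show ?thesis
              using mult_right_mono[OF bwd'[of "Suc n"], of "norm z ^ n"] by (simp add: mult_ac del: funpow.simps)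
          qed
        qed
      qed
    qed
    show "norm (k ((T ^^ n) x)) \<le> L * (C * norm x) * exp (real n powr \<beta>)" for n
      by (rule kb[OF fwd'])
    show "norm (k ((inv T ^^ Suc n) x)) \<le> L * (C * norm x) * exp (real (Suc n) powr \<beta>)" for n
      by (rule kb[OF bwd'])
    show "summable (\<lambda>l. norm (k ((T ^^ l) x) * G l))"
    proof (rule summable_comparison_test')
      show "summable (\<lambda>l. norm (G l *\<^sub>C (T ^^ l) x) * L)" by (rule summable_mult2[OF G2])
      show "norm (norm (k ((T ^^ l) x) * G l)) \<le> norm (G l *\<^sub>C (T ^^ l) x) * L" for l
        using mult_left_mono[OF L(2)[of "(T ^^ l) x"], of "norm (G l)"]
        by (simp add: norm_scaleC norm_mult mult_ac)
    qed
  qed (use \<beta> a g G c flat in auto)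
  show "(\<lambda>l. k (G l *\<^sub>C (T ^^ l) x)) sums 0"
    using pairing_zero by (simp add: bounded_clinearD(2)[OF k] scaleC_complex_def mult.commute)
qed

text \<open>The power map sends \<open>E\<close> into itself and is Lipschitz with constant q^p on
  the closed disc; hence f(z^N) inherits flatness on \<open>E\<close>.\<close>

lemma infdist_power_le:
  assumes q: "q \<ge> 3" and z: "norm z < 1"
  shows "infdist (z ^ (q ^ p)) (perfect_symmetric_set (1 / real q)) \<le>
    real (q ^ p) * infdist z (perfect_symmetric_set (1 / real q))"
proof -
  let ?E = "perfect_symmetric_set (1 / real q)"
  have pos: "real (q ^ p) > 0" using q by simp
  have "infdist (z ^ (q ^ p)) ?E / real (q ^ p) \<le> dist z e" if e: "e \<in> ?E" for e
  proof -
    have "infdist (z ^ (q ^ p)) ?E \<le> dist (z ^ (q ^ p)) (e ^ (q ^ p))"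
      by (rule infdist_le[OF unit_exp_power_in_cantor[OF q e]])
    also have "\<dots> \<le> real (q ^ p) * dist z e"
      unfolding dist_norm using z norm_perfect_symmetric_set[OF e] by (intro norm_power_diff) auto
    finally show ?thesis using pos by (simp add: field_simps)
  qed
  then have "infdist (z ^ (q ^ p)) ?E / real (q ^ p) \<le> infdist z ?E"
    using one_in_perfect_symmetric_set[of q] by (auto simp: infdist_def[of z] intro!: cINF_greatest)
  then show ?thesis using pos by (simp add: field_simps)
qed

lemma sums_power_subsequence:
  fixes y :: "nat \<Rightarrow> 'a::real_normed_vector"
  assumes "N > 0" and "\<And>m. \<not> N dvd m \<Longrightarrow> y m = 0"
  shows "(\<lambda>l. y (l * N)) sums s \<longleftrightarrow> y sums s"
proof (rule sums_mono_reindex)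
  show "strict_mono (\<lambda>l. l * N)" using assms(1) by (auto simp: strict_mono_def)
  show "y m = 0" if "m \<notin> range (\<lambda>l. l * N)" for m
    using that by (intro assms(2)) (auto elim!: dvdE simp: mult.commute)
qed

text \<open>With L = ln q, b/(1-b) = 1 - ln 2/L. So there is room for \<open>a\<close> between
  \<beta>'/(1-\<beta>') and this number, and then for \<sigma> between a + ln 2/L and 1, which is
  the last inequality after exponentiation.\<close>

lemma growth_exponent_parameters:
  assumes q: "q \<ge> 3" and \<beta>: "\<beta> < growth_exponent (1 / real q)"
  obtains \<beta>' a \<sigma> where "\<beta> \<le> \<beta>'" "0 < \<beta>'" "\<beta>' < 1 / 2" "\<beta>' / (1 - \<beta>') < a" "0 < a" "a < \<sigma>" "\<sigma> < 1"
    "2 * real q powr a < real q powr \<sigma>"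
proof -
  define L where "L = ln (real q)"
  define b where "b = (L - ln 2) / (2 * L - ln 2)"
  have L: "L > ln 2" unfolding L_def using q by simp
  have ln2: "ln 2 > (0::real)" by simp
  have b_eq: "growth_exponent (1 / real q) = b"
    using q by (simp add: growth_exponent_def b_def L_def ln_div)
  have den: "2 * L - ln 2 > 0" using L ln2 by linarith
  have b: "0 < b" "b < 1 / 2" using L ln2 den by (simp_all add: b_def pos_divide_less_eq)
  \<comment> \<open>\<beta> may be negative or 0; raising it to b/2 makes it positive and keeps it
    below b.\<close>
  define \<beta>' where "\<beta>' = max \<beta> (b / 2)"
  have \<beta>': "\<beta> \<le> \<beta>'" "0 < \<beta>'" "\<beta>' < b" using b \<beta> by (auto simp: \<beta>'_def b_eq)
  have "\<beta>' * (2 * L - ln 2) < L - ln 2"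
    using \<beta>'(3) L ln2 by (simp add: b_def pos_less_divide_eq)
  then have "\<beta>' * L < (L - ln 2) * (1 - \<beta>')" by (simp add: algebra_simps)
  then have lt: "\<beta>' / (1 - \<beta>') < (L - ln 2) / L"
    using \<beta>' b less_trans[OF ln2 L] by (simp add: pos_divide_less_eq pos_less_divide_eq)
  obtain a where a: "\<beta>' / (1 - \<beta>') < a" "a < (L - ln 2) / L" using dense[OF lt] by blast
  have "0 < \<beta>' / (1 - \<beta>')" using \<beta>' b by (intro divide_pos_pos) auto
  with a have a0: "0 < a" by linarith
  have aL: "a + ln 2 / L < 1" using a(2) less_trans[OF ln2 L] by (simp add: field_simps)
  obtain \<sigma> where \<sigma>: "a + ln 2 / L < \<sigma>" "\<sigma> < 1" using dense[OF aL] by blast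
  have "0 < ln 2 / L" using less_trans[OF ln2 L] by simp
  then have "a < \<sigma>" using \<sigma> by linarith
  have "a * L + ln 2 < \<sigma> * L"
    using mult_strict_right_mono[OF \<sigma>(1), of L] less_trans[OF ln2 L] by (simp add: distrib_right)
  then have "exp (a * L + ln 2) < exp (\<sigma> * L)" by simp
  then have "2 * real q powr a < real q powr \<sigma>"
    using q by (simp add: powr_def L_def exp_add mult.commute)
  with \<beta>' b a a0 \<sigma> \<open>a < \<sigma>\<close> show ?thesis by (intro that[of \<beta>' a \<sigma>]) auto
qed

lemma exists_power_between:
  assumes "q \<ge> (2::nat)" "n \<ge> 1"
  obtains p where "n \<le> q ^ p" "q ^ p \<le> q * n"
proof -
  define p where "p = (LEAST p. n \<le> q ^ p)"
  have "n < q ^ n" using assms(1) by (intro power_gt_expt) auto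
  then have "\<exists>p. n \<le> q ^ p" by (intro exI[of _ n]) simp
  then have p: "n \<le> q ^ p" unfolding p_def by (rule LeastI_ex)
  have "q ^ p \<le> q * n"
  proof (cases p)
    case 0
    then show ?thesis using assms by simp
  next
    case (Suc j)
    then have "\<not> n \<le> q ^ j" using not_less_Least[of j "\<lambda>p. n \<le> q ^ p"] by (simp add: p_def)
    then show ?thesis by (simp add: Suc)
  qed
  with p that show ?thesis by blast
qed

text \<open>Applying the annihilating series to \<open>(inv T ^^ n) x\<close> expresses this vector by powers
  \<open>T ^^ (l * N - n)\<close> with \<open>l \<ge> 1\<close>.\<close>

lemma inverse_power_bound:
  fixes T :: "'a::complex_banach \<Rightarrow> 'a"
  assumes T: "invertible_operator T" and n: "1 \<le> n" "n \<le> N" and s: "s \<ge> 0"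
    and fwd: "\<And>n. onorm (T ^^ n) \<le> C * (real n + 1) powr s" and C: "C \<ge> 0"
    and coef: "coef 0 \<noteq> 0" "summable (\<lambda>l. norm (coef l) * (real l + 1) powr s)"
    and zero: "\<And>x. (\<lambda>l. coef l *\<^sub>C (T ^^ (l * N)) x) sums 0"
  shows "onorm (inv T ^^ n) \<le> C * (\<Sum>l. norm (coef l) * (real l + 1) powr s) / norm (coef 0) * real N powr s"
proof (rule onorm_bound)
  note T' = invertible_operatorD[OF T]
  have "0 \<le> (\<Sum>l. norm (coef l) * (real l + 1) powr s)"
    by (intro suminf_nonneg coef(2)) auto
  then show "0 \<le> C * (\<Sum>l. norm (coef l) * (real l + 1) powr s) / norm (coef 0) * real N powr s"
    using C by (intro mult_nonneg_nonneg divide_nonneg_nonneg) auto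
  define S where "S = (\<Sum>l. norm (coef l) * (real l + 1) powr s)"
  fix x :: 'a
  let ?y = "(inv T ^^ n) x"
  have shift: "(T ^^ m) ?y = (T ^^ (m - n)) x" if "n \<le> m" for m
  proof -
    have "(T ^^ j) ((inv T ^^ j) z) = z" for j z
      by (induction j arbitrary: z) (simp_all add: funpow_swap1 T'(3))
    then have "(T ^^ (m - n)) ((T ^^ n) ?y) = (T ^^ (m - n)) x" by simp
    moreover have "T ^^ m = T ^^ (m - n) \<circ> T ^^ n" using that funpow_add[of "m - n" n T] by simp
    ultimately show ?thesis by simp
  qed
  \<comment> \<open>The term l = 0 contains the vector \<open>?y\<close> itself and is moved to the
    right side.\<close>
  have "(\<lambda>l. coef (Suc l) *\<^sub>C (T ^^ (Suc l * N)) ?y) sums (0 - coef 0 *\<^sub>C (T ^^ (0 * N)) ?y)"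
    using zero[of ?y] by (subst sums_Suc_iff) simp
  moreover have "(T ^^ (Suc l * N)) ?y = (T ^^ (Suc l * N - n)) x" for l
    using n by (intro shift) (simp add: trans_le_add1)
  ultimately have sums: "(\<lambda>l. coef (Suc l) *\<^sub>C (T ^^ (Suc l * N - n)) x) sums (- (coef 0 *\<^sub>C ?y))"
    by simp
  have le: "norm (coef (Suc l) *\<^sub>C (T ^^ (Suc l * N - n)) x) \<le>
      C * real N powr s * norm x * (norm (coef (Suc l)) * (real (Suc l) + 1) powr s)" for l
  proof -
    have "real (Suc l * N - n) + 1 \<le> (real (Suc l) + 1) * real N"
    proof -
      have "n \<le> Suc l * N" using n by (simp add: trans_le_add1)
      then have "real (Suc l * N - n) = real (Suc l) * real N - real n" by (simp add: of_nat_diff algebra_simps)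
      then show ?thesis using n by (simp add: algebra_simps)
    qed
    then have "(real (Suc l * N - n) + 1) powr s \<le> ((real (Suc l) + 1) * real N) powr s"
      using s by (intro powr_mono2) auto
    also have "\<dots> = (real (Suc l) + 1) powr s * real N powr s" by (simp add: powr_mult)
    finally have "C * (real (Suc l * N - n) + 1) powr s \<le> C * ((real (Suc l) + 1) powr s * real N powr s)"
      using C by (rule mult_left_mono)
    with fwd[of "Suc l * N - n"] have "onorm (T ^^ (Suc l * N - n)) \<le> C * ((real (Suc l) + 1) powr s * real N powr s)"
      by linarith
    then have "norm ((T ^^ (Suc l * N - n)) x) \<le> C * ((real (Suc l) + 1) powr s * real N powr s) * norm x"
      using onorm_funpow_le(1)[OF T'(1), of "Suc l * N - n" x] by (meson mult_right_mono norm_ge_zero order_trans)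
    then have "norm (coef (Suc l)) * norm ((T ^^ (Suc l * N - n)) x) \<le>
        norm (coef (Suc l)) * (C * ((real (Suc l) + 1) powr s * real N powr s) * norm x)"
      by (intro mult_left_mono) auto
    then show ?thesis by (simp add: norm_scaleC mult_ac)
  qed
  have summ: "summable (\<lambda>l. norm (coef (Suc l)) * (real (Suc l) + 1) powr s)"
    using coef(2) by (subst summable_Suc_iff)
  have "norm (coef 0) * norm ?y = norm (\<Sum>l. coef (Suc l) *\<^sub>C (T ^^ (Suc l * N - n)) x)"
    using sums by (simp add: sums_iff norm_scaleC)
  also have "\<dots> \<le> (\<Sum>l. C * real N powr s * norm x * (norm (coef (Suc l)) * (real (Suc l) + 1) powr s))"
    using le summ by (intro norm_suminf_le summable_mult)
  also have "\<dots> = C * real N powr s * norm x * (\<Sum>l. norm (coef (Suc l)) * (real (Suc l) + 1) powr s)"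
    by (rule suminf_mult[OF summ])
  also have "\<dots> \<le> C * real N powr s * norm x * S"
    using C suminf_split_head[OF coef(2)] by (intro mult_left_mono) (auto simp: S_def)
  finally show "norm ?y \<le> C * S / norm (coef 0) * real N powr s * norm x"
    using coef(1) by (simp add: field_simps)
qed

theorem theorem2p2:
  fixes s \<beta> :: real and q :: nat and T :: "'a::complex_banach \<Rightarrow> 'a"
  assumes "s \<ge> 0" and "q \<ge> 3"
    and "bounded_clinear T" and "invertible_operator T"
    and "spectrum T \<subseteq> perfect_symmetric_set (1 / real q)"
    and "(\<lambda>n::nat. onorm (T ^^ n)) \<in> O(\<lambda>n. real n powr s)"
    and "\<beta> < growth_exponent (1 / real q)"
    and "(\<lambda>n::nat. onorm (inv T ^^ n)) \<in> O(\<lambda>n. exp (real n powr \<beta>))"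
  shows "(\<lambda>n::nat. onorm (inv T ^^ n)) \<in> O(\<lambda>n. real n powr s)"
proof -
  note T = invertible_operatorD[OF assms(4)]
  obtain \<beta>' a \<sigma> where par: "\<beta> \<le> \<beta>'" "0 < \<beta>'" "\<beta>' < 1 / 2" "\<beta>' / (1 - \<beta>') < a" "0 < a" "a < \<sigma>" "\<sigma> < 1"
    "2 * real q powr a < real q powr \<sigma>"
    using growth_exponent_parameters[OF assms(2,7)] by blast
  interpret cantor_flat_function q a \<sigma>
    using par assms(2) by unfold_locales auto
  \<comment> \<open>\<open>real n powr s\<close> vanishes at n = 0, so a bound valid for all n needs
    the shifted power.\<close>
  have "(\<lambda>n. real n powr s) \<in> O(\<lambda>n. (real n + 1) powr s)"
    using assms(1) by (intro landau_o.big_mono always_eventually) (auto intro!: powr_mono2)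
  from landau_o.big_trans[OF assms(6) this]
  obtain C1 where C1: "C1 > 0" "\<And>n. \<bar>onorm (T ^^ n)\<bar> \<le> C1 * (real n + 1) powr s"
    by (rule bigo_bound_all) auto
  \<comment> \<open>As \<beta>' > 0, polynomial growth is below exp(n^\<beta>'), so one type of
    bound covers both directions.\<close>
  have "(\<lambda>n. (real n + 1) powr s) \<in> O(\<lambda>n. exp (real n powr \<beta>'))"
    using par(2) by real_asymp
  then obtain C2 where C2: "C2 > 0" "\<And>n. \<bar>(real n + 1) powr s\<bar> \<le> C2 * exp (real n powr \<beta>')"
    by (rule bigo_bound_all) auto
  have "\<forall>\<^sub>F n in sequentially. exp (real n powr \<beta>) \<le> exp (real n powr \<beta>')"
    using eventually_ge_at_top[of 1] by eventually_elim (use par(1) in \<open>auto intro!: powr_mono\<close>)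
  then have "(\<lambda>n. exp (real n powr \<beta>)) \<in> O(\<lambda>n. exp (real n powr \<beta>'))"
    by (intro landau_o.big_mono) simp
  from landau_o.big_trans[OF assms(8) this]
  obtain C3 where C3: "C3 > 0" "\<And>n. \<bar>onorm (inv T ^^ n)\<bar> \<le> C3 * exp (real n powr \<beta>')"
    by (rule bigo_bound_all) auto
  define C where "C = max (C1 * C2) C3"
  have fwd: "onorm (T ^^ n) \<le> C * exp (real n powr \<beta>')" for n
  proof -
    have "C1 * (real n + 1) powr s \<le> C1 * (C2 * exp (real n powr \<beta>'))"
      using C2(2)[of n] C1(1) by (intro mult_left_mono) auto
    also have "\<dots> \<le> C * exp (real n powr \<beta>')"
      unfolding mult.assoc[symmetric] C_def by (intro mult_right_mono) auto
    finally show ?thesis using C1(2)[of n] by linarith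
  qed
  have bwd: "onorm (inv T ^^ n) \<le> C * exp (real n powr \<beta>')" for n
  proof -
    have "C3 * exp (real n powr \<beta>') \<le> C * exp (real n powr \<beta>')"
      unfolding C_def by (intro mult_right_mono) auto
    then show ?thesis using C3(2)[of n] by linarith
  qed
  have zero: "(\<lambda>l. coef l *\<^sub>C (T ^^ (l * q ^ p)) x) sums 0" for p x
  proof -
    define N where "N = q ^ p"
    have N: "N > 0" using q by (simp add: N_def)
    \<comment> \<open>The Taylor coefficients of f(z^N).\<close>
    define G where "G m = (if N dvd m then coef (m div N) else 0)" for m
    have G_mult: "G (l * N) = coef l" for l using N by (simp add: G_def)
    have G_zero: "G m = 0" if "\<not> N dvd m" for m using that by (simp add: G_def)
    have "(\<lambda>l. G l *\<^sub>C (T ^^ l) x) sums 0"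
    proof (rule flat_series_annihilates[OF assms(2,4,5) fwd bwd par(2,3,4), where g = "\<lambda>z. f (z ^ N)"
          and c = "c0 * real N powr (- a)"])
      have "(f \<circ> (\<lambda>z. z ^ N)) holomorphic_on ball 0 1"
        using N by (intro holomorphic_on_compose_gen[OF _ holomorphic_on_f] holomorphic_intros)
          (auto simp: norm_power power_less_one_iff)
      then show "(\<lambda>z. f (z ^ N)) holomorphic_on ball 0 1" by (simp add: o_def)
      show "(\<lambda>l. G l * z ^ l) sums f (z ^ N)" if "norm z < 1" for z
      proof -
        have "(\<lambda>l. coef l * (z ^ N) ^ l) sums f (z ^ N)"
          using that N by (intro coef_sums) (simp add: norm_power power_less_one_iff)
        then have "(\<lambda>l. G (l * N) * z ^ (l * N)) sums f (z ^ N)"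
          by (simp add: G_mult power_mult mult.commute flip: power_mult)
        then show ?thesis by (subst (asm) sums_power_subsequence[OF N]) (simp_all add: G_zero)
      qed
      have "summable (\<lambda>l. norm (coef l))" using summable_coef[of 0] by simp
      then have "(\<lambda>l. norm (G (l * N))) sums (\<Sum>l. norm (coef l))"
        by (simp add: G_mult summable_sums)
      then show "summable (\<lambda>l. norm (G l))"
        by (subst (asm) sums_power_subsequence[OF N]) (simp_all add: G_zero sums_iff)
      have "summable (\<lambda>l. norm (coef l) * onorm (T ^^ (l * N)))"
      proof (rule summable_comparison_test')
        show "summable (\<lambda>l. C1 * real N powr s * (norm (coef l) * (real l + 1) powr s))"
          by (intro summable_mult summable_coef)
        show "norm (norm (coef l) * onorm (T ^^ (l * N))) \<le> C1 * real N powr s * (norm (coef l) * (real l + 1) powr s)" for l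
        proof -
          have "onorm (T ^^ (l * N)) \<le> C1 * (real (l * N) + 1) powr s" using C1(2)[of "l * N"] by linarith
          also have "\<dots> \<le> C1 * ((real l + 1) * real N) powr s"
            using C1(1) N assms(1) by (intro mult_left_mono powr_mono2) (auto simp: algebra_simps)
          also have "\<dots> = C1 * real N powr s * (real l + 1) powr s" by (simp add: powr_mult)
          finally have "norm (coef l) * onorm (T ^^ (l * N)) \<le> norm (coef l) * (C1 * real N powr s * (real l + 1) powr s)"
            by (intro mult_left_mono) auto
          then show ?thesis using onorm_funpow_le(2)[OF T(1), of "l * N"] by (simp add: mult_ac)
        qed
      qed
      then have "(\<lambda>l. norm (G (l * N)) * onorm (T ^^ (l * N))) sums (\<Sum>l. norm (coef l) * onorm (T ^^ (l * N)))"
        by (simp add: G_mult summable_sums)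
      then show "summable (\<lambda>l. norm (G l) * onorm (T ^^ l))"
        by (subst (asm) sums_power_subsequence[OF N, where y = "\<lambda>l. norm (G l) * onorm (T ^^ l)"])
           (simp_all add: G_zero sums_iff)
      show "0 < c0 * real N powr (- a)" using c0_pos N by simp
      show "norm (f (z ^ N)) \<le> exp (- (c0 * real N powr (- a) * infdist z E powr (- a)))" if z: "z \<in> ball 0 1" for z
      proof -
        have zN: "z ^ N \<in> ball 0 1" using z N by (simp add: norm_power power_less_one_iff)
        have "norm (f (z ^ N)) \<le> exp (- (c0 * infdist (z ^ N) E powr (- a)))"
          by (rule norm_f_le[OF zN mem_U[OF zN]])
        also have "\<dots> \<le> exp (- (c0 * (real N * infdist z E) powr (- a)))"
          using infdist_power_le[OF q, of z p] z par(5) c0_pos infdist_perfect_symmetric_set(1)[OF zN, of q]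
          by (auto simp: N_def intro!: powr_mono2')
        also have "(real N * infdist z E) powr (- a) = real N powr (- a) * infdist z E powr (- a)"
          by (simp add: powr_mult infdist_nonneg)
        finally show ?thesis by (simp add: mult.assoc)
      qed
    qed
    then show ?thesis
      using sums_power_subsequence[OF N, of "\<lambda>l. G l *\<^sub>C (T ^^ l) x" 0]
      by (simp add: G_zero G_mult scaleC_zero_left N_def[symmetric])
  qed
  define S where "S = (\<Sum>l. norm (coef l) * (real l + 1) powr s)"
  have S: "S \<ge> 0" unfolding S_def by (intro suminf_nonneg summable_coef) auto
  have bound: "norm (onorm (inv T ^^ n)) \<le> C1 * S / norm (coef 0) * real q powr s * norm (real n powr s)" if n: "n \<ge> 1" for n
  proof -
    \<comment> \<open>The power N = q^p varies with \<open>n\<close> but stays below q n, which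
      costs the factor q^s; \<open>coef\<close> and \<open>S\<close> are the same for every N, so
      the constant is uniform in \<open>n\<close>.\<close>
    obtain p where p: "n \<le> q ^ p" "q ^ p \<le> q * n"
      using exists_power_between[of q n] q n by auto
    have "onorm (inv T ^^ n) \<le> C1 * S / norm (coef 0) * real (q ^ p) powr s"
      unfolding S_def
    proof (rule inverse_power_bound[OF assms(4) n p(1) assms(1)])
      show "onorm (T ^^ n) \<le> C1 * (real n + 1) powr s" for n using C1(2)[of n] by linarith
    qed (use C1(1) coef_0 summable_coef zero in auto)
    also have "\<dots> \<le> C1 * S / norm (coef 0) * (real q * real n) powr s"
      using p(2) assms(1) C1(1) S
      by (intro mult_left_mono powr_mono2) (auto simp flip: of_nat_mult of_nat_power)
    also have "\<dots> = C1 * S / norm (coef 0) * real q powr s * real n powr s" by (simp add: powr_mult)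
    finally show ?thesis using onorm_funpow_le(2)[OF T(2), of n] by simp
  qed
  show ?thesis
  proof (rule bigoI)
    show "\<forall>\<^sub>F n in sequentially. norm (onorm (inv T ^^ n)) \<le>
        C1 * S / norm (coef 0) * real q powr s * norm (real n powr s)"
      using eventually_ge_at_top[of 1] by eventually_elim (rule bound)
  qed
qed

end
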